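(* For a typical map $f\in\mathcal C[0,1]$ the following hold: $$\mathrm{Per}_f\subset\bigcap_{q\ge1}\overline{\mathrm{AShr}_{\varepsilon,q}\mathrm{Per}_f}\qquad\text{for all }\varepsilon>0,$$ and therefore $$\bigcap_{\varepsilon>0}\bigcap_{q\ge1}\overline{\mathrm{AShr}_{\varepsilon,q}\mathrm{Per}_f}=\mathcal O_f=\overline{\mathrm{Shr}_f}=\overline{\mathcal E_f}=\overline{\mathrm{Per}_f}.$$ In particular, any ergodic $f$-invariant measure is pseudo-physical for $f$.
   Context: $\mathcal C[0,1]$ is the space of continuous maps of $[0,1]$ to itself, with the uniform metric. A property is typical ("holds for a typical map") if there is a dense $G_\delta$ subset $G\subset\mathcal C[0,1]$ such that all $f\in G$ have the property. "Measure" means Borel probability measure on $[0,1]$. Fix a countable dense subset $\{\Psi_i\}_{i\in\mathbb N}$ of $\mathcal C[0,1]$ and let $\mathrm{dist}(\mu,\nu)=\sum_{i\ge1}2^{-i}\left|\int\Psi_i\,d\mu-\int\Psi_i\,d\nu\right|$, which induces the weak$^*$ topology; closures (overlines) of sets of measures are in this topology. For $x\in[0,1]$, $p\omega(x)$ is the set of weak$^*$ limits of convergent subsequences of $\frac1n\sum_{j=0}^{n-1}\delta_{f^j(x)}$, and $\mathrm{dist}(p\omega(x),\mu)=\inf_{\nu\in p\omega(x)}\mathrm{dist}(\nu,\mu)$. A measure $\mu$ is pseudo-physical for $f$ if for every $\varepsilon>0$ the set $\{x\in[0,1]:\mathrm{dist}(p\omega(x),\mu)<\varepsilon\}$ has positive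 Lebesgue measure; $\mathcal O_f$ is the set of pseudo-physical measures for $f$. $\mathcal M_f$ is the set of $f$-invariant measures, $\mathcal E_f$ the set of ergodic $f$-invariant measures, and $\mathrm{Per}_f$ the set of measures $\frac1p\sum_{j=0}^{p-1}\delta_{f^j(x_0)}$ with $x_0$ a periodic point of period $p$ of $f$. A periodic shrinking interval of period $p\ge1$ for $f$ is a nonempty open interval $I\subset[0,1]$ such that the sets $f^j(\overline I)$, $0\le j\le p-1$, are pairwise disjoint, $f^p(\overline I)\subset I$, and $\mathrm{length}(f^j(I))<\mathrm{length}(I)$ for all $1\le j\le p-1$. An $f$-invariant measure $\mu$ is infinitely shrinked if there is a sequence $\{I_q\}_{q\ge1}$ of periodic shrinking intervals, of periods $p_q$, with $\mathrm{length}(I_q)<1/q$ and $\mu\big(\bigcup_{j=1}^{p_q}f^j(\overline{I_q})\big)=1$ for all $q\ge1$; $\mathrm{Shr}_f$ is the set of these measures. For $q\ge1$, $\mathrm{Shr}_q\mathrm{Per}_f$ is the set of $\nu\in\mathrm{Per}_f$ for which there is a periodic shrinking interval $I$, of some period $p\ge 1$ and length smaller than $1/q$, such that $\nu$ is supported on $\bigcup_{j=1}^pf^j(\overline I)$. For $\varepsilon>0$, $\mathrm{AShr}_{\varepsilon,q}\mathrm{Per}_f$ is the set of $f$-invariant measures $\mu$ for which there is $\nu\in\mathrm{Shr}_q\mathrm{Per}_f$ with $\mathrm{dist}(\mu,\nu)<\varepsilon$. *)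

theory Defs
  imports "HOL-Probability.Probability"
begin

section \<open>Continuous self-maps of the unit interval\<close>

text \<open>The elements of \<^term>\<open>cfunspace\<close> are extensional: maps of the interval are represented by
  functions that are \<^term>\<open>undefined\<close> outside it, so that equality is equality on the interval.\<close>

definition self_maps :: "(real \<Rightarrow> real) metric" where
  "self_maps = cfunspace (top_of_set {0..1}) (submetric euclidean_metric {0..1})"

lemma mspace_self_maps:
  "mspace self_maps = {f. continuous_on {0..1} f \<and> f \<in> {0..1} \<rightarrow> {0..1} \<and> f \<in> extensional {0..1}}"
  unfolding self_maps_def
  by (subst compactin_mspace_cfunspace) (auto simp: mtopology_of_submetric continuous_map_in_subtopology)

definition dense_in_space :: "'a topology \<Rightarrow> 'a set \<Rightarrow> bool" where
  "dense_in_space X S \<longleftrightarrow> S \<subseteq> topspace X \<and> X closure_of S = topspace X"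

definition holds_typically :: "((real \<Rightarrow> real) \<Rightarrow> bool) \<Rightarrow> bool" where
  "holds_typically P \<longleftrightarrow>
     (\<exists>G. gdelta_in (mtopology_of self_maps) G \<and> dense_in_space (mtopology_of self_maps) G \<and>
          (\<forall>f\<in>G. P f))"


section \<open>Borel probability measures on the unit interval\<close>

definition unit_borel :: "real measure" where
  "unit_borel = restrict_space borel {0..1}"

definition unit_probs :: "real measure set" where
  "unit_probs = space (prob_algebra unit_borel)"

lemma unit_probs_iff:
  "\<mu> \<in> unit_probs \<longleftrightarrow> prob_space \<mu> \<and> sets \<mu> = sets (restrict_space borel {0..1})"
  by (auto simp: unit_probs_def unit_borel_def space_prob_algebra)

text \<open>The coarsest topology for which integration against every continuous real function on the
  interval is continuous.\<close>

definition weak_star :: "real measure topology" where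
  "weak_star =
     pullback_topology unit_probs
       (\<lambda>\<mu>. \<lambda>\<phi>\<in>{\<phi>. continuous_on {0..1} \<phi>}. integral\<^sup>L \<mu> \<phi>)
       (product_topology (\<lambda>_. euclideanreal) {\<phi>. continuous_on {0..1} \<phi>})"

lemma topspace_weak_star: "topspace weak_star = unit_probs"
  by (auto simp: weak_star_def topspace_pullback_topology)

text \<open>The enumeration starts at 0, so the weight of the \<open>i\<close>-th function is \<open>2\<close> to the power
  \<open>-(i + 1)\<close>.\<close>

definition meas_dist :: "(nat \<Rightarrow> real \<Rightarrow> real) \<Rightarrow> real measure \<Rightarrow> real measure \<Rightarrow> real" where
  "meas_dist \<Psi> \<mu> \<nu> = (\<Sum>i. (1 / 2) ^ Suc i * \<bar>integral\<^sup>L \<mu> (\<Psi> i) - integral\<^sup>L \<nu> (\<Psi> i)\<bar>)"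


section \<open>Empirical measures and pseudo-physical measures\<close>

definition empirical :: "(real \<Rightarrow> real) \<Rightarrow> real \<Rightarrow> nat \<Rightarrow> real measure" where
  "empirical f x n =
     measure_of {0..1} (sets unit_borel)
       (\<lambda>A. (\<Sum>j<n. emeasure (return unit_borel ((f ^^ j) x)) A) / of_nat n)"

definition p_omega :: "(real \<Rightarrow> real) \<Rightarrow> real \<Rightarrow> real measure set" where
  "p_omega f x =
     {\<mu>. \<exists>r. strict_mono r \<and> limitin weak_star (\<lambda>k. empirical f x (r k)) \<mu> sequentially}"

definition meas_setdist ::
    "(nat \<Rightarrow> real \<Rightarrow> real) \<Rightarrow> real measure set \<Rightarrow> real measure \<Rightarrow> real" where
  "meas_setdist \<Psi> K \<mu> = (INF \<nu>\<in>K. meas_dist \<Psi> \<nu> \<mu>)"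

definition pseudo_physical ::
    "(nat \<Rightarrow> real \<Rightarrow> real) \<Rightarrow> (real \<Rightarrow> real) \<Rightarrow> real measure set" where
  "pseudo_physical \<Psi> f =
     {\<mu> \<in> unit_probs. \<forall>\<epsilon>>0. emeasure lebesgue {x \<in> {0..1}. meas_setdist \<Psi> (p_omega f x) \<mu> < \<epsilon>} > 0}"


section \<open>Invariant, ergodic and periodic measures\<close>

definition invariant_measures :: "(real \<Rightarrow> real) \<Rightarrow> real measure set" where
  "invariant_measures f = {\<mu> \<in> unit_probs. distr \<mu> unit_borel f = \<mu>}"

definition ergodic_measures :: "(real \<Rightarrow> real) \<Rightarrow> real measure set" where
  "ergodic_measures f =
     {\<mu> \<in> invariant_measures f.
        \<forall>A\<in>sets unit_borel. f -` A \<inter> {0..1} = A \<longrightarrow> measure \<mu> A = 0 \<or> measure \<mu> A = 1}"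

definition periodic_point :: "(real \<Rightarrow> real) \<Rightarrow> nat \<Rightarrow> real \<Rightarrow> bool" where
  "periodic_point f p x \<longleftrightarrow>
     x \<in> {0..1} \<and> p \<ge> 1 \<and> (f ^^ p) x = x \<and> (\<forall>j. 1 \<le> j \<and> j < p \<longrightarrow> (f ^^ j) x \<noteq> x)"

definition periodic_measures :: "(real \<Rightarrow> real) \<Rightarrow> real measure set" where
  "periodic_measures f = {empirical f x p | x p. periodic_point f p x}"


section \<open>Shrinking intervals and shrinked measures\<close>

text \<open>The length of an interval, possibly degenerate, is its Lebesgue measure.\<close>

definition shrinking_interval :: "(real \<Rightarrow> real) \<Rightarrow> nat \<Rightarrow> real set \<Rightarrow> bool" where
  "shrinking_interval f p I \<longleftrightarrow>
     p \<ge> 1 \<and> I \<noteq> {} \<and> open I \<and> is_interval I \<and> I \<subseteq> {0..1} \<and>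
     disjoint_family_on (\<lambda>j. (f ^^ j) ` closure I) {0..p - 1} \<and>
     (f ^^ p) ` closure I \<subseteq> I \<and>
     (\<forall>j\<in>{1..p - 1}. measure lebesgue ((f ^^ j) ` I) < measure lebesgue I)"

definition infinitely_shrinked :: "(real \<Rightarrow> real) \<Rightarrow> real measure set" where
  "infinitely_shrinked f =
     {\<mu> \<in> invariant_measures f.
        \<exists>(I :: nat \<Rightarrow> real set) (p :: nat \<Rightarrow> nat). \<forall>q\<ge>1.
          shrinking_interval f (p q) (I q) \<and> measure lebesgue (I q) < 1 / real q \<and>
          measure \<mu> (\<Union>j\<in>{1..p q}. (f ^^ j) ` closure (I q)) = 1}"

definition shrinked_periodic :: "nat \<Rightarrow> (real \<Rightarrow> real) \<Rightarrow> real measure set" where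
  "shrinked_periodic q f =
     {\<nu> \<in> periodic_measures f.
        \<exists>I p. shrinking_interval f p I \<and> measure lebesgue I < 1 / real q \<and>
          measure \<nu> (\<Union>j\<in>{1..p}. (f ^^ j) ` closure I) = 1}"

definition almost_shrinked_periodic ::
    "(nat \<Rightarrow> real \<Rightarrow> real) \<Rightarrow> real \<Rightarrow> nat \<Rightarrow> (real \<Rightarrow> real) \<Rightarrow> real measure set" where
  "almost_shrinked_periodic \<Psi> \<epsilon> q f =
     {\<mu> \<in> invariant_measures f. \<exists>\<nu>\<in>shrinked_periodic q f. meas_dist \<Psi> \<mu> \<nu> < \<epsilon>}"

end

theory Submission
  imports Defs
begin

text \<open>The theorem rests on two facts about a typical map \<open>f\<close>: every ergodic measure is, for each \<open>q\<close>,
  a weak-star limit of periodic measures carried by cycles of shrinking intervals of length less than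
  \<open>1 / q\<close>; and, for each \<open>q\<close>, the orbit of almost every point enters a shrinking interval of
  length less than \<open>1 / q\<close>. All the claims follow from these two (lemma
  \<open>abundance_implies_equalities\<close>), for the following reasons.

  The cycle of a shrinking interval traps every orbit that enters it. It consists of \<open>p\<close> disjoint
  pieces, mapped cyclically into each other and no longer than the interval, so every invariant measure on it gives
  each piece the weight \<open>1 / p\<close>. Hence any two invariant measures on the cycle are close to each other
  if the interval is short (\<open>meas_dist_cycle_small\<close>); and the cycle carries a periodic measure, by the
  fixed point theorem. Therefore infinitely shrinked measures are limits of periodic ones. If \<open>x\<close> lies
  in a short shrinking interval, then all elements of \<open>p_omega f x\<close> are close to the periodic measure
  on the cycle; as shrinking intervals have positive length, limits of periodic measures on ever
  shorter cycles are pseudo-physical. If the orbit of \<open>x\<close> enters arbitrarily short shrinking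
  intervals, then \<open>p_omega f x\<close>, which is not empty because the space of measures is compact, consists
  of infinitely shrinked measures. As this holds for almost every \<open>x\<close>, pseudo-physical measures are
  limits of infinitely shrinked ones, and so are the limits of periodic measures on ever shorter
  cycles.

  Both facts about typical maps come from Baire's theorem. A map that is constant on small intervals,
  with values at the centres of such intervals, sends each of them after finitely many steps into a
  shrinking interval, and the maps near it still do so (locale \<open>plateaus\<close>). Any map can be approximated by a map
  with plateaus that cover most of the interval, which gives the second fact (\<open>grid_perturbation\<close>).
  For the first one, Birkhoff's theorem provides a point whose orbit follows a given ergodic
  measure; the orbit returns close to itself, and a small perturbation with plateaus along this
  stretch of orbit creates a shrinking interval whose cycle imitates the ergodic measure
  (\<open>ergodic_perturbation\<close>).

  The set of maps with a prescribed kind of ergodic measure need not be open. This is no obstacle: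
  if every map of a set \<open>V\<close> is a limit of interior points of a set \<open>S\<close>, then a typical map that
  belongs to \<open>V\<close> also belongs to \<open>S\<close> (\<open>holds_typicallyI\<close>).\<close>

section \<open>Probability measures on the unit interval\<close>

lemma space_unit_borel [simp]: "space unit_borel = {0..1}"
  by (simp add: unit_borel_def space_restrict_space)

lemma sets_unit_borel_iff: "A \<in> sets unit_borel \<longleftrightarrow> A \<in> sets borel \<and> A \<subseteq> {0..1}"
  by (auto simp: unit_borel_def sets_restrict_space_iff)

lemma unit_probsD:
  assumes "\<mu> \<in> unit_probs"
  shows "prob_space \<mu>" "sets \<mu> = sets unit_borel" "space \<mu> = {0..1}"
  using assms sets_eq_imp_space_eq[of \<mu> unit_borel]
  by (auto simp: unit_probs_iff unit_borel_def space_restrict_space)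

lemma continuous_measurable_unit:
  fixes \<phi> :: "real \<Rightarrow> real"
  shows "continuous_on {0..1} \<phi> \<Longrightarrow> \<phi> \<in> borel_measurable unit_borel"
  unfolding unit_borel_def by (rule borel_measurable_continuous_on_restrict)

lemma continuous_bounded_unit:
  fixes \<phi> :: "real \<Rightarrow> real"
  assumes "continuous_on {0..1} \<phi>"
  obtains B where "B > 0" "\<And>x. x \<in> {0..1} \<Longrightarrow> \<bar>\<phi> x\<bar> \<le> B"
proof -
  have "bounded (\<phi> ` {0..1})"
    using assms by (intro compact_imp_bounded compact_continuous_image) auto
  then obtain B where "B > 0" "\<forall>y\<in>\<phi> ` {0..1}. norm y \<le> B"
    by (auto simp: bounded_pos)
  then show thesis by (intro that) auto
qed

lemma integrable_unit:
  fixes \<phi> :: "real \<Rightarrow> real"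
  assumes \<mu>: "\<mu> \<in> unit_probs" and c: "continuous_on {0..1} \<phi>"
  shows "integrable \<mu> \<phi>"
proof -
  interpret prob_space \<mu> using \<mu> by (rule unit_probsD)
  obtain B where "\<And>x. x \<in> {0..1} \<Longrightarrow> \<bar>\<phi> x\<bar> \<le> B" using continuous_bounded_unit[OF c] by metis
  moreover have "\<phi> \<in> borel_measurable \<mu>"
    using continuous_measurable_unit[OF c] measurable_cong_sets[OF unit_probsD(2)[OF \<mu>] refl] by blast
  ultimately show ?thesis
    by (intro integrable_const_bound[where B=B]) (auto intro!: AE_I2 simp: unit_probsD(3)[OF \<mu>])
qed

lemma integral_unit_close:
  fixes \<phi> \<psi> :: "real \<Rightarrow> real"
  assumes \<mu>: "\<mu> \<in> unit_probs" and c: "continuous_on {0..1} \<phi>" "continuous_on {0..1} \<psi>"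
    and le: "\<And>x. x \<in> {0..1} \<Longrightarrow> \<bar>\<phi> x - \<psi> x\<bar> \<le> e"
  shows "\<bar>integral\<^sup>L \<mu> \<phi> - integral\<^sup>L \<mu> \<psi>\<bar> \<le> e"
proof -
  interpret prob_space \<mu> using \<mu> by (rule unit_probsD)
  note i = integrable_unit[OF \<mu> c(1)] integrable_unit[OF \<mu> c(2)]
  have "\<bar>integral\<^sup>L \<mu> \<phi> - integral\<^sup>L \<mu> \<psi>\<bar> = \<bar>\<integral>x. \<phi> x - \<psi> x \<partial>\<mu>\<bar>"
    using i by simp
  also have "\<dots> \<le> (\<integral>x. \<bar>\<phi> x - \<psi> x\<bar> \<partial>\<mu>)" by (rule integral_abs_bound)
  also have "\<dots> \<le> (\<integral>x. e \<partial>\<mu>)"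
    using i le by (intro integral_mono) (auto simp: unit_probsD(3)[OF \<mu>])
  finally show ?thesis by (simp add: prob_space)
qed

text \<open>The indicator of a half-line is a pointwise limit of continuous ramps, so the integrals of
  continuous functions determine the distribution function.\<close>

lemma unit_probs_eqI:
  assumes \<mu>: "\<mu> \<in> unit_probs" and \<nu>: "\<nu> \<in> unit_probs"
    and eq: "\<And>\<phi> :: real \<Rightarrow> real. continuous_on {0..1} \<phi> \<Longrightarrow> integral\<^sup>L \<mu> \<phi> = integral\<^sup>L \<nu> \<phi>"
  shows "\<mu> = \<nu>"
proof -
  define ext where "ext \<rho> = distr \<rho> borel (\<lambda>x::real. x)" for \<rho> :: "real measure"
  have meas: "(\<lambda>x. x) \<in> borel_measurable \<rho>" if "\<rho> \<in> unit_probs" for \<rho>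
    using continuous_measurable_unit[of "\<lambda>x. x"] measurable_cong_sets[OF unit_probsD(2)[OF that] refl]
    by auto
  have dist: "real_distribution (ext \<rho>)" if "\<rho> \<in> unit_probs" for \<rho>
    unfolding ext_def real_distribution_def real_distribution_axioms_def
    using prob_space.prob_space_distr[OF unit_probsD(1)[OF that] meas[OF that]] by simp
  define st where "st c n = cts_step c (c + 1 / real (Suc n))" for c n
  have cont: "continuous_on S (st c n)" for S c n
    unfolding st_def
    by (rule continuous_on_subset[OF uniformly_continuous_imp_continuous[OF cts_step_uniformly_continuous]]) auto
  have lim: "(\<lambda>n. integral\<^sup>L \<rho> (st c n)) \<longlonglongrightarrow> cdf (ext \<rho>) c" if \<rho>: "\<rho> \<in> unit_probs" for \<rho> c
  proof -
    interpret prob_space \<rho> using \<rho> by (rule unit_probsD)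
    note [measurable] = meas[OF \<rho>]
    have p: "(\<lambda>n. st c n x) \<longlonglongrightarrow> indicator {..c} x" for x
    proof (cases "x \<le> c")
      case False
      have "(\<lambda>n. 1 / real (Suc n)) \<longlonglongrightarrow> 0" by (rule LIMSEQ_Suc[OF lim_1_over_n])
      then have "\<forall>\<^sub>F n in sequentially. 1 / real (Suc n) < x - c"
        using False by (intro order_tendstoD) auto
      then have "\<forall>\<^sub>F n in sequentially. st c n x = indicator {..c} x"
        by eventually_elim (use False in \<open>auto simp: st_def cts_step_def\<close>)
      then show ?thesis by (rule tendsto_eventually)
    qed (auto simp: st_def cts_step_def)
    have b: "norm (st c n x) \<le> 1" for n x
      by (auto simp: st_def cts_step_def divide_simps)
    have "(\<lambda>n. integral\<^sup>L \<rho> (st c n)) \<longlonglongrightarrow> (\<integral>x. indicator {..c} x \<partial>\<rho>)"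
      using p b cont integrable_unit[OF \<rho> cont, THEN borel_measurable_integrable]
      by (intro integral_dominated_convergence[where w="\<lambda>_. 1"]) auto
    moreover have "(\<integral>x. indicator {..c} x \<partial>\<rho>) = cdf (ext \<rho>) c"
    proof -
      have "cdf (ext \<rho>) c = measure \<rho> ((\<lambda>x. x) -` {..c} \<inter> space \<rho>)"
        unfolding cdf_def ext_def by (subst measure_distr) auto
      also have "\<dots> = (\<integral>x. indicator ((\<lambda>x. x) -` {..c} \<inter> space \<rho>) x \<partial>\<rho>)"
        by simp
      also have "\<dots> = (\<integral>x. indicator {..c} x \<partial>\<rho>)"
        by (intro Bochner_Integration.integral_cong) (auto simp: indicator_def)
      finally show ?thesis by simp
    qed
    ultimately show ?thesis by simp
  qed
  have "cdf (ext \<mu>) = cdf (ext \<nu>)"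
  proof
    fix c
    have "(\<lambda>n. integral\<^sup>L \<mu> (st c n)) = (\<lambda>n. integral\<^sup>L \<nu> (st c n))"
      using eq[OF cont] by auto
    then show "cdf (ext \<mu>) c = cdf (ext \<nu>) c"
      using lim[OF \<mu>, of c] lim[OF \<nu>, of c] LIMSEQ_unique by metis
  qed
  then have e: "ext \<mu> = ext \<nu>" using cdf_unique dist \<mu> \<nu> by blast
  have em: "emeasure \<rho> A = emeasure (ext \<rho>) A" if "\<rho> \<in> unit_probs" "A \<in> sets unit_borel" for \<rho> A
  proof -
    have "(\<lambda>x. x) -` A \<inter> space \<rho> = A"
      using that unit_probsD(3)[OF that(1)] by (auto simp: sets_unit_borel_iff)
    then show ?thesis
      using that meas[OF that(1)] unfolding ext_def by (simp add: emeasure_distr sets_unit_borel_iff)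
  qed
  show ?thesis
    using unit_probsD(2)[OF \<mu>] unit_probsD(2)[OF \<nu>] em[OF \<mu>] em[OF \<nu>] e
    by (intro measure_eqI) auto
qed

text \<open>Convergence in the pullback of a product topology is convergence of each coordinate, here of
  each integral.\<close>

lemma limitin_weak_star:
  "limitin weak_star \<sigma> \<mu> F \<longleftrightarrow>
     \<mu> \<in> unit_probs \<and> (\<forall>\<^sub>F n in F. \<sigma> n \<in> unit_probs) \<and>
     (\<forall>\<phi> :: real \<Rightarrow> real. continuous_on {0..1} \<phi> \<longrightarrow> ((\<lambda>n. integral\<^sup>L (\<sigma> n) \<phi>) \<longlongrightarrow> integral\<^sup>L \<mu> \<phi>) F)"
proof -
  define C where "C = {\<phi>::real \<Rightarrow> real. continuous_on {0..1} \<phi>}"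
  define T where "T = (\<lambda>\<mu>. \<lambda>\<phi>\<in>C. integral\<^sup>L \<mu> \<phi>)"
  define X where "X = product_topology (\<lambda>_. euclideanreal) C"
  have ws: "weak_star = pullback_topology unit_probs T X"
    unfolding weak_star_def T_def X_def C_def by simp
  have Ttop: "T \<nu> \<in> topspace X" for \<nu> by (simp add: T_def X_def)
  have 1: "limitin X (\<lambda>n. T (\<sigma> n)) (T \<mu>) F \<longleftrightarrow>
      (\<forall>\<phi>\<in>C. ((\<lambda>n. integral\<^sup>L (\<sigma> n) \<phi>) \<longlongrightarrow> integral\<^sup>L \<mu> \<phi>) F)"
    unfolding X_def limitin_componentwise by (auto simp: T_def)
  have 2: "limitin weak_star \<sigma> \<mu> F \<longleftrightarrow> \<mu> \<in> unit_probs \<and> (\<forall>\<^sub>F n in F. \<sigma> n \<in> unit_probs) \<and>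
      limitin X (\<lambda>n. T (\<sigma> n)) (T \<mu>) F"
  proof safe
    assume l: "limitin weak_star \<sigma> \<mu> F"
    then show \<mu>: "\<mu> \<in> unit_probs" by (auto simp: limitin_def topspace_weak_star)
    have "openin weak_star unit_probs" by (metis openin_topspace topspace_weak_star)
    then show "\<forall>\<^sub>F n in F. \<sigma> n \<in> unit_probs" using l \<mu> by (auto simp: limitin_def)
    show "limitin X (\<lambda>n. T (\<sigma> n)) (T \<mu>) F"
      unfolding limitin_def
    proof (intro conjI allI impI Ttop)
      fix U assume U: "openin X U \<and> T \<mu> \<in> U"
      then have "openin weak_star (T -` U \<inter> unit_probs)"
        unfolding ws openin_pullback_topology by blast
      then have "\<forall>\<^sub>F n in F. \<sigma> n \<in> T -` U \<inter> unit_probs"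
        using l U \<mu> by (auto simp: limitin_def)
      then show "\<forall>\<^sub>F n in F. T (\<sigma> n) \<in> U" by eventually_elim auto
    qed
  next
    assume \<mu>: "\<mu> \<in> unit_probs" and ev: "\<forall>\<^sub>F n in F. \<sigma> n \<in> unit_probs"
      and l: "limitin X (\<lambda>n. T (\<sigma> n)) (T \<mu>) F"
    show "limitin weak_star \<sigma> \<mu> F"
      unfolding limitin_def topspace_weak_star
    proof (intro conjI allI impI \<mu>)
      fix V assume V: "openin weak_star V \<and> \<mu> \<in> V"
      then obtain U where U: "openin X U" "V = T -` U \<inter> unit_probs"
        unfolding ws openin_pullback_topology by blast
      then have "\<forall>\<^sub>F n in F. T (\<sigma> n) \<in> U" using l V by (auto simp: limitin_def)
      with ev show "\<forall>\<^sub>F n in F. \<sigma> n \<in> V" by eventually_elim (use U in auto)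
    qed
  qed
  show ?thesis unfolding 2 1 C_def by auto
qed

text \<open>Compactness comes from Helly selection on the line; clamping the limit distribution back
  into the interval spares the discussion of its support.\<close>

lemma unit_probs_seq_compact:
  assumes \<sigma>: "\<And>n::nat. \<sigma> n \<in> unit_probs"
  obtains r \<mu> where "strict_mono (r::nat\<Rightarrow>nat)" "limitin weak_star (\<lambda>n. \<sigma> (r n)) \<mu> sequentially"
proof -
  \<comment> \<open>Viewed on the line, the measures are tight, as they are all carried by one bounded interval.\<close>
  define M where "M n = distr (\<sigma> n) borel (\<lambda>x::real. x)" for n
  have meas: "(\<lambda>x. x) \<in> borel_measurable (\<sigma> n)" for n
    using continuous_measurable_unit[of "\<lambda>x. x"] measurable_cong_sets[OF unit_probsD(2)[OF \<sigma>] refl]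
    by auto
  have rd: "real_distribution (M n)" for n
    unfolding M_def real_distribution_def real_distribution_axioms_def
    using prob_space.prob_space_distr[OF unit_probsD(1)[OF \<sigma>] meas] by simp
  have "tight M"
    unfolding tight_def
  proof (intro conjI allI impI rd)
    fix e :: real assume "e > 0"
    have "measure (M n) {-1<..1} > 1 - e" for n
    proof -
      interpret prob_space "\<sigma> n" using \<sigma> by (rule unit_probsD)
      have "measure (M n) {-1<..1} = measure (\<sigma> n) ((\<lambda>x. x) -` {-1<..1} \<inter> space (\<sigma> n))"
        unfolding M_def using meas by (subst measure_distr) auto
      also have "(\<lambda>x. x) -` {-1<..1} \<inter> space (\<sigma> n) = space (\<sigma> n)"
        by (auto simp: unit_probsD(3)[OF \<sigma>])
      finally show ?thesis using \<open>e > 0\<close> by (simp add: prob_space)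
    qed
    then show "\<exists>a b. a < b \<and> (\<forall>n. measure (M n) {a<..b} > 1 - e)"
      by (intro exI[of _ "-1"] exI[of _ 1]) auto
  qed
  then obtain r N where r: "strict_mono (r::nat\<Rightarrow>nat)" and N: "real_distribution N"
    and w: "weak_conv_m (M \<circ> id \<circ> r) N"
    using tight_imp_convergent_subsubsequence[of M id] strict_mono_id by blast
  define cl :: "real \<Rightarrow> real" where "cl x = max 0 (min 1 x)" for x
  have cl_cont: "continuous_on UNIV cl" unfolding cl_def by (intro continuous_intros)
  have cl_in: "cl x \<in> {0..1}" for x by (auto simp: cl_def)
  have [measurable]: "cl \<in> borel_measurable borel"
    using cl_cont by (rule borel_measurable_continuous_onI)
  have clN: "cl \<in> measurable N unit_borel"
    unfolding unit_borel_def
    by (rule measurable_restrict_space2)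
      (use cl_in N in \<open>auto simp: measurable_cong_sets[OF real_distribution.events_eq_borel[OF N] refl]\<close>)
  define \<mu> where "\<mu> = distr N unit_borel cl"
  interpret N: real_distribution N by (rule N)
  have \<mu>: "\<mu> \<in> unit_probs"
    unfolding unit_probs_iff \<mu>_def using N.prob_space_distr[OF clN] by (simp add: unit_borel_def)
  have "limitin weak_star (\<lambda>n. \<sigma> (r n)) \<mu> sequentially"
    unfolding limitin_weak_star
  proof (intro conjI allI impI \<mu> always_eventually \<sigma>)
    fix \<phi> :: "real \<Rightarrow> real" assume c: "continuous_on {0..1} \<phi>"
    obtain B where B: "\<And>x. x \<in> {0..1} \<Longrightarrow> \<bar>\<phi> x\<bar> \<le> B" using continuous_bounded_unit[OF c] by metis
    have cc: "continuous_on UNIV (\<lambda>x. \<phi> (cl x))"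
      by (rule continuous_on_compose2[OF c cl_cont]) (use cl_in in auto)
    have "(\<lambda>n. integral\<^sup>L ((M \<circ> id \<circ> r) n) (\<lambda>x. \<phi> (cl x))) \<longlonglongrightarrow> integral\<^sup>L N (\<lambda>x. \<phi> (cl x))"
      using rd N w cc B cl_in
      by (intro weak_conv_imp_integral_bdd_continuous_conv[where B=B])
        (auto simp: continuous_on_eq_continuous_at comp_def)
    moreover have "integral\<^sup>L ((M \<circ> id \<circ> r) n) (\<lambda>x. \<phi> (cl x)) = integral\<^sup>L (\<sigma> (r n)) \<phi>" for n
    proof -
      have "integral\<^sup>L ((M \<circ> id \<circ> r) n) (\<lambda>x. \<phi> (cl x)) = integral\<^sup>L (\<sigma> (r n)) (\<lambda>x. \<phi> (cl x))"
        unfolding M_def comp_def id_def using meas borel_measurable_continuous_onI[OF cc]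
        by (subst integral_distr) auto
      also have "\<dots> = integral\<^sup>L (\<sigma> (r n)) \<phi>"
        by (intro Bochner_Integration.integral_cong) (auto simp: unit_probsD(3)[OF \<sigma>] cl_def)
      finally show ?thesis .
    qed
    moreover have "integral\<^sup>L N (\<lambda>x. \<phi> (cl x)) = integral\<^sup>L \<mu> \<phi>"
      unfolding \<mu>_def using clN continuous_measurable_unit[OF c] by (subst integral_distr) auto
    ultimately show "(\<lambda>n. integral\<^sup>L (\<sigma> (r n)) \<phi>) \<longlonglongrightarrow> integral\<^sup>L \<mu> \<phi>" by simp
  qed
  with r show thesis by (rule that)
qed

section \<open>The space of self-maps\<close>

lemma self_mapsD:
  assumes "f \<in> mspace self_maps"
  shows "continuous_on {0..1} f" "\<And>x. x \<in> {0..1} \<Longrightarrow> f x \<in> {0..1}"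
  using assms by (auto simp: mspace_self_maps)

lemma restrict_self_maps:
  assumes "continuous_on {0..1} f" "\<And>x. x \<in> {0..1} \<Longrightarrow> f x \<in> {0..1}"
  shows "restrict f {0..1} \<in> mspace self_maps"
  using assms continuous_on_cong[of "{0..1}" "{0..1}" f "restrict f {0..1}"]
  by (auto simp: mspace_self_maps)

lemma mdist_self_maps_le:
  assumes "f \<in> mspace self_maps" "g \<in> mspace self_maps"
  shows "mdist self_maps f g \<le> a \<longleftrightarrow> (\<forall>x\<in>{0..1}. \<bar>f x - g x\<bar> \<le> a)"
  using assms unfolding self_maps_def
  by (subst cfunspace_mdist_le) (auto simp: dist_real_def)

interpretation SM: Metric_space "mspace self_maps" "mdist self_maps"
  rewrites "Metric_space.mtopology (mspace self_maps) (mdist self_maps) = mtopology_of self_maps"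
  by (auto simp: mtopology_of_def)

lemma in_closure_of_self_maps:
  "f \<in> mtopology_of self_maps closure_of T \<longleftrightarrow>
     f \<in> mspace self_maps \<and> (\<forall>r>0. \<exists>g\<in>T. g \<in> mspace self_maps \<and> mdist self_maps f g < r)"
  unfolding SM.metric_closure_of by (auto simp: SM.in_mball)

text \<open>Completeness of the space of maps is inherited from that of the interval; it makes Baire's
  theorem available.\<close>

lemma mcomplete_self_maps: "SM.mcomplete"
proof -
  interpret I: Submetric UNIV dist "{0..1::real}" by unfold_locales auto
  have "Met_TC.mcomplete TYPE(real)" by (simp add: complete_UNIV)
  then have "I.sub.mcomplete"
    by (intro I.closedin_mcomplete_imp_mcomplete) auto
  then have "mcomplete_of (cfunspace (top_of_set {0..1}) (I.sub.Self :: real metric))"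
    by (rule I.sub.mcomplete_cfunspace)
  moreover have "I.sub.Self = submetric euclidean_metric {0..1::real}"
    by (simp add: submetric_def I.sub.Self_def)
  ultimately show ?thesis
    unfolding mcomplete_of_def self_maps_def by simp
qed

section \<open>The distance given by a dense sequence of self-maps\<close>

locale dense_self_maps =
  fixes \<Psi> :: "nat \<Rightarrow> real \<Rightarrow> real"
  assumes dense: "dense_in_space (mtopology_of self_maps) (range \<Psi>)"
begin

lemma Psi_self_map: "\<Psi> i \<in> mspace self_maps"
  using dense by (auto simp: dense_in_space_def)

lemmas Psi_cont = self_mapsD(1)[OF Psi_self_map]
lemmas Psi_in = self_mapsD(2)[OF Psi_self_map]

lemma Psi_integral_in:
  assumes \<mu>: "\<mu> \<in> unit_probs"
  shows "integral\<^sup>L \<mu> (\<Psi> i) \<in> {0..1}"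
proof -
  interpret prob_space \<mu> using \<mu> by (rule unit_probsD)
  have "\<bar>integral\<^sup>L \<mu> (\<Psi> i) - integral\<^sup>L \<mu> (\<lambda>_. 1/2)\<bar> \<le> 1/2"
    using Psi_in[of _ i] by (intro integral_unit_close[OF \<mu> Psi_cont]) (auto simp: abs_le_iff field_simps)
  then have "\<bar>integral\<^sup>L \<mu> (\<Psi> i) - 1/2\<bar> \<le> 1/2" by (simp add: prob_space)
  then show ?thesis unfolding abs_le_iff by auto
qed

text \<open>The self-maps only take values in the interval; a general test function is first rescaled.\<close>

lemma Psi_approx:
  fixes \<phi> :: "real \<Rightarrow> real"
  assumes c: "continuous_on {0..1} \<phi>" and e: "e > 0"
  obtains i a b where "\<And>x. x \<in> {0..1} \<Longrightarrow> \<bar>\<phi> x - (a * \<Psi> i x + b)\<bar> \<le> e"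
proof -
  obtain B where B: "B > 0" "\<And>x. x \<in> {0..1} \<Longrightarrow> \<bar>\<phi> x\<bar> \<le> B"
    using continuous_bounded_unit[OF c] by metis
  define h where "h = restrict (\<lambda>x. (\<phi> x + B) / (2 * B)) {0..1}"
  have "(\<phi> x + B) / (2 * B) \<in> {0..1}" if "x \<in> {0..1}" for x
    using B(1) B(2)[OF that] by (auto simp: divide_simps abs_le_iff)
  then have h: "h \<in> mspace self_maps"
    unfolding h_def using B(1) by (intro restrict_self_maps continuous_intros c) auto
  then have "h \<in> mtopology_of self_maps closure_of range \<Psi>"
    using dense by (simp add: dense_in_space_def)
  then obtain i where i: "mdist self_maps h (\<Psi> i) < e / (2 * B)"
    unfolding in_closure_of_self_maps using e B(1) by (metis (no_types, lifting) divide_pos_pos mult_pos_pos rangeE zero_less_numeral)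
  have "\<bar>\<phi> x - (2 * B * \<Psi> i x + (- B))\<bar> \<le> e" if x: "x \<in> {0..1}" for x
  proof -
    have "\<bar>h x - \<Psi> i x\<bar> \<le> e / (2 * B)"
      using mdist_self_maps_le[OF h Psi_self_map, of i "e / (2 * B)"] i x by auto
    then have "2 * B * \<bar>h x - \<Psi> i x\<bar> \<le> e" using B(1) by (simp add: field_simps)
    also have "2 * B * \<bar>h x - \<Psi> i x\<bar> = \<bar>2 * B * (h x - \<Psi> i x)\<bar>" using B(1) by (simp add: abs_mult)
    also have "2 * B * (h x - \<Psi> i x) = \<phi> x - (2 * B * \<Psi> i x + (- B))"
      using x B(1) by (simp add: h_def field_simps)
    finally show ?thesis .
  qed
  then show thesis by (rule that)
qed

lemma meas_dist_summable:
  assumes "\<mu> \<in> unit_probs" "\<nu> \<in> unit_probs"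
  shows "summable (\<lambda>i. (1 / 2 :: real) ^ Suc i * \<bar>integral\<^sup>L \<mu> (\<Psi> i) - integral\<^sup>L \<nu> (\<Psi> i)\<bar>)"
proof (rule summable_comparison_test'[where N=0])
  show "summable (\<lambda>i. (1 / 2 :: real) ^ Suc i)" by (simp add: summable_geometric)
  show "norm ((1 / 2 :: real) ^ Suc i * \<bar>integral\<^sup>L \<mu> (\<Psi> i) - integral\<^sup>L \<nu> (\<Psi> i)\<bar>) \<le> (1 / 2) ^ Suc i" for i
    using Psi_integral_in[OF assms(1), of i] Psi_integral_in[OF assms(2), of i]
    by (auto simp: abs_mult intro!: mult_left_le)
qed

lemma meas_dist_commute: "meas_dist \<Psi> \<mu> \<nu> = meas_dist \<Psi> \<nu> \<mu>"
  by (simp add: meas_dist_def abs_minus_commute)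

lemma meas_dist_nonneg:
  assumes "\<mu> \<in> unit_probs" "\<nu> \<in> unit_probs"
  shows "meas_dist \<Psi> \<mu> \<nu> \<ge> 0"
  unfolding meas_dist_def by (rule suminf_nonneg[OF meas_dist_summable[OF assms]]) auto

lemma meas_dist_self [simp]: "meas_dist \<Psi> \<mu> \<mu> = 0"
  by (simp add: meas_dist_def)

lemma meas_dist_triangle:
  assumes "\<mu> \<in> unit_probs" "\<nu> \<in> unit_probs" "\<rho> \<in> unit_probs"
  shows "meas_dist \<Psi> \<mu> \<rho> \<le> meas_dist \<Psi> \<mu> \<nu> + meas_dist \<Psi> \<nu> \<rho>"
proof -
  note s = meas_dist_summable[OF assms(1,2)] meas_dist_summable[OF assms(2,3)]
  have "meas_dist \<Psi> \<mu> \<rho> \<le> (\<Sum>i. (1 / 2 :: real) ^ Suc i * \<bar>integral\<^sup>L \<mu> (\<Psi> i) - integral\<^sup>L \<nu> (\<Psi> i)\<bar> +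
      (1 / 2 :: real) ^ Suc i * \<bar>integral\<^sup>L \<nu> (\<Psi> i) - integral\<^sup>L \<rho> (\<Psi> i)\<bar>)"
    unfolding meas_dist_def
    by (intro suminf_le[OF _ meas_dist_summable[OF assms(1,3)] summable_add[OF s]])
      (auto simp flip: distrib_left)
  also have "\<dots> = meas_dist \<Psi> \<mu> \<nu> + meas_dist \<Psi> \<nu> \<rho>"
    unfolding meas_dist_def by (rule suminf_add[OF s, symmetric])
  finally show ?thesis .
qed

lemma integral_diff_le_meas_dist:
  assumes "\<mu> \<in> unit_probs" "\<nu> \<in> unit_probs"
  shows "\<bar>integral\<^sup>L \<mu> (\<Psi> i) - integral\<^sup>L \<nu> (\<Psi> i)\<bar> \<le> 2 ^ Suc i * meas_dist \<Psi> \<mu> \<nu>"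
proof -
  have "(\<Sum>j\<in>{i}. (1 / 2 :: real) ^ Suc j * \<bar>integral\<^sup>L \<mu> (\<Psi> j) - integral\<^sup>L \<nu> (\<Psi> j)\<bar>) \<le> meas_dist \<Psi> \<mu> \<nu>"
    unfolding meas_dist_def by (rule sum_le_suminf[OF meas_dist_summable[OF assms]]) auto
  then show ?thesis by (simp add: field_simps power_one_over)
qed

text \<open>Since the integrands are bounded by 1, the tail of the series beyond the \<open>N\<close>-th term is at
  most \<open>2\<close> to the power \<open>-N\<close>: closeness is decided by finitely many integrals.\<close>

lemma meas_dist_less_criterion:
  assumes e: "e > 0"
  obtains N where "\<And>\<mu> \<nu>. \<lbrakk>\<mu> \<in> unit_probs; \<nu> \<in> unit_probs;
      \<And>i. i < N \<Longrightarrow> \<bar>integral\<^sup>L \<mu> (\<Psi> i) - integral\<^sup>L \<nu> (\<Psi> i)\<bar> \<le> e / 2\<rbrakk> \<Longrightarrow> meas_dist \<Psi> \<mu> \<nu> < e"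
proof -
  obtain N where N: "(1/2::real) ^ N < e / 2"
    using e real_arch_pow_inv[of "e/2" "1/2"] by auto
  show thesis
  proof (rule that[of N])
    fix \<mu> \<nu> assume \<mu>: "\<mu> \<in> unit_probs" "\<nu> \<in> unit_probs"
      and le: "\<And>i. i < N \<Longrightarrow> \<bar>integral\<^sup>L \<mu> (\<Psi> i) - integral\<^sup>L \<nu> (\<Psi> i)\<bar> \<le> e / 2"
    define t where "t i = (1 / 2 :: real) ^ Suc i * \<bar>integral\<^sup>L \<mu> (\<Psi> i) - integral\<^sup>L \<nu> (\<Psi> i)\<bar>" for i
    have s: "summable t" unfolding t_def by (rule meas_dist_summable[OF \<mu>])
    have geo: "(\<Sum>i. (1/2::real) ^ Suc (i + k)) = (1/2) ^ k" "summable (\<lambda>i. (1/2::real) ^ Suc (i + k))" for k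
      using sums_mult[OF geometric_sums[of "1/2::real"], of "(1/2)^Suc k"]
      by (auto simp: power_add mult_ac sums_iff simp del: power_one_over)
    have "meas_dist \<Psi> \<mu> \<nu> = (\<Sum>i. t (i + N)) + sum t {..<N}"
      using suminf_split_initial_segment[OF s, of N] unfolding meas_dist_def t_def[symmetric] .
    also have "(\<Sum>i. t (i + N)) \<le> (\<Sum>i. (1/2) ^ Suc (i + N))"
    proof (rule suminf_le[OF _ _ geo(2)])
      show "summable (\<lambda>i. t (i + N))" using s by (simp add: summable_iff_shift)
      show "t (i + N) \<le> (1/2) ^ Suc (i + N)" for i
        using Psi_integral_in[OF \<mu>(1), of "i+N"] Psi_integral_in[OF \<mu>(2), of "i+N"]
        unfolding t_def by (intro mult_left_le) auto
    qed
    also have "\<dots> < e / 2" using N geo(1) by simp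
    also have "sum t {..<N} \<le> (\<Sum>i<N. (1/2) ^ Suc i * (e / 2))"
      unfolding t_def using le by (intro sum_mono mult_left_mono) auto
    also have "\<dots> = (\<Sum>i<N. (1/2) ^ Suc i) * (e / 2)" by (rule sum_distrib_right[symmetric])
    also have "\<dots> \<le> 1 * (e / 2)"
    proof (rule mult_right_mono)
      have "(\<Sum>i<N. (1/2::real) ^ Suc i) \<le> (\<Sum>i. (1/2) ^ Suc i)"
        using geo(2)[of 0] by (intro sum_le_suminf) auto
      then show "(\<Sum>i<N. (1/2::real) ^ Suc i) \<le> 1" using geo(1)[of 0] by simp
    qed (use e in simp)
    finally show "meas_dist \<Psi> \<mu> \<nu> < e" by simp
  qed
qed

text \<open>The distance induces the weak-star topology: finitely many terms of the series control the
  distance, and every test function is uniformly close to an affine function of some \<open>\<Psi> i\<close>.\<close>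

lemma limitin_weak_star_meas_dist:
  "limitin weak_star \<sigma> \<mu> F \<longleftrightarrow>
     \<mu> \<in> unit_probs \<and> (\<forall>\<^sub>F n in F. \<sigma> n \<in> unit_probs) \<and> ((\<lambda>n. meas_dist \<Psi> (\<sigma> n) \<mu>) \<longlongrightarrow> 0) F"
proof safe
  assume l: "limitin weak_star \<sigma> \<mu> F"
  then show \<mu>: "\<mu> \<in> unit_probs" and ev: "\<forall>\<^sub>F n in F. \<sigma> n \<in> unit_probs" by (auto simp: limitin_weak_star)
  show "((\<lambda>n. meas_dist \<Psi> (\<sigma> n) \<mu>) \<longlongrightarrow> 0) F"
  proof (rule tendstoI)
    fix e :: real assume e: "e > 0"
    obtain N where N: "\<And>\<mu> \<nu>. \<lbrakk>\<mu> \<in> unit_probs; \<nu> \<in> unit_probs;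
      \<And>i. i < N \<Longrightarrow> \<bar>integral\<^sup>L \<mu> (\<Psi> i) - integral\<^sup>L \<nu> (\<Psi> i)\<bar> \<le> e / 2\<rbrakk> \<Longrightarrow> meas_dist \<Psi> \<mu> \<nu> < e"
      using meas_dist_less_criterion[OF e] by metis
    have "\<forall>\<^sub>F n in F. \<forall>i\<in>{..<N}. \<bar>integral\<^sup>L (\<sigma> n) (\<Psi> i) - integral\<^sup>L \<mu> (\<Psi> i)\<bar> < e / 2"
    proof (rule eventually_ball_finite)
      show "\<forall>i\<in>{..<N}. \<forall>\<^sub>F n in F. \<bar>integral\<^sup>L (\<sigma> n) (\<Psi> i) - integral\<^sup>L \<mu> (\<Psi> i)\<bar> < e / 2"
      proof
        fix i
        have "((\<lambda>n. integral\<^sup>L (\<sigma> n) (\<Psi> i)) \<longlongrightarrow> integral\<^sup>L \<mu> (\<Psi> i)) F"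
          using l Psi_cont by (auto simp: limitin_weak_star)
        from tendstoD[OF this, of "e/2"] e
        show "\<forall>\<^sub>F n in F. \<bar>integral\<^sup>L (\<sigma> n) (\<Psi> i) - integral\<^sup>L \<mu> (\<Psi> i)\<bar> < e / 2"
          by (simp add: dist_real_def)
      qed
    qed auto
    with ev show "\<forall>\<^sub>F n in F. dist (meas_dist \<Psi> (\<sigma> n) \<mu>) 0 < e"
    proof eventually_elim
      case (elim n)
      then have "meas_dist \<Psi> (\<sigma> n) \<mu> < e" using \<mu> by (intro N) (auto intro: less_imp_le)
      then show ?case using meas_dist_nonneg[OF _ \<mu>] elim by simp
    qed
  qed
next
  assume \<mu>: "\<mu> \<in> unit_probs" and ev: "\<forall>\<^sub>F n in F. \<sigma> n \<in> unit_probs"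
    and l: "((\<lambda>n. meas_dist \<Psi> (\<sigma> n) \<mu>) \<longlongrightarrow> 0) F"
  show "limitin weak_star \<sigma> \<mu> F"
    unfolding limitin_weak_star
  proof (intro conjI \<mu> ev allI impI tendstoI)
    fix \<phi> :: "real \<Rightarrow> real" and e :: real
    assume c: "continuous_on {0..1} \<phi>" and e: "e > 0"
    obtain i a b where iab: "\<And>x. x \<in> {0..1} \<Longrightarrow> \<bar>\<phi> x - (a * \<Psi> i x + b)\<bar> \<le> e / 4"
      using Psi_approx[OF c, of "e/4"] e by (metis divide_pos_pos zero_less_numeral)
    have int: "\<bar>integral\<^sup>L \<nu> \<phi> - (a * integral\<^sup>L \<nu> (\<Psi> i) + b)\<bar> \<le> e / 4" if \<nu>: "\<nu> \<in> unit_probs" for \<nu>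
    proof -
      interpret prob_space \<nu> using \<nu> by (rule unit_probsD)
      have "continuous_on {0..1} (\<lambda>x. a * \<Psi> i x + b)" by (intro continuous_intros Psi_cont)
      from integral_unit_close[OF \<nu> c this iab] integrable_unit[OF \<nu> Psi_cont]
      show ?thesis by (simp add: prob_space)
    qed
    have "((\<lambda>n. \<bar>a\<bar> * (2 ^ Suc i * meas_dist \<Psi> (\<sigma> n) \<mu>)) \<longlongrightarrow> \<bar>a\<bar> * (2 ^ Suc i * 0)) F"
      by (intro tendsto_intros l)
    then have "\<forall>\<^sub>F n in F. \<bar>a\<bar> * (2 ^ Suc i * meas_dist \<Psi> (\<sigma> n) \<mu>) < e / 4"
      using e by (intro order_tendstoD(2)) auto
    with ev show "\<forall>\<^sub>F n in F. dist (integral\<^sup>L (\<sigma> n) \<phi>) (integral\<^sup>L \<mu> \<phi>) < e"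
    proof eventually_elim
      case (elim n)
      have "\<bar>a * integral\<^sup>L (\<sigma> n) (\<Psi> i) - a * integral\<^sup>L \<mu> (\<Psi> i)\<bar> =
          \<bar>a\<bar> * \<bar>integral\<^sup>L (\<sigma> n) (\<Psi> i) - integral\<^sup>L \<mu> (\<Psi> i)\<bar>"
        by (simp add: abs_mult flip: right_diff_distrib)
      also have "\<dots> \<le> \<bar>a\<bar> * (2 ^ Suc i * meas_dist \<Psi> (\<sigma> n) \<mu>)"
        by (intro mult_left_mono integral_diff_le_meas_dist elim \<mu>) auto
      finally show ?case using int[OF elim(1)] int[OF \<mu>] elim(2) unfolding dist_real_def by linarith
    qed
  qed
qed

text \<open>All the closures in this development are treated through this metric description.\<close>

lemma in_weak_star_closure:
  "\<mu> \<in> weak_star closure_of S \<longleftrightarrow>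
     \<mu> \<in> unit_probs \<and> (\<forall>e>0. \<exists>\<nu>\<in>S \<inter> unit_probs. meas_dist \<Psi> \<nu> \<mu> < e)"
proof safe
  assume cl: "\<mu> \<in> weak_star closure_of S"
  then show \<mu>: "\<mu> \<in> unit_probs" by (auto simp: in_closure_of topspace_weak_star)
  fix e :: real assume e: "e > 0"
  have "limitin weak_star (\<lambda>\<nu>. \<nu>) \<mu> (atin weak_star \<mu>)"
    using \<mu> continuous_map_atin[of weak_star weak_star "\<lambda>\<nu>. \<nu>"]
    by (auto simp: topspace_weak_star)
  then have "((\<lambda>\<nu>. meas_dist \<Psi> \<nu> \<mu>) \<longlongrightarrow> 0) (atin weak_star \<mu>)"
    and ev: "\<forall>\<^sub>F \<nu> in atin weak_star \<mu>. \<nu> \<in> unit_probs"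
    by (auto simp: limitin_weak_star_meas_dist)
  then have "\<forall>\<^sub>F \<nu> in atin weak_star \<mu>. meas_dist \<Psi> \<nu> \<mu> < e"
    using e by (intro order_tendstoD(2)) auto
  with ev have "\<forall>\<^sub>F \<nu> in atin weak_star \<mu>. \<nu> \<in> unit_probs \<and> meas_dist \<Psi> \<nu> \<mu> < e"
    by (rule eventually_conj)
  then obtain U where U: "openin weak_star U" "\<mu> \<in> U"
      "\<And>\<nu>. \<nu> \<in> U - {\<mu>} \<Longrightarrow> \<nu> \<in> unit_probs \<and> meas_dist \<Psi> \<nu> \<mu> < e"
    using \<mu> by (auto simp: eventually_atin topspace_weak_star)
  obtain \<nu> where "\<nu> \<in> S" "\<nu> \<in> U" using cl U unfolding in_closure_of by blast
  then have "\<nu> \<in> S \<inter> unit_probs \<and> meas_dist \<Psi> \<nu> \<mu> < e"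
    using U(3)[of \<nu>] \<mu> e by (cases "\<nu> = \<mu>") auto
  then show "\<exists>\<nu>\<in>S \<inter> unit_probs. meas_dist \<Psi> \<nu> \<mu> < e" by auto
next
  assume \<mu>: "\<mu> \<in> unit_probs" and ap: "\<forall>e>0. \<exists>\<nu>\<in>S \<inter> unit_probs. meas_dist \<Psi> \<nu> \<mu> < e"
  have "\<forall>n. \<exists>\<nu>\<in>S \<inter> unit_probs. meas_dist \<Psi> \<nu> \<mu> < 1 / real (Suc n)" using ap by auto
  then obtain \<sigma> where \<sigma>: "\<And>n. \<sigma> n \<in> S \<inter> unit_probs" "\<And>n. meas_dist \<Psi> (\<sigma> n) \<mu> < 1 / real (Suc n)"
    by metis
  have l: "limitin weak_star \<sigma> \<mu> sequentially"
    unfolding limitin_weak_star_meas_dist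
  proof (intro conjI \<mu> always_eventually allI)
    show "\<sigma> n \<in> unit_probs" for n using \<sigma>(1) by auto
    show "(\<lambda>n. meas_dist \<Psi> (\<sigma> n) \<mu>) \<longlonglongrightarrow> 0"
      using \<sigma>(1) meas_dist_nonneg[OF _ \<mu>] less_imp_le[OF \<sigma>(2)]
      by (intro tendsto_sandwich[OF _ _ tendsto_const LIMSEQ_Suc[OF lim_1_over_n]] always_eventually) auto
  qed
  show "\<mu> \<in> weak_star closure_of S"
    unfolding in_closure_of topspace_weak_star
  proof (intro conjI \<mu> allI impI)
    fix U assume "\<mu> \<in> U \<and> openin weak_star U"
    then have "\<forall>\<^sub>F n in sequentially. \<sigma> n \<in> U" using l by (auto simp: limitin_def)
    then obtain n where "\<sigma> n \<in> U" by (auto simp: eventually_sequentially)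
    then show "\<exists>\<nu>. \<nu> \<in> S \<and> \<nu> \<in> U" using \<sigma>(1) by blast
  qed
qed

end

section \<open>Empirical and invariant measures\<close>

lemma iterate_self_map:
  assumes "f \<in> mspace self_maps"
  shows "x \<in> {0..1} \<Longrightarrow> (f ^^ n) x \<in> {0..1}" and "continuous_on {0..1} (f ^^ n)"
proof -
  note f = self_mapsD[OF assms]
  have in01: "(f ^^ n) x \<in> {0..1}" if "x \<in> {0..1}" for x n
    using that by (induction n) (auto simp del: atLeastAtMost_iff intro: f)
  then show "x \<in> {0..1} \<Longrightarrow> (f ^^ n) x \<in> {0..1}" .
  show "continuous_on {0..1} (f ^^ n)"
  proof (induction n)
    case (Suc n)
    have "continuous_on {0..1} (\<lambda>x. f ((f ^^ n) x))"
      by (rule continuous_on_compose2[OF f(1) Suc]) (use in01 in blast)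
    then show ?case by (simp add: comp_def)
  qed (simp add: id_def)
qed

lemma continuous_comp_iterate:
  fixes \<phi> :: "real \<Rightarrow> real"
  assumes "f \<in> mspace self_maps" "continuous_on {0..1} \<phi>"
  shows "continuous_on {0..1} (\<lambda>x. \<phi> ((f ^^ n) x))"
  by (rule continuous_on_compose2[OF assms(2) iterate_self_map(2)[OF assms(1)]])
    (use iterate_self_map(1)[OF assms(1)] in blast)

text \<open>The empirical measure is the image of the uniform measure on the times \<open>0, \<dots>, n - 1\<close>. The average
  over no times is not a probability measure, whence the restriction on \<open>n\<close>.\<close>

lemma empirical_eq_distr:
  assumes f: "f \<in> mspace self_maps" and x: "x \<in> {0..1}" and n: "n \<ge> 1"
  shows "empirical f x n = distr (uniform_count_measure {..<n}) unit_borel (\<lambda>j. (f ^^ j) x)"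
  unfolding empirical_def distr_def space_unit_borel
proof (rule measure_of_eq)
  show "sets unit_borel \<subseteq> Pow {0..1}" using sets.space_closed[of unit_borel] by simp
  fix X assume "X \<in> sigma_sets {0..1} (sets unit_borel)"
  then have X: "X \<in> sets unit_borel" using sets.sigma_sets_eq[of unit_borel] by simp
  let ?J = "{..<n} \<inter> {j. (f ^^ j) x \<in> X}"
  have "(\<Sum>j<n. emeasure (return unit_borel ((f ^^ j) x)) X) = (\<Sum>j<n. indicator X ((f ^^ j) x))"
    using X by (intro sum.cong) (auto simp: emeasure_return)
  also have "\<dots> = of_nat (card ?J)"
    by (simp add: indicator_def sum.If_cases)
  finally have 1: "(\<Sum>j<n. emeasure (return unit_borel ((f ^^ j) x)) X) = of_nat (card ?J)" .
  have "emeasure (uniform_count_measure {..<n}) ?J = ennreal (card ?J / n)"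
    by (subst emeasure_uniform_count_measure) auto
  also have "\<dots> = of_nat (card ?J) / of_nat n"
    using n by (subst divide_ennreal[symmetric]) (auto simp: ennreal_of_nat_eq_real_of_nat)
  finally have 2: "emeasure (uniform_count_measure {..<n}) ?J = of_nat (card ?J) / of_nat n" .
  have eq: "(\<lambda>j. (f ^^ j) x) -` X \<inter> space (uniform_count_measure {..<n}) = ?J"
    by (auto simp: space_uniform_count_measure)
  show "(\<Sum>j<n. emeasure (return unit_borel ((f ^^ j) x)) X) / of_nat n =
      emeasure (uniform_count_measure {..<n}) ((\<lambda>j. (f ^^ j) x) -` X \<inter> space (uniform_count_measure {..<n}))"
    unfolding 1 eq 2 ..
qed

context
  fixes f :: "real \<Rightarrow> real" and x :: real and n :: nat
  assumes f: "f \<in> mspace self_maps" and x: "x \<in> {0..1}" and n: "n \<ge> 1"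
begin

lemma orbit_measurable: "(\<lambda>j. (f ^^ j) x) \<in> measurable (uniform_count_measure {..<n}) unit_borel"
  using iterate_self_map(1)[OF f x] by (auto simp: measurable_def space_uniform_count_measure sets_uniform_count_measure)

lemma empirical_unit_probs: "empirical f x n \<in> unit_probs"
proof -
  interpret prob_space "uniform_count_measure {..<n}"
    using n by (intro prob_space_uniform_count_measure) (auto simp: lessThan_empty_iff)
  show ?thesis
    unfolding unit_probs_iff empirical_eq_distr[OF f x n]
    using prob_space_distr[OF orbit_measurable] by (simp add: unit_borel_def)
qed

lemma integral_empirical:
  fixes \<phi> :: "real \<Rightarrow> real"
  assumes "continuous_on {0..1} \<phi>"
  shows "integral\<^sup>L (empirical f x n) \<phi> = (\<Sum>j<n. \<phi> ((f ^^ j) x)) / n"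
  unfolding empirical_eq_distr[OF f x n]
  using orbit_measurable continuous_measurable_unit[OF assms]
  by (subst integral_distr) (auto simp: integral_uniform_count_measure)

lemma measure_empirical:
  assumes X: "X \<in> sets unit_borel"
  shows "measure (empirical f x n) X = real (card {j. j < n \<and> (f ^^ j) x \<in> X}) / n"
proof -
  have "(\<lambda>j. (f ^^ j) x) -` X \<inter> space (uniform_count_measure {..<n}) = {j. j < n \<and> (f ^^ j) x \<in> X}"
    by (auto simp: space_uniform_count_measure)
  then show ?thesis
    unfolding empirical_eq_distr[OF f x n]
    using orbit_measurable X by (subst measure_distr) (auto simp: measure_uniform_count_measure subset_eq)
qed

end

lemma self_map_measurable:
  assumes f: "f \<in> mspace self_maps" and \<mu>: "\<mu> \<in> unit_probs"
  shows "f \<in> measurable \<mu> unit_borel"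
proof -
  have "f \<in> measurable unit_borel unit_borel"
    unfolding unit_borel_def using self_mapsD[OF f]
    by (intro measurable_restrict_space2 borel_measurable_continuous_on_restrict) (auto simp: space_restrict_space)
  then show ?thesis using measurable_cong_sets[OF unit_probsD(2)[OF \<mu>] refl] by blast
qed

lemma invariant_measures_iff_integral:
  assumes f: "f \<in> mspace self_maps"
  shows "\<mu> \<in> invariant_measures f \<longleftrightarrow> \<mu> \<in> unit_probs \<and>
    (\<forall>\<phi> :: real \<Rightarrow> real. continuous_on {0..1} \<phi> \<longrightarrow> integral\<^sup>L \<mu> (\<lambda>x. \<phi> (f x)) = integral\<^sup>L \<mu> \<phi>)"
proof (cases "\<mu> \<in> unit_probs")
  case \<mu>: True
  have fm: "f \<in> measurable \<mu> unit_borel" using f \<mu> by (rule self_map_measurable)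
  have d: "distr \<mu> unit_borel f \<in> unit_probs"
    using prob_space.prob_space_distr[OF unit_probsD(1)[OF \<mu>] fm] by (simp add: unit_probs_iff unit_borel_def)
  have i: "integral\<^sup>L (distr \<mu> unit_borel f) \<phi> = integral\<^sup>L \<mu> (\<lambda>x. \<phi> (f x))"
    if "continuous_on {0..1} \<phi>" for \<phi> :: "real \<Rightarrow> real"
    using fm continuous_measurable_unit[OF that] by (rule integral_distr)
  show ?thesis
    unfolding invariant_measures_def using \<mu> i unit_probs_eqI[OF d \<mu>] by auto
qed (auto simp: invariant_measures_def)

lemma invariant_measures_unit_probs: "\<mu> \<in> invariant_measures f \<Longrightarrow> \<mu> \<in> unit_probs"
  by (simp add: invariant_measures_def)

lemma invariant_measure_vimage:
  assumes f: "f \<in> mspace self_maps" and \<mu>: "\<mu> \<in> invariant_measures f" and A: "A \<in> sets unit_borel"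
  shows "measure \<mu> (f -` A \<inter> {0..1}) = measure \<mu> A" "f -` A \<inter> {0..1} \<in> sets unit_borel"
proof -
  have u: "\<mu> \<in> unit_probs" using \<mu> by (rule invariant_measures_unit_probs)
  have fm: "f \<in> measurable \<mu> unit_borel" using f u by (rule self_map_measurable)
  have "measure \<mu> A = measure (distr \<mu> unit_borel f) A" using \<mu> by (simp add: invariant_measures_def)
  also have "\<dots> = measure \<mu> (f -` A \<inter> {0..1})"
    using measure_distr[OF fm A] unit_probsD(3)[OF u] by simp
  finally show "measure \<mu> (f -` A \<inter> {0..1}) = measure \<mu> A" by simp
  show "f -` A \<inter> {0..1} \<in> sets unit_borel"
    using measurable_sets[OF fm A] unit_probsD(2,3)[OF u] by simp
qed

text \<open>An invariant set contains all of a periodic orbit or none of it.\<close>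

lemma periodic_measures_ergodic:
  assumes f: "f \<in> mspace self_maps"
  shows "periodic_measures f \<subseteq> ergodic_measures f"
proof
  fix \<mu> assume "\<mu> \<in> periodic_measures f"
  then obtain x p where \<mu>: "\<mu> = empirical f x p" and per: "periodic_point f p x"
    by (auto simp: periodic_measures_def)
  then have x: "x \<in> {0..1}" and p: "p \<ge> 1" and fx: "(f ^^ p) x = x"
    by (auto simp: periodic_point_def)
  have "integral\<^sup>L \<mu> (\<lambda>x. \<phi> (f x)) = integral\<^sup>L \<mu> \<phi>" if c: "continuous_on {0..1} \<phi>" for \<phi> :: "real \<Rightarrow> real"
  proof -
    have "integral\<^sup>L \<mu> (\<lambda>x. \<phi> (f x)) = (\<Sum>j<p. \<phi> ((f ^^ Suc j) x)) / p"
      unfolding \<mu> using continuous_comp_iterate[OF f c, of 1] by (subst integral_empirical[OF f x p]) auto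
    also have "(\<Sum>j<p. \<phi> ((f ^^ Suc j) x)) = (\<Sum>j<p. \<phi> ((f ^^ j) x))"
      using sum.lessThan_Suc_shift[of "\<lambda>j. \<phi> ((f ^^ j) x)" p] fx by simp
    finally show ?thesis unfolding \<mu> by (simp add: integral_empirical[OF f x p c])
  qed
  then have inv: "\<mu> \<in> invariant_measures f"
    using empirical_unit_probs[OF f x p] by (auto simp: invariant_measures_iff_integral[OF f] \<mu>)
  have "measure \<mu> A = 0 \<or> measure \<mu> A = 1" if A: "A \<in> sets unit_borel" "f -` A \<inter> {0..1} = A" for A
  proof -
    have "(f ^^ j) x \<in> A \<longleftrightarrow> x \<in> A" for j
    proof (induction j)
      case (Suc j)
      have "f ((f ^^ j) x) \<in> A \<longleftrightarrow> (f ^^ j) x \<in> A"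
        using A(2) iterate_self_map(1)[OF f x, of j] by blast
      with Suc show ?case by simp
    qed simp
    then show ?thesis
      unfolding \<mu> measure_empirical[OF f x p A(1)] using p by (cases "x \<in> A") auto
  qed
  with inv show "\<mu> \<in> ergodic_measures f" by (auto simp: ergodic_measures_def)
qed

text \<open>In particular \<open>p_omega f x\<close> is not empty. The version for subsequences serves to choose a limit
  measure along prescribed times.\<close>

lemma empirical_subsequence_converges:
  assumes f: "f \<in> mspace self_maps" and x: "x \<in> {0..1}" and r: "strict_mono (r :: nat \<Rightarrow> nat)"
  obtains s \<nu> where "strict_mono (s :: nat \<Rightarrow> nat)"
    "limitin weak_star (\<lambda>k. empirical f x (r (s k))) \<nu> sequentially" "\<nu> \<in> p_omega f x"
proof -
  \<comment> \<open>The shift keeps the possible time 0 out of the sequence.\<close>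
  define \<sigma> where "\<sigma> n = empirical f x (r (Suc n))" for n
  have "\<sigma> n \<in> unit_probs" for n
    unfolding \<sigma>_def using strict_mono_imp_increasing[OF r, of "Suc n"] by (intro empirical_unit_probs[OF f x]) auto
  then obtain t \<nu> where t: "strict_mono (t :: nat \<Rightarrow> nat)" "limitin weak_star (\<lambda>n. \<sigma> (t n)) \<nu> sequentially"
    using unit_probs_seq_compact by metis
  have s: "strict_mono (\<lambda>k. Suc (t k))" using t(1) by (simp add: strict_mono_def)
  have l: "limitin weak_star (\<lambda>k. empirical f x (r (Suc (t k)))) \<nu> sequentially"
    using t(2) by (simp add: \<sigma>_def)
  show thesis
  proof (rule that[OF s l])
    have "strict_mono (\<lambda>k. r (Suc (t k)))" using r s by (simp add: strict_mono_def)
    with l show "\<nu> \<in> p_omega f x" unfolding p_omega_def by blast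
  qed
qed

lemma p_omega_integral:
  assumes "\<nu> \<in> p_omega f x"
  obtains r where "strict_mono (r :: nat \<Rightarrow> nat)"
    "\<And>\<phi> :: real \<Rightarrow> real. continuous_on {0..1} \<phi> \<Longrightarrow> (\<lambda>k. integral\<^sup>L (empirical f x (r k)) \<phi>) \<longlonglongrightarrow> integral\<^sup>L \<nu> \<phi>"
  using assms by (auto simp: p_omega_def limitin_weak_star)

lemma p_omega_unit_probs: "\<nu> \<in> p_omega f x \<Longrightarrow> \<nu> \<in> unit_probs"
  by (auto simp: p_omega_def limitin_weak_star)

text \<open>The sums along the orbits of \<open>x\<close> and of \<open>f x\<close> differ in their first and last terms only.\<close>

lemma p_omega_invariant:
  assumes f: "f \<in> mspace self_maps" and x: "x \<in> {0..1}" and \<nu>: "\<nu> \<in> p_omega f x"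
  shows "\<nu> \<in> invariant_measures f"
  unfolding invariant_measures_iff_integral[OF f]
proof (intro conjI allI impI p_omega_unit_probs[OF \<nu>])
  fix \<phi> :: "real \<Rightarrow> real" assume c: "continuous_on {0..1} \<phi>"
  have cf: "continuous_on {0..1} (\<lambda>x. \<phi> (f x))" using continuous_comp_iterate[OF f c, of 1] by simp
  obtain r where r: "strict_mono (r :: nat \<Rightarrow> nat)"
    and l: "\<And>\<phi> :: real \<Rightarrow> real. continuous_on {0..1} \<phi> \<Longrightarrow> (\<lambda>k. integral\<^sup>L (empirical f x (r k)) \<phi>) \<longlonglongrightarrow> integral\<^sup>L \<nu> \<phi>"
    using p_omega_integral[OF \<nu>] by metis
  obtain B where B: "\<And>x. x \<in> {0..1} \<Longrightarrow> \<bar>\<phi> x\<bar> \<le> B" using continuous_bounded_unit[OF c] by metis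
  define D where "D k = integral\<^sup>L (empirical f x (r k)) (\<lambda>x. \<phi> (f x)) - integral\<^sup>L (empirical f x (r k)) \<phi>" for k
  have 1: "D \<longlonglongrightarrow> integral\<^sup>L \<nu> (\<lambda>x. \<phi> (f x)) - integral\<^sup>L \<nu> \<phi>"
    unfolding D_def by (intro tendsto_diff l c cf)
  have le: "\<bar>D k\<bar> \<le> 2 * B / r k" if "k \<ge> 1" for k
  proof -
    have rk: "r k \<ge> 1" using strict_mono_imp_increasing[OF r, of k] that by simp
    have "D k = ((\<Sum>j<r k. \<phi> ((f ^^ Suc j) x)) - (\<Sum>j<r k. \<phi> ((f ^^ j) x))) / r k"
      unfolding D_def integral_empirical[OF f x rk cf] integral_empirical[OF f x rk c]
      by (simp add: diff_divide_distrib)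
    also have "(\<Sum>j<r k. \<phi> ((f ^^ Suc j) x)) - (\<Sum>j<r k. \<phi> ((f ^^ j) x)) = \<phi> ((f ^^ r k) x) - \<phi> x"
      unfolding sum_subtractf[symmetric] by (subst sum_lessThan_telescope) simp
    finally have "\<bar>D k\<bar> = \<bar>\<phi> ((f ^^ r k) x) - \<phi> x\<bar> / r k" by simp
    also have "\<dots> \<le> 2 * B / r k"
      using B[OF x] B[OF iterate_self_map(1)[OF f x, of "r k"]]
      by (intro divide_right_mono) auto
    finally show ?thesis .
  qed
  have "(\<lambda>k. 2 * B / real (r k)) \<longlonglongrightarrow> 0"
    by (intro tendsto_divide_0[OF tendsto_const] filterlim_at_top_imp_at_infinity
        filterlim_compose[OF filterlim_real_sequentially filterlim_subseq[OF r]])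
  then have "D \<longlonglongrightarrow> 0"
    by (rule Lim_null_comparison[rotated]) (use le in \<open>auto simp: eventually_sequentially intro!: exI[of _ 1]\<close>)
  then have "integral\<^sup>L \<nu> (\<lambda>x. \<phi> (f x)) - integral\<^sup>L \<nu> \<phi> = 0" by (rule LIMSEQ_unique[OF 1])
  then show "integral\<^sup>L \<nu> (\<lambda>x. \<phi> (f x)) = integral\<^sup>L \<nu> \<phi>" by simp
qed

text \<open>The distance from \<open>K\<close> is a continuous function that vanishes along the orbit from some time
  on, so its limit averages vanish.\<close>

lemma p_omega_support:
  assumes f: "f \<in> mspace self_maps" and x: "x \<in> {0..1}" and \<nu>: "\<nu> \<in> p_omega f x"
    and K: "closed K" "K \<subseteq> {0..1}" "K \<noteq> {}" and ev: "\<And>n. n \<ge> N \<Longrightarrow> (f ^^ n) x \<in> K"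
  shows "measure \<nu> K = 1"
proof -
  define \<phi> where "\<phi> y = infdist y K" for y
  have c: "continuous_on {0..1} \<phi>" unfolding \<phi>_def by (intro continuous_intros)
  obtain r where r: "strict_mono (r :: nat \<Rightarrow> nat)"
    and l: "\<And>\<phi> :: real \<Rightarrow> real. continuous_on {0..1} \<phi> \<Longrightarrow> (\<lambda>k. integral\<^sup>L (empirical f x (r k)) \<phi>) \<longlonglongrightarrow> integral\<^sup>L \<nu> \<phi>"
    using p_omega_integral[OF \<nu>] by metis
  define C where "C = (\<Sum>j<N. \<phi> ((f ^^ j) x))"
  have eq: "integral\<^sup>L (empirical f x (r k)) \<phi> = C / r k" if "k \<ge> max 1 N" for k
  proof -
    have rk: "r k \<ge> 1" "r k \<ge> N" using strict_mono_imp_increasing[OF r, of k] that by simp_all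
    have "(\<Sum>j<r k. \<phi> ((f ^^ j) x)) = C"
      unfolding C_def using rk(2) ev by (intro sum.mono_neutral_right) (auto simp: \<phi>_def)
    then show ?thesis by (simp add: integral_empirical[OF f x rk(1) c])
  qed
  have "(\<lambda>k. C / real (r k)) \<longlonglongrightarrow> 0"
    by (intro tendsto_divide_0[OF tendsto_const] filterlim_at_top_imp_at_infinity
        filterlim_compose[OF filterlim_real_sequentially filterlim_subseq[OF r]])
  moreover have "\<forall>\<^sub>F k in sequentially. C / real (r k) = integral\<^sup>L (empirical f x (r k)) \<phi>"
    unfolding eventually_sequentially using eq by (intro exI[of _ "max 1 N"]) auto
  ultimately have "(\<lambda>k. integral\<^sup>L (empirical f x (r k)) \<phi>) \<longlonglongrightarrow> 0"
    by (rule Lim_transform_eventually)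
  then have z: "integral\<^sup>L \<nu> \<phi> = 0" by (rule LIMSEQ_unique[OF l[OF c]])
  note u = p_omega_unit_probs[OF \<nu>]
  interpret prob_space \<nu> using u by (rule unit_probsD)
  have "AE y in \<nu>. \<phi> y = 0"
    using integral_nonneg_eq_0_iff_AE[OF integrable_unit[OF u c]] z by (auto simp: \<phi>_def infdist_nonneg)
  then have "AE y in \<nu>. y \<in> K"
    by eventually_elim (use K in \<open>auto simp: \<phi>_def in_closed_iff_infdist_zero\<close>)
  moreover have "K \<in> sets \<nu>" using K(1,2) unit_probsD(2)[OF u] by (simp add: sets_unit_borel_iff)
  ultimately show ?thesis by (subst prob_eq_1) auto
qed

context dense_self_maps
begin

lemma tendsto_meas_dist:
  assumes l: "limitin weak_star \<sigma> \<nu> F" and \<mu>: "\<mu> \<in> unit_probs"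
  shows "((\<lambda>n. meas_dist \<Psi> (\<sigma> n) \<mu>) \<longlongrightarrow> meas_dist \<Psi> \<nu> \<mu>) F"
proof -
  have \<nu>: "\<nu> \<in> unit_probs" and ev: "\<forall>\<^sub>F n in F. \<sigma> n \<in> unit_probs"
    and d: "((\<lambda>n. meas_dist \<Psi> (\<sigma> n) \<nu>) \<longlongrightarrow> 0) F"
    using l by (auto simp: limitin_weak_star_meas_dist)
  have "((\<lambda>n. meas_dist \<Psi> (\<sigma> n) \<mu> - meas_dist \<Psi> \<nu> \<mu>) \<longlongrightarrow> 0) F"
  proof (rule Lim_null_comparison[OF _ d])
    show "\<forall>\<^sub>F n in F. norm (meas_dist \<Psi> (\<sigma> n) \<mu> - meas_dist \<Psi> \<nu> \<mu>) \<le> meas_dist \<Psi> (\<sigma> n) \<nu>"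
      using ev
    proof eventually_elim
      case (elim n)
      show ?case
        using meas_dist_triangle[OF elim \<nu> \<mu>] meas_dist_triangle[OF \<nu> elim \<mu>] meas_dist_commute[of "\<sigma> n" \<nu>]
        by (simp add: abs_le_iff)
    qed
  qed
  then show ?thesis by (simp add: Lim_null[symmetric])
qed

lemma meas_setdist_p_omega_less_iff:
  assumes f: "f \<in> mspace self_maps" and x: "x \<in> {0..1}" and \<mu>: "\<mu> \<in> unit_probs"
  shows "meas_setdist \<Psi> (p_omega f x) \<mu> < \<epsilon> \<longleftrightarrow> (\<exists>\<nu>\<in>p_omega f x. meas_dist \<Psi> \<nu> \<mu> < \<epsilon>)"
proof -
  have ne: "p_omega f x \<noteq> {}" using empirical_subsequence_converges[OF f x strict_mono_id] by auto
  have "bdd_below ((\<lambda>\<nu>. meas_dist \<Psi> \<nu> \<mu>) ` p_omega f x)"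
    using meas_dist_nonneg[OF p_omega_unit_probs \<mu>] by (intro bdd_belowI[where m=0]) auto
  then show ?thesis unfolding meas_setdist_def using ne by (subst cInf_less_iff) auto
qed

text \<open>By compactness the distance from \<open>p_omega f x\<close> is the lower limit of the distances from the
  empirical measures, which depend continuously on \<open>x\<close>.\<close>

lemma meas_setdist_p_omega_less_iff_empirical:
  assumes f: "f \<in> mspace self_maps" and x: "x \<in> {0..1}" and \<mu>: "\<mu> \<in> unit_probs"
  shows "meas_setdist \<Psi> (p_omega f x) \<mu> < \<epsilon> \<longleftrightarrow>
    (\<exists>k. \<forall>N. \<exists>n\<ge>N. meas_dist \<Psi> (empirical f x (Suc n)) \<mu> < \<epsilon> - 1 / Suc k)"
  unfolding meas_setdist_p_omega_less_iff[OF assms]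
proof
  assume "\<exists>\<nu>\<in>p_omega f x. meas_dist \<Psi> \<nu> \<mu> < \<epsilon>"
  then obtain \<nu> where \<nu>: "\<nu> \<in> p_omega f x" and less: "meas_dist \<Psi> \<nu> \<mu> < \<epsilon>"
    by blast
  obtain r where r: "strict_mono (r :: nat \<Rightarrow> nat)" "limitin weak_star (\<lambda>k. empirical f x (r k)) \<nu> sequentially"
    using \<nu> by (auto simp: p_omega_def)
  obtain k where k: "1 / real (Suc k) < \<epsilon> - meas_dist \<Psi> \<nu> \<mu>"
    using less reals_Archimedean[of "\<epsilon> - meas_dist \<Psi> \<nu> \<mu>"] by (auto simp: inverse_eq_divide)
  have "\<forall>\<^sub>F j in sequentially. meas_dist \<Psi> (empirical f x (r j)) \<mu> < \<epsilon> - 1 / Suc k"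
    using k by (intro order_tendstoD(2)[OF tendsto_meas_dist[OF r(2) \<mu>]]) linarith
  then obtain J where J: "\<And>j. j \<ge> J \<Longrightarrow> meas_dist \<Psi> (empirical f x (r j)) \<mu> < \<epsilon> - 1 / Suc k"
    by (auto simp: eventually_sequentially)
  show "\<exists>k. \<forall>N. \<exists>n\<ge>N. meas_dist \<Psi> (empirical f x (Suc n)) \<mu> < \<epsilon> - 1 / Suc k"
  proof (rule exI[of _ k], rule allI)
    fix N
    define j where "j = max J (Suc N)"
    have "r j \<ge> Suc N" using strict_mono_imp_increasing[OF r(1), of j] by (simp add: j_def)
    then show "\<exists>n\<ge>N. meas_dist \<Psi> (empirical f x (Suc n)) \<mu> < \<epsilon> - 1 / Suc k"
      using J[of j] by (intro exI[of _ "r j - 1"]) (auto simp: j_def)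
  qed
next
  assume "\<exists>k. \<forall>N. \<exists>n\<ge>N. meas_dist \<Psi> (empirical f x (Suc n)) \<mu> < \<epsilon> - 1 / Suc k"
  then obtain k where k: "\<forall>N. \<exists>n\<ge>N. meas_dist \<Psi> (empirical f x (Suc n)) \<mu> < \<epsilon> - 1 / Suc k" ..
  have "infinite {n. meas_dist \<Psi> (empirical f x (Suc n)) \<mu> < \<epsilon> - 1 / Suc k}" (is "infinite ?I")
    unfolding infinite_nat_iff_unbounded_le mem_Collect_eq by (rule k)
  then obtain r where r: "strict_mono (r :: nat \<Rightarrow> nat)" and rI: "\<And>j. r j \<in> ?I"
    using infinite_enumerate[of ?I] by metis
  have sr: "strict_mono (\<lambda>j. Suc (r j))" using r by (simp add: strict_mono_def)
  obtain s \<nu> where s: "limitin weak_star (\<lambda>j. empirical f x (Suc (r (s j)))) \<nu> sequentially" "\<nu> \<in> p_omega f x"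
    using empirical_subsequence_converges[OF f x sr] by metis
  have "meas_dist \<Psi> \<nu> \<mu> \<le> \<epsilon> - 1 / Suc k"
    using rI by (intro tendsto_upperbound[OF tendsto_meas_dist[OF s(1) \<mu>]] always_eventually)
      (auto intro: less_imp_le)
  also have "\<dots> < \<epsilon>" by simp
  finally have "meas_dist \<Psi> \<nu> \<mu> < \<epsilon>" .
  with s(2) show "\<exists>\<nu>\<in>p_omega f x. meas_dist \<Psi> \<nu> \<mu> < \<epsilon>" by auto
qed

text \<open>The outer measure of a set that is not measurable does not enter the notion of a
  pseudo-physical measure: positive measure of the set below presupposes that it is measurable.\<close>

lemma meas_setdist_p_omega_measurable:
  assumes f: "f \<in> mspace self_maps" and \<mu>: "\<mu> \<in> unit_probs"
  shows "{x \<in> {0..1}. meas_setdist \<Psi> (p_omega f x) \<mu> < \<epsilon>} \<in> sets borel"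
proof -
  define h where "h n x = meas_dist \<Psi> (empirical f x (Suc n)) \<mu>" for n x
  have [measurable]: "h n \<in> borel_measurable unit_borel" for n
  proof -
    have "(\<lambda>x. integral\<^sup>L (empirical f x (Suc n)) (\<Psi> i)) \<in> borel_measurable unit_borel" for i
    proof (rule continuous_measurable_unit)
      have "continuous_on {0..1} (\<lambda>x. (\<Sum>j<Suc n. \<Psi> i ((f ^^ j) x)) / Suc n)"
        by (intro continuous_intros continuous_comp_iterate f Psi_cont) auto
      then show "continuous_on {0..1} (\<lambda>x. integral\<^sup>L (empirical f x (Suc n)) (\<Psi> i))"
        by (rule continuous_on_eq) (simp add: integral_empirical[OF f _ _ Psi_cont])
    qed
    then show ?thesis unfolding h_def meas_dist_def
      by (intro borel_measurable_suminf borel_measurable_times borel_measurable_abs borel_measurable_diff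
          borel_measurable_const)
  qed
  have eq: "{x \<in> {0..1}. meas_setdist \<Psi> (p_omega f x) \<mu> < \<epsilon>} =
      {x \<in> space unit_borel. \<exists>k. \<forall>N. \<exists>n\<ge>N. h n x < \<epsilon> - 1 / Suc k}"
    using meas_setdist_p_omega_less_iff_empirical[OF f _ \<mu>] by (auto simp: h_def)
  have "{x \<in> space unit_borel. \<exists>k. \<forall>N. \<exists>n\<ge>N. h n x < \<epsilon> - 1 / Suc k} \<in> sets unit_borel"
    by measurable
  then show ?thesis unfolding eq sets_unit_borel_iff by (rule conjunct1)
qed

end

section \<open>Measures carried by the cycle of a shrinking interval\<close>

abbreviation cycle :: "(real \<Rightarrow> real) \<Rightarrow> nat \<Rightarrow> real set \<Rightarrow> real set" where
  "cycle f p I \<equiv> \<Union>j\<in>{1..p}. (f ^^ j) ` closure I"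

context
  fixes f :: "real \<Rightarrow> real" and p :: nat and I :: "real set"
  assumes f: "f \<in> mspace self_maps" and shr: "shrinking_interval f p I"
begin

lemma shrinking_closure: "closure I \<subseteq> {0..1}" "compact (closure I)" "closure I \<noteq> {}" "p \<ge> 1"
proof -
  show sub: "closure I \<subseteq> {0..1}"
    by (rule closure_minimal) (use shr in \<open>simp_all add: shrinking_interval_def\<close>)
  show "compact (closure I)"
    using bounded_subset[OF bounded_closed_interval sub] by (simp add: compact_eq_bounded_closed)
  show "closure I \<noteq> {}" "p \<ge> 1" using shr by (auto simp: shrinking_interval_def)
qed

lemma iterate_period_closure: "(f ^^ p) ` closure I \<subseteq> I" "(f ^^ p) ` closure I \<subseteq> closure I"
proof -
  show "(f ^^ p) ` closure I \<subseteq> I" using shr unfolding shrinking_interval_def by metis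
  then show "(f ^^ p) ` closure I \<subseteq> closure I" using closure_subset by (rule subset_trans)
qed

lemma compact_iterate_closure: "compact ((f ^^ j) ` closure I)" "(f ^^ j) ` closure I \<subseteq> {0..1}"
proof -
  show "compact ((f ^^ j) ` closure I)"
    by (rule compact_continuous_image[OF continuous_on_subset[OF iterate_self_map(2)[OF f] shrinking_closure(1)]
        shrinking_closure(2)])
  show "(f ^^ j) ` closure I \<subseteq> {0..1}"
    using shrinking_closure(1) iterate_self_map(1)[OF f] by blast
qed

lemma iterate_closure_measurable: "(f ^^ j) ` closure I \<in> sets unit_borel"
  using compact_iterate_closure[of j] by (auto simp: sets_unit_borel_iff borel_compact)

lemma closed_cycle: "closed (cycle f p I)" "cycle f p I \<subseteq> {0..1}" "cycle f p I \<noteq> {}"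
proof -
  show "closed (cycle f p I)" using compact_iterate_closure(1) by (intro closed_UN) (auto intro: compact_imp_closed)
  show "cycle f p I \<subseteq> {0..1}" using compact_iterate_closure(2) by blast
  show "cycle f p I \<noteq> {}" using shrinking_closure(3,4) by auto
qed

lemma cycle_measurable: "cycle f p I \<in> sets unit_borel"
  using closed_cycle by (auto simp: sets_unit_borel_iff)

text \<open>The cycle is forward invariant because it closes up: the image under \<open>f\<close> of the piece number
  \<open>p\<close> is contained in the piece number 1.\<close>

lemma iterate_in_cycle:
  assumes y: "y \<in> closure I" and n: "n \<ge> 1"
  shows "(f ^^ n) y \<in> cycle f p I"
proof -
  have "f z \<in> cycle f p I" if z: "z \<in> cycle f p I" for z
  proof -
    obtain j w where j: "j \<in> {1..p}" "w \<in> closure I" "z = (f ^^ j) w"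
      using z by auto
    show ?thesis
    proof (cases "j = p")
      case True
      then have "z \<in> closure I" using iterate_period_closure(2) j(2,3) by blast
      then have "f z \<in> (f ^^ 1) ` closure I" by auto
      then show ?thesis using shrinking_closure(4) by (intro UN_I[of 1]) auto
    next
      case False
      have "f z \<in> (f ^^ Suc j) ` closure I" using j by auto
      then show ?thesis using j False by (intro UN_I[of "Suc j"]) auto
    qed
  qed
  moreover have "(f ^^ Suc 0) y \<in> cycle f p I"
    using y shrinking_closure(4) by (intro UN_I[of "Suc 0"]) auto
  ultimately have "(f ^^ Suc m) y \<in> cycle f p I" for m by (induction m) auto
  then show ?thesis using n by (metis One_nat_def Suc_le_D)
qed

lemma cycle_subset: "cycle f p I \<subseteq> (\<Union>j<p. (f ^^ j) ` closure I)"
proof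
  fix z assume "z \<in> cycle f p I"
  then obtain j where j: "j \<in> {1..p}" "z \<in> (f ^^ j) ` closure I" by blast
  show "z \<in> (\<Union>j<p. (f ^^ j) ` closure I)"
  proof (cases "j = p")
    case True
    then have "z \<in> (f ^^ 0) ` closure I" using iterate_period_closure(2) j(2) by auto
    then show ?thesis using shrinking_closure(4) by (intro UN_I[of 0]) auto
  qed (use j in auto)
qed

lemma disjoint_cycle: "disjoint_family_on (\<lambda>j. (f ^^ j) ` closure I) {..<p}"
proof -
  have "{..<p} = {0..p - 1}" using shrinking_closure(4) by auto
  then show ?thesis using shr by (simp add: shrinking_interval_def)
qed

text \<open>Only the lengths of the images of the open interval are controlled. They are intervals, whose
  length is their diameter, and the diameter does not change on passing to the closure.\<close>

lemma diameter_iterate_closure: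
  assumes j: "j < p" and a: "a \<in> (f ^^ j) ` closure I" and b: "b \<in> (f ^^ j) ` closure I"
  shows "\<bar>a - b\<bar> \<le> measure lebesgue I"
proof -
  let ?S = "(f ^^ j) ` I"
  have sub: "?S \<subseteq> (f ^^ j) ` closure I" using closure_subset by blast
  have bd: "bounded ?S" using compact_iterate_closure(1)[of j] sub bounded_subset compact_imp_bounded by blast
  have conI: "connected I" using shr by (simp add: shrinking_interval_def is_interval_connected_1)
  have cont: "continuous_on (closure I) (f ^^ j)"
    using iterate_self_map(2)[OF f] shrinking_closure(1) by (rule continuous_on_subset)
  have con: "connected ?S"
    by (rule connected_continuous_image[OF continuous_on_subset[OF cont closure_subset] conI])
  then have cvx: "convex ?S" by (simp add: is_interval_connected_1 flip: is_interval_convex_1)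
  have lm: "?S \<in> lmeasurable" using cvx bd by (rule measurable_convex)
  have len: "measure lebesgue ?S \<le> measure lebesgue I"
    using shr j by (cases "j = 0") (auto simp: shrinking_interval_def intro: less_imp_le)
  have "diameter ?S \<le> measure lebesgue I"
  proof (rule diameter_le)
    fix x y assume xy: "x \<in> ?S" "y \<in> ?S"
    have "{min x y..max x y} \<subseteq> ?S"
      using connected_contains_Icc[OF con] xy by (auto simp: min_def max_def)
    then have "measure lebesgue {min x y..max x y} \<le> measure lebesgue ?S"
      by (intro measure_mono_fmeasurable lm) auto
    then show "norm (x - y) \<le> measure lebesgue I" using len by (auto simp: min_def max_def split: if_splits)
  qed auto
  then have "diameter (closure ?S) \<le> measure lebesgue I" using diameter_closure[OF bd] by simp
  moreover have "(f ^^ j) ` closure I \<subseteq> closure ?S"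
    by (rule image_closure_subset[OF cont]) (auto simp: closure_subset)
  ultimately show ?thesis
    using diameter_bounded_bound[OF bounded_closure[OF bd], of a b] a b
    unfolding dist_real_def by (meson order_trans subsetD)
qed

text \<open>Invariance makes the weights non-decreasing along the cycle, and the cycle closes up; so an
  invariant measure carried by the cycle gives the same weight to each of its \<open>p\<close> pieces.\<close>

lemma invariant_measure_piece:
  assumes \<nu>: "\<nu> \<in> invariant_measures f" "measure \<nu> (cycle f p I) = 1" and j: "j < p"
  shows "measure \<nu> ((f ^^ j) ` closure I) = 1 / p"
proof -
  note u = invariant_measures_unit_probs[OF \<nu>(1)]
  interpret prob_space \<nu> using u by (rule unit_probsD)
  let ?K = "\<lambda>j. (f ^^ j) ` closure I"
  have sets: "?K j \<in> sets \<nu>" for j using iterate_closure_measurable unit_probsD(2)[OF u] by simp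
  have step: "measure \<nu> (?K j) \<le> measure \<nu> (?K (Suc j))" for j
  proof -
    have "?K j \<subseteq> f -` ?K (Suc j) \<inter> {0..1}" using compact_iterate_closure(2)[of j] by auto
    then have "measure \<nu> (?K j) \<le> measure \<nu> (f -` ?K (Suc j) \<inter> {0..1})"
      by (rule finite_measure_mono)
        (simp only: unit_probsD(2)[OF u] invariant_measure_vimage(2)[OF f \<nu>(1) iterate_closure_measurable])
    then show ?thesis by (simp only: invariant_measure_vimage(1)[OF f \<nu>(1) iterate_closure_measurable])
  qed
  have mono: "measure \<nu> (?K i) \<le> measure \<nu> (?K j)" if "i \<le> j" for i j
    using that by (rule lift_Suc_mono_le[of "\<lambda>j. measure \<nu> (?K j)", OF step])
  have "?K p \<subseteq> ?K 0" using iterate_period_closure(2) by auto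
  then have wrap: "measure \<nu> (?K p) \<le> measure \<nu> (?K 0)" by (rule finite_measure_mono) (rule sets)
  have eq: "measure \<nu> (?K i) = measure \<nu> (?K 0)" if "i < p" for i
    using mono[of 0 i] mono[of i p] wrap that by simp
  have "1 \<le> measure \<nu> (\<Union>j<p. ?K j)"
    unfolding \<nu>(2)[symmetric] using sets cycle_subset by (intro finite_measure_mono) auto
  also have "\<dots> = (\<Sum>j<p. measure \<nu> (?K j))"
    using sets disjoint_cycle by (intro finite_measure_finite_Union) auto
  also have "\<dots> = p * measure \<nu> (?K 0)" using eq by simp
  finally have "1 \<le> p * measure \<nu> (?K 0)" .
  moreover have "p * measure \<nu> (?K 0) \<le> 1"
  proof -
    have "p * measure \<nu> (?K 0) = (\<Sum>j<p. measure \<nu> (?K j))" using eq by simp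
    also have "\<dots> = measure \<nu> (\<Union>j<p. ?K j)"
      using sets disjoint_cycle by (intro finite_measure_finite_Union[symmetric]) auto
    finally show ?thesis by simp
  qed
  ultimately have "p * measure \<nu> (?K 0) = 1" by simp
  then show ?thesis using eq[OF j] j by (simp add: field_simps)
qed

text \<open>Replace \<open>\<phi>\<close> on each piece by its value at a chosen point of the piece: the error is at most the
  oscillation of \<open>\<phi>\<close> at the scale of the interval, and all the pieces have the same weight.\<close>

lemma integral_near_cycle_average:
  assumes \<nu>: "\<nu> \<in> invariant_measures f" "measure \<nu> (cycle f p I) = 1"
    and c: "continuous_on {0..1} \<phi>"
    and osc: "\<And>x y. \<lbrakk>x \<in> {0..1}; y \<in> {0..1}; \<bar>x - y\<bar> \<le> measure lebesgue I\<rbrakk> \<Longrightarrow> \<bar>\<phi> x - \<phi> y\<bar> \<le> w"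
    and a: "\<And>j. j < p \<Longrightarrow> a j \<in> (f ^^ j) ` closure I"
  shows "\<bar>integral\<^sup>L \<nu> \<phi> - (\<Sum>j<p. \<phi> (a j)) / p\<bar> \<le> w"
proof -
  note u = invariant_measures_unit_probs[OF \<nu>(1)]
  interpret prob_space \<nu> using u by (rule unit_probsD)
  let ?K = "\<lambda>j. (f ^^ j) ` closure I"
  have sets: "?K j \<in> sets \<nu>" for j using iterate_closure_measurable unit_probsD(2)[OF u] by simp
  define s where "s x = (\<Sum>j<p. \<phi> (a j) * indicator (?K j) x)" for x
  have ints: "integrable \<nu> s" unfolding s_def using sets emeasure_finite
    by (intro Bochner_Integration.integrable_sum integrable_mult_right) (auto simp: less_top[symmetric])
  have "integral\<^sup>L \<nu> s = (\<Sum>j<p. \<phi> (a j) * measure \<nu> (?K j))"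
    unfolding s_def using sets emeasure_finite
    by (subst Bochner_Integration.integral_sum)
      (auto simp: less_top[symmetric] intro!: integrable_mult_right)
  also have "\<dots> = (\<Sum>j<p. \<phi> (a j)) / p"
    using invariant_measure_piece[OF \<nu>] by (simp add: sum_divide_distrib)
  finally have Is: "integral\<^sup>L \<nu> s = (\<Sum>j<p. \<phi> (a j)) / p" .
  have near: "\<bar>\<phi> x - s x\<bar> \<le> w" if x: "x \<in> cycle f p I" for x
  proof -
    obtain i where i: "i < p" "x \<in> ?K i" using x cycle_subset by blast
    have "s x = (\<Sum>j<p. if j = i then \<phi> (a i) else 0)"
      unfolding s_def using i disjoint_cycle
      by (intro sum.cong) (auto simp: indicator_def disjoint_family_on_def)
    then have "s x = \<phi> (a i)" using i by simp
    moreover have "x \<in> {0..1}" "a i \<in> {0..1}" using i a compact_iterate_closure(2) by blast+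
    ultimately show ?thesis using osc[of x "a i"] diameter_iterate_closure[OF i(1,2) a[OF i(1)]] by simp
  qed
  have ae: "AE x in \<nu>. x \<in> cycle f p I"
    using \<nu>(2) cycle_measurable unit_probsD(2)[OF u] by (subst (asm) prob_eq_1) auto
  have ip: "integrable \<nu> \<phi>" by (rule integrable_unit[OF u c])
  have "\<bar>integral\<^sup>L \<nu> \<phi> - integral\<^sup>L \<nu> s\<bar> = \<bar>\<integral>x. \<phi> x - s x \<partial>\<nu>\<bar>"
    using ip ints by simp
  also have "\<dots> \<le> (\<integral>x. \<bar>\<phi> x - s x\<bar> \<partial>\<nu>)" by (rule integral_abs_bound)
  also have "\<dots> \<le> (\<integral>x. w \<partial>\<nu>)"
    using ip ints ae by (intro integral_mono_AE) (auto elim!: AE_mp simp: near)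
  finally show ?thesis using Is by (simp add: prob_space)
qed

text \<open>The map \<open>f ^^ p\<close> sends the closure of \<open>I\<close> into itself and so has a fixed point there; since the
  pieces are disjoint, its period cannot be smaller than \<open>p\<close>.\<close>

lemma shrinking_interval_periodic_point:
  obtains x where "x \<in> closure I" "periodic_point f p x"
proof -
  have "convex (closure I)"
    using shr by (intro convex_closure) (simp add: shrinking_interval_def is_interval_convex_1)
  moreover have "continuous_on (closure I) (f ^^ p)"
    using iterate_self_map(2)[OF f] shrinking_closure(1) by (rule continuous_on_subset)
  moreover have "(f ^^ p) \<in> closure I \<rightarrow> closure I"
    using iterate_period_closure(2) by auto
  ultimately obtain x where x: "x \<in> closure I" "(f ^^ p) x = x"
    using brouwer[of "closure I" "f ^^ p"] shrinking_closure(2,3) by blast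
  have "(f ^^ j) x \<noteq> x" if "1 \<le> j" "j < p" for j
  proof -
    have "(f ^^ j) ` closure I \<inter> (f ^^ 0) ` closure I = {}"
      using that by (intro disjoint_family_onD[OF disjoint_cycle]) auto
    then show ?thesis using x by auto
  qed
  then show thesis using x shrinking_closure(1,4) by (intro that[of x]) (auto simp: periodic_point_def)
qed

lemma shrinking_interval_periodic_measure:
  assumes len: "measure lebesgue I < 1 / real q"
  obtains \<nu> where "\<nu> \<in> shrinked_periodic q f" "measure \<nu> (cycle f p I) = 1"
proof -
  obtain x where x: "x \<in> closure I" "periodic_point f p x" by (rule shrinking_interval_periodic_point)
  then have x01: "x \<in> {0..1}" and fx: "(f ^^ p) x = x" by (auto simp: periodic_point_def)
  have "(f ^^ j) x \<in> cycle f p I" for j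
  proof (cases "j = 0")
    case True
    have "(f ^^ p) x \<in> cycle f p I" by (rule iterate_in_cycle[OF x(1) shrinking_closure(4)])
    then show ?thesis using True fx by simp
  qed (use iterate_in_cycle[OF x(1), of j] in auto)
  then have "measure (empirical f x p) (cycle f p I) = 1"
    using measure_empirical[OF f x01 shrinking_closure(4) cycle_measurable] shrinking_closure(4) by simp
  then show thesis
    using that[of "empirical f x p"] x(2) shr len
    unfolding shrinked_periodic_def periodic_measures_def by blast
qed

lemma p_omega_cycle:
  assumes x: "x \<in> {0..1}" "(f ^^ n) x \<in> I" and \<nu>: "\<nu> \<in> p_omega f x"
  shows "measure \<nu> (cycle f p I) = 1"
proof (rule p_omega_support[OF f x(1) \<nu> closed_cycle])
  fix m assume "m \<ge> Suc n"
  then have "(f ^^ m) x = (f ^^ (m - n)) ((f ^^ n) x)"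
    by (simp add: funpow_add[symmetric, THEN fun_cong, unfolded comp_def])
  then show "(f ^^ m) x \<in> cycle f p I"
    using iterate_in_cycle[OF subsetD[OF closure_subset x(2)], of "m - n"] \<open>m \<ge> Suc n\<close> by simp
qed

end

lemma shrinked_periodicE:
  assumes "\<nu> \<in> shrinked_periodic q f"
  obtains I p where "shrinking_interval f p I" "measure lebesgue I < 1 / real q" "measure \<nu> (cycle f p I) = 1"
  using assms by (auto simp: shrinked_periodic_def)

definition entering :: "(real \<Rightarrow> real) \<Rightarrow> nat \<Rightarrow> real set" where
  "entering f q = {x \<in> {0..1}. \<exists>I p n. shrinking_interval f p I \<and> measure lebesgue I < 1 / real q \<and> (f ^^ n) x \<in> I}"

text \<open>A cycle that the orbit of \<open>x\<close> enters is closed and retains the orbit, hence it carries each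
  element of \<open>p_omega f x\<close>.\<close>

lemma p_omega_infinitely_shrinked:
  assumes f: "f \<in> mspace self_maps" and x: "x \<in> {0..1}" "\<And>q. q \<ge> 1 \<Longrightarrow> x \<in> entering f q"
  shows "p_omega f x \<subseteq> infinitely_shrinked f"
proof
  fix \<nu> assume \<nu>: "\<nu> \<in> p_omega f x"
  have "\<forall>q. \<exists>I p. q \<ge> 1 \<longrightarrow> shrinking_interval f p I \<and> measure lebesgue I < 1 / real q \<and> measure \<nu> (cycle f p I) = 1"
  proof (intro allI)
    fix q :: nat
    show "\<exists>I p. q \<ge> 1 \<longrightarrow> shrinking_interval f p I \<and> measure lebesgue I < 1 / real q \<and> measure \<nu> (cycle f p I) = 1"
      using x(2)[of q] p_omega_cycle[OF f _ x(1) _ \<nu>] unfolding entering_def by blast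
  qed
  then obtain I p where "\<forall>q\<ge>1. shrinking_interval f (p q) (I q) \<and> measure lebesgue (I q) < 1 / real q \<and>
      measure \<nu> (cycle f (p q) (I q)) = 1"
    by metis
  then show "\<nu> \<in> infinitely_shrinked f"
    unfolding infinitely_shrinked_def using p_omega_invariant[OF f x(1) \<nu>] by blast
qed

context dense_self_maps
begin

text \<open>Both measures are close to the same average along the cycle. The scale \<open>q\<close> depends on neither
  the map nor the period, as it comes from the moduli of continuity of finitely many of the functions
  \<open>\<Psi> i\<close>.\<close>

lemma meas_dist_cycle_small:
  assumes e: "e > 0"
  obtains q :: nat where "q \<ge> 1"
    "\<And>f p I \<mu> \<nu>. \<lbrakk>f \<in> mspace self_maps; shrinking_interval f p I; measure lebesgue I < 1 / real q;
      \<mu> \<in> invariant_measures f; measure \<mu> (cycle f p I) = 1;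
      \<nu> \<in> invariant_measures f; measure \<nu> (cycle f p I) = 1\<rbrakk> \<Longrightarrow> meas_dist \<Psi> \<mu> \<nu> < e"
proof -
  obtain N where N: "\<And>\<mu> \<nu>. \<lbrakk>\<mu> \<in> unit_probs; \<nu> \<in> unit_probs;
      \<And>i. i < N \<Longrightarrow> \<bar>integral\<^sup>L \<mu> (\<Psi> i) - integral\<^sup>L \<nu> (\<Psi> i)\<bar> \<le> e / 2\<rbrakk> \<Longrightarrow> meas_dist \<Psi> \<mu> \<nu> < e"
    using meas_dist_less_criterion[OF e] by metis
  have "\<exists>d>0. \<forall>x\<in>{0..1}. \<forall>y\<in>{0..1}. \<bar>x - y\<bar> < d \<longrightarrow> \<bar>\<Psi> i x - \<Psi> i y\<bar> < e / 4" for i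
  proof -
    have "uniformly_continuous_on {0..1} (\<Psi> i)"
      by (rule compact_uniformly_continuous[OF Psi_cont compact_Icc])
    then show ?thesis using e unfolding uniformly_continuous_on_def
      by (metis dist_commute dist_real_def divide_pos_pos zero_less_numeral)
  qed
  then obtain d where d: "\<And>i. d i > 0"
    "\<And>i x y. \<lbrakk>x \<in> {0..1}; y \<in> {0..1}; \<bar>x - y\<bar> < d i\<rbrakk> \<Longrightarrow> \<bar>\<Psi> i x - \<Psi> i y\<bar> < e / 4"
    by metis
  define D where "D = Min (insert 1 (d ` {..<N}))"
  have D: "D > 0" "\<And>i. i < N \<Longrightarrow> D \<le> d i" using d(1) by (auto simp: D_def)
  obtain n where n: "1 / real (Suc n) < D" using reals_Archimedean[OF D(1)] by (auto simp: inverse_eq_divide)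
  show thesis
  proof (rule that[of "Suc n"])
    fix f p I \<mu> \<nu>
    assume f: "f \<in> mspace self_maps" and shr: "shrinking_interval f p I" and len: "measure lebesgue I < 1 / real (Suc n)"
      and \<mu>: "\<mu> \<in> invariant_measures f" "measure \<mu> (cycle f p I) = 1"
      and \<nu>: "\<nu> \<in> invariant_measures f" "measure \<nu> (cycle f p I) = 1"
    show "meas_dist \<Psi> \<mu> \<nu> < e"
    proof (rule N)
      fix i assume i: "i < N"
      obtain z where z: "z \<in> closure I" using shrinking_closure(3)[OF f shr] ex_in_conv by metis
      have osc: "\<bar>\<Psi> i x - \<Psi> i y\<bar> \<le> e / 4" if "x \<in> {0..1}" "y \<in> {0..1}" "\<bar>x - y\<bar> \<le> measure lebesgue I" for x y
        using d(2)[OF that(1,2), of i] that(3) len n D(2)[OF i] by linarith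
      have a: "(f ^^ j) z \<in> (f ^^ j) ` closure I" for j using z by blast
      have "\<bar>integral\<^sup>L \<mu> (\<Psi> i) - (\<Sum>j<p. \<Psi> i ((f ^^ j) z)) / p\<bar> \<le> e / 4"
        using osc a by (intro integral_near_cycle_average[OF f shr \<mu> Psi_cont]) auto
      moreover have "\<bar>integral\<^sup>L \<nu> (\<Psi> i) - (\<Sum>j<p. \<Psi> i ((f ^^ j) z)) / p\<bar> \<le> e / 4"
        using osc a by (intro integral_near_cycle_average[OF f shr \<nu> Psi_cont]) auto
      ultimately show "\<bar>integral\<^sup>L \<mu> (\<Psi> i) - integral\<^sup>L \<nu> (\<Psi> i)\<bar> \<le> e / 2" by linarith
    qed (use \<mu> \<nu> invariant_measures_unit_probs in auto)
  qed simp
qed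

lemma infinitely_shrinked_subset_closure:
  assumes f: "f \<in> mspace self_maps"
  shows "infinitely_shrinked f \<subseteq> weak_star closure_of periodic_measures f"
proof
  fix \<mu> assume "\<mu> \<in> infinitely_shrinked f"
  then obtain I p where inv: "\<mu> \<in> invariant_measures f"
    and Ip: "\<And>q. q \<ge> 1 \<Longrightarrow> shrinking_interval f (p q) (I q) \<and> measure lebesgue (I q) < 1 / real q \<and>
        measure \<mu> (cycle f (p q) (I q)) = 1"
    by (auto simp: infinitely_shrinked_def)
  show "\<mu> \<in> weak_star closure_of periodic_measures f"
    unfolding in_weak_star_closure
  proof (intro conjI allI impI)
    fix e :: real assume "e > 0"
    then obtain q :: nat where q: "q \<ge> 1"
      "\<And>f p I \<mu> \<nu>. \<lbrakk>f \<in> mspace self_maps; shrinking_interval f p I; measure lebesgue I < 1 / real q;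
      \<mu> \<in> invariant_measures f; measure \<mu> (cycle f p I) = 1;
      \<nu> \<in> invariant_measures f; measure \<nu> (cycle f p I) = 1\<rbrakk> \<Longrightarrow> meas_dist \<Psi> \<mu> \<nu> < e"
      using meas_dist_cycle_small by metis
    obtain \<nu> where \<nu>: "\<nu> \<in> shrinked_periodic q f" "measure \<nu> (cycle f (p q) (I q)) = 1"
      using shrinking_interval_periodic_measure[OF f] Ip[OF q(1)] by metis
    then have per: "\<nu> \<in> periodic_measures f" by (simp add: shrinked_periodic_def)
    then have nui: "\<nu> \<in> invariant_measures f"
      using periodic_measures_ergodic[OF f] by (auto simp: ergodic_measures_def)
    have "meas_dist \<Psi> \<nu> \<mu> < e" using q(2)[OF f _ _ nui \<nu>(2) inv] Ip[OF q(1)] by blast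
    then show "\<exists>\<nu>\<in>periodic_measures f \<inter> unit_probs. meas_dist \<Psi> \<nu> \<mu> < e"
      using per nui invariant_measures_unit_probs by blast
  qed (rule invariant_measures_unit_probs[OF inv])
qed

end

section \<open>Consequences of the abundance of shrinking intervals\<close>

lemma entering_subset: "entering f q \<subseteq> {0..1}"
  by (auto simp: entering_def)

lemma entering_antimono:
  assumes "1 \<le> q" "q \<le> q'"
  shows "entering f q' \<subseteq> entering f q"
proof -
  have "1 / real q' \<le> 1 / real q" using assms by (simp add: frac_le)
  then show ?thesis unfolding entering_def by (blast intro: less_le_trans)
qed

text \<open>The sets \<open>entering f q\<close> decrease as \<open>q\<close> grows, so that each of them contains Borel sets whose
  complements are as small as desired. The sets \<open>J\<close> spare the question whether \<open>entering f q\<close> is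
  measurable.\<close>

lemma entering_almost_everywhere:
  assumes G: "\<And>q. q \<ge> 1 \<Longrightarrow> \<exists>J\<in>sets borel. J \<subseteq> entering f q \<and> emeasure lborel ({0..1} - J) \<le> ennreal (1 / real q)"
  obtains E where "E \<in> sets borel" "E \<subseteq> {0..1}" "emeasure lborel ({0..1} - E) = 0"
    "\<And>x q. \<lbrakk>x \<in> E; q \<ge> 1\<rbrakk> \<Longrightarrow> x \<in> entering f q"
proof -
  have "\<forall>q. \<exists>J. q \<ge> 1 \<longrightarrow> J \<in> sets borel \<and> J \<subseteq> entering f q \<and> emeasure lborel ({0..1} - J) \<le> ennreal (1 / real q)"
    using G by blast
  then obtain J where J: "\<And>q. q \<ge> 1 \<Longrightarrow> J q \<in> sets borel" "\<And>q. q \<ge> 1 \<Longrightarrow> J q \<subseteq> entering f q"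
    "\<And>q. q \<ge> 1 \<Longrightarrow> emeasure lborel ({0..1} - J q) \<le> ennreal (1 / real q)"
    by metis
  define E where "E = (\<Inter>q\<in>{1..}. \<Union>m\<in>{q..}. J m)"
  have Eb: "E \<in> sets borel" unfolding E_def using J(1) by (intro sets.countable_INT') auto
  have ent: "x \<in> entering f q" if x: "x \<in> E" and q: "q \<ge> 1" for x q
  proof -
    obtain m where "m \<ge> q" "x \<in> J m" using x q by (auto simp: E_def)
    then show ?thesis using J(2)[of m] entering_antimono[OF q, of m f] q by auto
  qed
  have "emeasure lborel ({0..1} - (\<Union>m\<in>{q..}. J m)) = 0" if q: "q \<ge> 1" for q
  proof -
    let ?e = "emeasure lborel ({0..1} - (\<Union>m\<in>{q..}. J m))"
    have le: "?e \<le> ennreal (1 / real m)" if "m \<ge> q" for m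
    proof -
      have "?e \<le> emeasure lborel ({0..1} - J m)" using that q J(1) by (intro emeasure_mono) auto
      also have "\<dots> \<le> ennreal (1 / real m)" using J(3)[of m] that q by simp
      finally show ?thesis .
    qed
    have "(\<lambda>m. ennreal (1 / real m)) \<longlonglongrightarrow> ennreal 0"
      by (intro tendsto_ennrealI lim_1_over_n)
    then have "?e \<le> ennreal 0"
      using le by (intro tendsto_lowerbound[where f="\<lambda>m. ennreal (1 / real m)"]) (auto simp: eventually_sequentially intro!: exI[of _ q])
    then show ?thesis by simp
  qed
  then have "(\<Union>q\<in>{1..}. {0..1} - (\<Union>m\<in>{q..}. J m)) \<in> null_sets lborel"
    using J(1) by (intro null_sets_UN') (auto simp: null_sets_def intro!: sets.Diff sets.countable_UN')
  moreover have "(\<Union>q\<in>{1..}. {0..1} - (\<Union>m\<in>{q..}. J m)) = {0..1} - E" by (auto simp: E_def)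
  ultimately have "emeasure lborel ({0..1} - E) = 0" by auto
  then show thesis using that[OF Eb _ _ ent] ent entering_subset by blast
qed

context dense_self_maps
begin

lemma shrinked_periodic_subset:
  assumes "f \<in> mspace self_maps"
  shows "shrinked_periodic q f \<subseteq> periodic_measures f" "periodic_measures f \<subseteq> invariant_measures f"
  using periodic_measures_ergodic[OF assms] by (auto simp: shrinked_periodic_def ergodic_measures_def)

text \<open>This turns approximation by periodic measures into a statement about orbits of a whole open set
  of points: take a periodic measure close to \<open>\<mu>\<close> on a cycle so short that all invariant measures on
  it are close to each other.\<close>

lemma near_shrinked_periodic:
  assumes f: "f \<in> mspace self_maps"
    and \<mu>: "\<And>q. q \<ge> 1 \<Longrightarrow> \<mu> \<in> weak_star closure_of shrinked_periodic q f" and e: "e > 0"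
  obtains I where "open I" "I \<noteq> {}" "I \<subseteq> {0..1}"
    "\<And>x \<nu>. \<lbrakk>x \<in> I; \<nu> \<in> p_omega f x\<rbrakk> \<Longrightarrow> meas_dist \<Psi> \<nu> \<mu> < e"
proof -
  obtain q :: nat where q: "q \<ge> 1"
    "\<And>f p I \<mu> \<nu>. \<lbrakk>f \<in> mspace self_maps; shrinking_interval f p I; measure lebesgue I < 1 / real q;
      \<mu> \<in> invariant_measures f; measure \<mu> (cycle f p I) = 1;
      \<nu> \<in> invariant_measures f; measure \<nu> (cycle f p I) = 1\<rbrakk> \<Longrightarrow> meas_dist \<Psi> \<mu> \<nu> < e / 2"
    using meas_dist_cycle_small[of "e / 2"] e by (metis half_gt_zero)
  have u: "\<mu> \<in> unit_probs" using \<mu>[OF q(1)] by (simp add: in_weak_star_closure)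
  obtain \<rho> where \<rho>: "\<rho> \<in> shrinked_periodic q f" "\<rho> \<in> unit_probs" "meas_dist \<Psi> \<rho> \<mu> < e / 2"
    using \<mu>[OF q(1)] e unfolding in_weak_star_closure by (meson IntE half_gt_zero)
  obtain I p where I: "shrinking_interval f p I" "measure lebesgue I < 1 / real q" "measure \<rho> (cycle f p I) = 1"
    using \<rho>(1) by (rule shrinked_periodicE)
  have \<rho>i: "\<rho> \<in> invariant_measures f" using shrinked_periodic_subset[OF f] \<rho>(1) by blast
  have I01: "open I" "I \<noteq> {}" "I \<subseteq> {0..1}" using I(1) by (auto simp: shrinking_interval_def)
  have "meas_dist \<Psi> \<nu> \<mu> < e" if x: "x \<in> I" and \<nu>: "\<nu> \<in> p_omega f x" for x \<nu>
  proof -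
    have x01: "x \<in> {0..1}" and x0: "(f ^^ 0) x \<in> I" using x I01 by auto
    have "meas_dist \<Psi> \<nu> \<rho> < e / 2"
      by (rule q(2)[OF f I(1,2) p_omega_invariant[OF f x01 \<nu>] p_omega_cycle[OF f I(1) x01 x0 \<nu>] \<rho>i I(3)])
    then show ?thesis using meas_dist_triangle[OF p_omega_unit_probs[OF \<nu>] \<rho>(2) u] \<rho>(3) by simp
  qed
  with I01 show thesis by (rule that)
qed

lemma shrinked_periodic_limit_pseudo_physical:
  assumes f: "f \<in> mspace self_maps"
    and \<mu>: "\<And>q. q \<ge> 1 \<Longrightarrow> \<mu> \<in> weak_star closure_of shrinked_periodic q f"
  shows "\<mu> \<in> pseudo_physical \<Psi> f"
  unfolding pseudo_physical_def mem_Collect_eq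
proof (intro conjI allI impI)
  show u: "\<mu> \<in> unit_probs" using \<mu>[of 1] by (simp add: in_weak_star_closure)
  fix e :: real assume "e > 0"
  obtain I where I: "open I" "I \<noteq> {}" "I \<subseteq> {0..1}"
    "\<And>x \<nu>. \<lbrakk>x \<in> I; \<nu> \<in> p_omega f x\<rbrakk> \<Longrightarrow> meas_dist \<Psi> \<nu> \<mu> < e"
    using near_shrinked_periodic[OF f \<mu> \<open>e > 0\<close>] by metis
  let ?S = "{x \<in> {0..1}. meas_setdist \<Psi> (p_omega f x) \<mu> < e}"
  have "I \<subseteq> ?S"
  proof
    fix x assume x: "x \<in> I"
    then have x01: "x \<in> {0..1}" using I(3) by blast
    obtain \<nu> where "\<nu> \<in> p_omega f x" using empirical_subsequence_converges[OF f x01 strict_mono_id] by metis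
    then show "x \<in> ?S" using meas_setdist_p_omega_less_iff[OF f x01 u] I(4)[OF x] x01 by blast
  qed
  moreover have "?S \<in> sets lebesgue" using meas_setdist_p_omega_measurable[OF f u] by auto
  ultimately have "emeasure lebesgue I \<le> emeasure lebesgue ?S" by (rule emeasure_mono)
  moreover have "I \<notin> null_sets lebesgue" using open_not_negligible[OF I(1,2)] by (simp add: negligible_iff_null_sets)
  then have "emeasure lebesgue I \<noteq> 0" using I(1) by (auto simp: null_sets_def)
  ultimately show "emeasure lebesgue ?S > 0" by (auto simp: zero_less_iff_neq_zero)
qed

lemma shrinked_periodic_limit_infinitely_shrinked:
  assumes f: "f \<in> mspace self_maps"
    and \<mu>: "\<And>q. q \<ge> 1 \<Longrightarrow> \<mu> \<in> weak_star closure_of shrinked_periodic q f"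
    and E: "E \<in> sets borel" "E \<subseteq> {0..1}" "emeasure lborel ({0..1} - E) = 0"
      "\<And>x q. \<lbrakk>x \<in> E; q \<ge> 1\<rbrakk> \<Longrightarrow> x \<in> entering f q"
  shows "\<mu> \<in> weak_star closure_of infinitely_shrinked f"
  unfolding in_weak_star_closure
proof (intro conjI allI impI)
  show "\<mu> \<in> unit_probs" using \<mu>[of 1] by (simp add: in_weak_star_closure)
  fix e :: real assume "e > 0"
  obtain I where I: "open I" "I \<noteq> {}" "I \<subseteq> {0..1}"
    "\<And>x \<nu>. \<lbrakk>x \<in> I; \<nu> \<in> p_omega f x\<rbrakk> \<Longrightarrow> meas_dist \<Psi> \<nu> \<mu> < e"
    using near_shrinked_periodic[OF f \<mu> \<open>e > 0\<close>] by metis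
  have "I \<inter> E \<noteq> {}"
  proof
    assume "I \<inter> E = {}"
    then have "I \<subseteq> {0..1} - E" using I(3) by blast
    moreover have "{0..1} - E \<in> null_sets lebesgue"
      using E(1,3) by (intro null_sets_completionI) (auto simp: null_sets_def)
    ultimately have "negligible I" using negligible_iff_null_sets negligible_subset by blast
    then show False using open_not_negligible[OF I(1,2)] by simp
  qed
  then obtain x where x: "x \<in> I" "x \<in> E" by blast
  then have x01: "x \<in> {0..1}" using I(3) by blast
  obtain \<nu> where \<nu>: "\<nu> \<in> p_omega f x" using empirical_subsequence_converges[OF f x01 strict_mono_id] by metis
  have "\<nu> \<in> infinitely_shrinked f" using p_omega_infinitely_shrinked[OF f x01 E(4)[OF x(2)]] \<nu> by blast
  then show "\<exists>\<nu>\<in>infinitely_shrinked f \<inter> unit_probs. meas_dist \<Psi> \<nu> \<mu> < e"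
    using I(4)[OF x(1) \<nu>] p_omega_unit_probs[OF \<nu>] by blast
qed

lemma pseudo_physical_subset_closure:
  assumes f: "f \<in> mspace self_maps"
    and E: "E \<in> sets borel" "E \<subseteq> {0..1}" "emeasure lborel ({0..1} - E) = 0"
      "\<And>x q. \<lbrakk>x \<in> E; q \<ge> 1\<rbrakk> \<Longrightarrow> x \<in> entering f q"
  shows "pseudo_physical \<Psi> f \<subseteq> weak_star closure_of infinitely_shrinked f"
proof
  fix \<mu> assume \<mu>: "\<mu> \<in> pseudo_physical \<Psi> f"
  then have u: "\<mu> \<in> unit_probs" by (simp add: pseudo_physical_def)
  show "\<mu> \<in> weak_star closure_of infinitely_shrinked f"
    unfolding in_weak_star_closure
  proof (intro conjI allI impI u)
    fix e :: real assume e: "e > 0"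
    let ?S = "{x \<in> {0..1}. meas_setdist \<Psi> (p_omega f x) \<mu> < e}"
    have pos: "emeasure lebesgue ?S > 0" using \<mu> e by (simp add: pseudo_physical_def)
    have "?S \<inter> E \<noteq> {}"
    proof
      assume "?S \<inter> E = {}"
      then have "?S \<subseteq> {0..1} - E" by blast
      then have "emeasure lebesgue ?S \<le> emeasure lebesgue ({0..1} - E)"
        using E(1) by (intro emeasure_mono) auto
      also have "\<dots> = 0" using E(1,3) by simp
      finally show False using pos by simp
    qed
    then obtain x where x: "x \<in> ?S" "x \<in> E" by blast
    then have x01: "x \<in> {0..1}" by blast
    obtain \<nu> where \<nu>: "\<nu> \<in> p_omega f x" "meas_dist \<Psi> \<nu> \<mu> < e"
      using meas_setdist_p_omega_less_iff[OF f x01 u] x(1) by blast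
    have "\<nu> \<in> infinitely_shrinked f" using p_omega_infinitely_shrinked[OF f x01 E(4)[OF x(2)]] \<nu>(1) by blast
    then show "\<exists>\<nu>\<in>infinitely_shrinked f \<inter> unit_probs. meas_dist \<Psi> \<nu> \<mu> < e"
      using \<nu> p_omega_unit_probs[OF \<nu>(1)] by blast
  qed
qed

text \<open>With \<open>C\<close> for the closure of the periodic measures and \<open>B\<close> for the set of limits of periodic
  measures on ever shorter cycles, the hypothesis on ergodic measures gives \<open>B = C\<close>; each
  of the other sets contains \<open>B\<close> and is contained in \<open>C\<close>.\<close>

lemma abundance_implies_equalities:
  assumes f: "f \<in> mspace self_maps"
    and erg: "\<And>q. q \<ge> 1 \<Longrightarrow> ergodic_measures f \<subseteq> weak_star closure_of shrinked_periodic q f"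
    and ent: "\<And>q. q \<ge> 1 \<Longrightarrow> \<exists>J\<in>sets borel. J \<subseteq> entering f q \<and> emeasure lborel ({0..1} - J) \<le> ennreal (1 / real q)"
  shows "(\<forall>\<epsilon>>0. periodic_measures f
        \<subseteq> (\<Inter>q\<in>{1..}. weak_star closure_of almost_shrinked_periodic \<Psi> \<epsilon> q f)) \<and>
    (\<Inter>\<epsilon>\<in>{0<..}. \<Inter>q\<in>{1..}. weak_star closure_of almost_shrinked_periodic \<Psi> \<epsilon> q f)
      = pseudo_physical \<Psi> f \<and>
    pseudo_physical \<Psi> f = weak_star closure_of infinitely_shrinked f \<and>
    weak_star closure_of infinitely_shrinked f = weak_star closure_of ergodic_measures f \<and>
    weak_star closure_of ergodic_measures f = weak_star closure_of periodic_measures f \<and>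
    (\<forall>\<mu>\<in>ergodic_measures f. \<mu> \<in> pseudo_physical \<Psi> f)"
proof -
  define A where "A \<epsilon> q = weak_star closure_of almost_shrinked_periodic \<Psi> \<epsilon> q f" for \<epsilon> q
  define B where "B = (\<Inter>q\<in>{1..}. weak_star closure_of shrinked_periodic q f)"
  define C where "C = weak_star closure_of periodic_measures f"
  obtain E where E: "E \<in> sets borel" "E \<subseteq> {0..1}" "emeasure lborel ({0..1} - E) = 0"
      "\<And>x q. \<lbrakk>x \<in> E; q \<ge> 1\<rbrakk> \<Longrightarrow> x \<in> entering f q"
    using entering_almost_everywhere[OF ent] by metis
  note sp = shrinked_periodic_subset[OF f]
  have "weak_star closure_of ergodic_measures f \<subseteq> B"
    unfolding B_def by (intro INT_greatest closure_of_minimal erg) auto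
  moreover have "C \<subseteq> weak_star closure_of ergodic_measures f"
    unfolding C_def by (rule closure_of_mono[OF periodic_measures_ergodic[OF f]])
  moreover have "B \<subseteq> C"
    unfolding B_def C_def using closure_of_mono[OF sp(1)[of 1], of weak_star] by blast
  ultimately have CB: "weak_star closure_of ergodic_measures f = C" "B = C" by auto
  have Bl: "\<mu> \<in> weak_star closure_of shrinked_periodic q f" if "\<mu> \<in> C" "q \<ge> 1" for \<mu> q
    using that unfolding CB(2)[symmetric] B_def by blast
  have CO: "C \<subseteq> pseudo_physical \<Psi> f"
    using shrinked_periodic_limit_pseudo_physical[OF f] Bl by blast
  have CS: "C \<subseteq> weak_star closure_of infinitely_shrinked f"
    using shrinked_periodic_limit_infinitely_shrinked[OF f _ E] Bl by blast
  have SC: "weak_star closure_of infinitely_shrinked f \<subseteq> C"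
    unfolding C_def by (intro closure_of_minimal infinitely_shrinked_subset_closure[OF f]) auto
  have S: "weak_star closure_of infinitely_shrinked f = C" using CS SC by blast
  have O: "pseudo_physical \<Psi> f = C"
    using CO pseudo_physical_subset_closure[OF f E] S by blast
  have CA: "C \<subseteq> A \<epsilon> q" if "\<epsilon> > 0" "q \<ge> 1" for \<epsilon> q
  proof -
    have "shrinked_periodic q f \<subseteq> almost_shrinked_periodic \<Psi> \<epsilon> q f"
    proof
      fix \<nu> assume \<nu>: "\<nu> \<in> shrinked_periodic q f"
      then have "\<nu> \<in> invariant_measures f" using sp by blast
      then show "\<nu> \<in> almost_shrinked_periodic \<Psi> \<epsilon> q f"
        unfolding almost_shrinked_periodic_def using \<nu> that(1) by (auto intro: bexI[of _ \<nu>])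
    qed
    from closure_of_mono[OF this, of weak_star] show ?thesis using Bl that(2) unfolding A_def by blast
  qed
  have AC: "(\<Inter>\<epsilon>\<in>{0<..}. \<Inter>q\<in>{1..}. A \<epsilon> q) \<subseteq> C"
  proof
    fix \<mu> assume "\<mu> \<in> (\<Inter>\<epsilon>\<in>{0<..}. \<Inter>q\<in>{1..}. A \<epsilon> q)"
    then have \<mu>: "\<mu> \<in> A \<epsilon> 1" if "\<epsilon> > 0" for \<epsilon> using that by auto
    then have u: "\<mu> \<in> unit_probs" using \<mu>[of 1] by (simp add: A_def in_weak_star_closure)
    show "\<mu> \<in> C"
      unfolding C_def in_weak_star_closure
    proof (intro conjI allI impI u)
      fix e :: real assume e: "e > 0"
      then have e2: "e / 2 > 0" by simp
      obtain \<rho> where \<rho>: "\<rho> \<in> almost_shrinked_periodic \<Psi> (e / 2) 1 f" "\<rho> \<in> unit_probs" "meas_dist \<Psi> \<rho> \<mu> < e / 2"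
        using \<mu>[OF e2] e2 unfolding A_def in_weak_star_closure by blast
      then obtain \<nu> where \<nu>: "\<nu> \<in> shrinked_periodic 1 f" "meas_dist \<Psi> \<rho> \<nu> < e / 2"
        by (auto simp: almost_shrinked_periodic_def)
      have \<nu>u: "\<nu> \<in> unit_probs" using \<nu>(1) sp invariant_measures_unit_probs by blast
      have "meas_dist \<Psi> \<nu> \<mu> < e"
        using meas_dist_triangle[OF \<nu>u \<rho>(2) u] \<rho>(3) \<nu>(2) meas_dist_commute[of \<rho> \<nu>] by simp
      then show "\<exists>\<nu>\<in>periodic_measures f \<inter> unit_probs. meas_dist \<Psi> \<nu> \<mu> < e" using \<nu>(1) \<nu>u sp(1) by blast
    qed
  qed
  have AA: "(\<Inter>\<epsilon>\<in>{0<..}. \<Inter>q\<in>{1..}. A \<epsilon> q) = C"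
  proof
    show "C \<subseteq> (\<Inter>\<epsilon>\<in>{0<..}. \<Inter>q\<in>{1..}. A \<epsilon> q)"
      by (intro INT_greatest CA) auto
  qed (rule AC)
  have PC: "periodic_measures f \<subseteq> C"
    unfolding C_def using sp(2) invariant_measures_unit_probs
    by (intro closure_of_subset) (auto simp: topspace_weak_star)
  have EC: "ergodic_measures f \<subseteq> C"
    unfolding CB(1)[symmetric] using invariant_measures_unit_probs
    by (intro closure_of_subset) (auto simp: topspace_weak_star ergodic_measures_def)
  show ?thesis
  proof (intro conjI allI impI ballI)
    fix \<epsilon> :: real assume "\<epsilon> > 0"
    then show "periodic_measures f \<subseteq> (\<Inter>q\<in>{1..}. weak_star closure_of almost_shrinked_periodic \<Psi> \<epsilon> q f)"
      unfolding A_def[symmetric] by (intro INT_greatest subset_trans[OF PC CA]) auto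
  next
    fix \<mu> assume "\<mu> \<in> ergodic_measures f"
    then show "\<mu> \<in> pseudo_physical \<Psi> f" using EC unfolding O by blast
  qed (use AA in \<open>simp_all only: O S CB(1) A_def C_def[symmetric]\<close>)
qed

end

section \<open>Generic points of ergodic measures\<close>

text \<open>Garsia's argument for the maximal ergodic theorem: if the Birkhoff sums of a function with
  negative mean were unbounded above on a set of positive measure, they would be so almost
  everywhere, the set of such points being invariant. The running maxima \<open>M n\<close> of the sums satisfy
  \<open>M (n + 1) - M n \<circ> f = max (- M n \<circ> f) g\<close>, which tends to \<open>g\<close> where the sums are unbounded, while
  its integral is nonnegative by invariance.\<close>

lemma ergodic_birkhoff_sums_bounded_above:
  fixes g :: "real \<Rightarrow> real"
  assumes f: "f \<in> mspace self_maps" and \<mu>: "\<mu> \<in> ergodic_measures f"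
    and g: "continuous_on {0..1} g" and neg: "integral\<^sup>L \<mu> g < 0"
  shows "AE x in \<mu>. \<exists>B::nat. \<forall>n. (\<Sum>j<n. g ((f ^^ j) x)) \<le> B"
proof -
  have inv: "\<mu> \<in> invariant_measures f" using \<mu> by (simp add: ergodic_measures_def)
  note u = invariant_measures_unit_probs[OF inv]
  interpret prob_space \<mu> using u by (rule unit_probsD)
  note sp = unit_probsD(3)[OF u] and se = unit_probsD(2)[OF u]
  have fin: "f x \<in> {0..1}" if "x \<in> {0..1}" for x using self_mapsD(2)[OF f that] .
  obtain G0 where G0: "\<And>x. x \<in> {0..1} \<Longrightarrow> \<bar>g x\<bar> \<le> G0" using continuous_bounded_unit[OF g] by metis
  define G where "G = nat \<lceil>G0\<rceil>"
  have G: "\<bar>g x\<bar> \<le> real G" if "x \<in> {0..1}" for x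
    using G0[OF that] unfolding G_def by linarith
  define S where "S n x = (\<Sum>j<n. g ((f ^^ j) x))" for n x
  have S_cont: "continuous_on {0..1} (S n)" for n
    unfolding S_def by (intro continuous_intros continuous_comp_iterate[OF f g])
  have S_Suc: "S (Suc n) x = g x + S n (f x)" for n x
    unfolding S_def by (subst sum.lessThan_Suc_shift) (simp add: funpow_swap1)
  define A where "A = {x \<in> space unit_borel. \<forall>B::nat. \<exists>n. S n x > real B}"
  have [measurable]: "S n \<in> borel_measurable unit_borel" for n
    by (rule continuous_measurable_unit[OF S_cont])
  have A: "A \<in> sets unit_borel" unfolding A_def by measurable
  have A_inv: "f x \<in> A \<longleftrightarrow> x \<in> A" if x: "x \<in> {0..1}" for x
  proof
    assume a: "f x \<in> A"
    have "\<exists>n. S n x > real B" for B :: nat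
    proof -
      obtain n where "S n (f x) > real (B + G)" using a unfolding A_def by blast
      then have "S (Suc n) x > real B" using G[OF x] by (simp add: S_Suc)
      then show ?thesis by blast
    qed
    then show "x \<in> A" using x by (simp add: A_def)
  next
    assume a: "x \<in> A"
    have "\<exists>n. S n (f x) > real B" for B :: nat
    proof -
      obtain n where n: "S n x > real (B + G)" using a unfolding A_def by blast
      then have "n \<noteq> 0" by (intro notI) (simp add: S_def)
      then obtain m where "n = Suc m" by (cases n) auto
      then have "S m (f x) > real B" using G[OF x] n by (simp add: S_Suc)
      then show ?thesis by blast
    qed
    then show "f x \<in> A" using fin[OF x] by (simp add: A_def)
  qed
  have "A \<subseteq> {0..1}" by (auto simp: A_def)
  then have "f -` A \<inter> {0..1} = A" using A_inv by blast
  then have "measure \<mu> A = 0 \<or> measure \<mu> A = 1" using \<mu> A by (simp add: ergodic_measures_def)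
  moreover have "measure \<mu> A \<noteq> 1"
  proof
    assume full: "measure \<mu> A = 1"
    \<comment> \<open>The value \<open>M n x\<close> is the maximum of \<open>S 0 x, \<dots>, S n x\<close>.\<close>
    define M where "M = rec_nat (\<lambda>x. 0) (\<lambda>n m x. max 0 (g x + m (f x)))"
    have M0: "M 0 x = 0" and MS: "M (Suc n) x = max 0 (g x + M n (f x))" for n x
      by (simp_all add: M_def)
    have M_cont: "continuous_on {0..1} (M n)" for n
    proof (induction n)
      case (Suc n)
      have "continuous_on {0..1} (\<lambda>x. M n (f x))" using continuous_comp_iterate[OF f Suc, of 1] by simp
      then have "continuous_on {0..1} (\<lambda>x. max 0 (g x + M n (f x)))" by (intro continuous_intros g)
      then show ?case by (rule continuous_on_eq) (simp add: MS)
    qed (simp add: M_def)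
    have M_nonneg: "M n x \<ge> 0" for n x by (cases n) (simp_all add: M0 MS)
    have M_mono: "M n x \<le> M (Suc n) x" for n x
    proof (induction n arbitrary: x)
      case (Suc n)
      show ?case using Suc[of "f x"] by (subst (1 2) MS) (auto simp: max_def)
    qed (simp add: M0 M_nonneg)
    have M_ge: "S k x \<le> M n x" if "k \<le> n" for k n x
      using that
    proof (induction n arbitrary: k x)
      case 0
      then show ?case by (simp add: S_def M0)
    next
      case (Suc n)
      show ?case
      proof (cases k)
        case 0
        then show ?thesis using M_nonneg by (simp add: S_def)
      next
        case (Suc m)
        then show ?thesis using Suc.IH[of m "f x"] Suc.prems by (simp add: S_Suc MS)
      qed
    qed
    define D where "D n x = M (Suc n) x - M n (f x)" for n x
    have D_cont: "continuous_on {0..1} (D n)" for n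
      unfolding D_def using continuous_comp_iterate[OF f M_cont, of n 1] by (intro continuous_intros M_cont) simp
    have D_bound: "\<bar>D n x\<bar> \<le> real G" if "x \<in> {0..1}" for n x
      using G[OF that] M_nonneg[of n "f x"] by (auto simp: D_def MS)
    have D_int: "integral\<^sup>L \<mu> (D n) \<ge> 0" for n
    proof -
      have c: "continuous_on {0..1} (\<lambda>x. M n (f x))" using continuous_comp_iterate[OF f M_cont, of n 1] by simp
      have "integral\<^sup>L \<mu> (\<lambda>x. M n (f x)) = integral\<^sup>L \<mu> (M n)"
        using inv M_cont unfolding invariant_measures_iff_integral[OF f] by blast
      then have "integral\<^sup>L \<mu> (D n) = integral\<^sup>L \<mu> (M (Suc n)) - integral\<^sup>L \<mu> (M n)"
        unfolding D_def using integrable_unit[OF u M_cont] integrable_unit[OF u c] by simp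
      moreover have "integral\<^sup>L \<mu> (M n) \<le> integral\<^sup>L \<mu> (M (Suc n))"
        by (intro integral_mono integrable_unit[OF u M_cont] M_mono)
      ultimately show ?thesis by simp
    qed
    have D_lim: "(\<lambda>n. D n x) \<longlonglongrightarrow> g x" if x: "x \<in> A" for x
    proof -
      have x01: "x \<in> {0..1}" using x by (simp add: A_def)
      then have "f x \<in> A" using A_inv x by blast
      then obtain k where k: "S k (f x) > real G" unfolding A_def by blast
      have "D n x = g x" if "n \<ge> k" for n
        using M_ge[OF that, of "f x"] k G[OF x01] by (auto simp: D_def MS)
      then have "\<forall>\<^sub>F n in sequentially. D n x = g x" by (auto simp: eventually_sequentially)
      then show ?thesis by (rule tendsto_eventually)
    qed
    have "AE x in \<mu>. x \<in> A" using full A se by (subst (asm) prob_eq_1) auto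
    then have "AE x in \<mu>. (\<lambda>n. D n x) \<longlonglongrightarrow> g x" by eventually_elim (rule D_lim)
    then have "(\<lambda>n. integral\<^sup>L \<mu> (D n)) \<longlonglongrightarrow> integral\<^sup>L \<mu> g"
      using D_bound integrable_unit[OF u g] integrable_unit[OF u D_cont]
      by (intro integral_dominated_convergence[where w="\<lambda>_. real G"]) (auto simp: sp intro!: AE_I2)
    then have "integral\<^sup>L \<mu> g \<ge> 0" using D_int by (intro tendsto_lowerbound) auto
    with neg show False by simp
  qed
  ultimately have "measure \<mu> A = 0" by blast
  then have "AE x in \<mu>. x \<notin> A" using A se by (subst (asm) prob_eq_0) auto
  then show ?thesis
  proof (rule AE_mp, intro AE_I2 impI)
    fix x assume "x \<in> space \<mu>" "x \<notin> A"
    then show "\<exists>B::nat. \<forall>n. (\<Sum>j<n. g ((f ^^ j) x)) \<le> B"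
      unfolding A_def S_def sp by (auto simp: not_less)
  qed
qed

lemma ergodic_averages_eventually_less:
  fixes \<phi> :: "real \<Rightarrow> real"
  assumes f: "f \<in> mspace self_maps" and \<mu>: "\<mu> \<in> ergodic_measures f"
    and \<phi>: "continuous_on {0..1} \<phi>"
  shows "AE x in \<mu>. \<forall>m. \<forall>\<^sub>F n in sequentially. (\<Sum>j<n. \<phi> ((f ^^ j) x)) / n < integral\<^sup>L \<mu> \<phi> + 1 / Suc m"
  unfolding AE_all_countable
proof
  fix m :: nat
  define c where "c = integral\<^sup>L \<mu> \<phi> + 1 / (2 * Suc m)"
  have inv: "\<mu> \<in> invariant_measures f" using \<mu> by (simp add: ergodic_measures_def)
  note u = invariant_measures_unit_probs[OF inv]
  interpret prob_space \<mu> using u by (rule unit_probsD)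
  have "integral\<^sup>L \<mu> (\<lambda>x. \<phi> x - c) = integral\<^sup>L \<mu> \<phi> - c"
    using integrable_unit[OF u \<phi>] by (simp add: prob_space)
  also have "\<dots> < 0" by (simp add: c_def)
  finally have "AE x in \<mu>. \<exists>B::nat. \<forall>n. (\<Sum>j<n. \<phi> ((f ^^ j) x) - c) \<le> B"
    using \<phi> by (intro ergodic_birkhoff_sums_bounded_above[OF f \<mu>] continuous_intros)
  then show "AE x in \<mu>. \<forall>\<^sub>F n in sequentially. (\<Sum>j<n. \<phi> ((f ^^ j) x)) / n < integral\<^sup>L \<mu> \<phi> + 1 / Suc m"
  proof eventually_elim
    case (elim x)
    then obtain B :: nat where B: "\<And>n. (\<Sum>j<n. \<phi> ((f ^^ j) x) - c) \<le> B" by blast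
    have "(\<lambda>n. real B / real n) \<longlonglongrightarrow> 0" by (rule lim_const_over_n)
    then have "\<forall>\<^sub>F n in sequentially. real B / real n < 1 / (2 * Suc m)"
      by (rule order_tendstoD(2)) simp
    then show ?case using eventually_gt_at_top[of 0]
    proof eventually_elim
      case (elim n)
      have "(\<Sum>j<n. \<phi> ((f ^^ j) x)) - n * c \<le> B" using B[of n] by (simp add: sum_subtractf)
      then have "((\<Sum>j<n. \<phi> ((f ^^ j) x)) - n * c) / n \<le> B / n" by (rule divide_right_mono) simp
      then have "(\<Sum>j<n. \<phi> ((f ^^ j) x)) / n \<le> c + B / n" using elim(2) by (simp add: diff_divide_distrib)
      also have "\<dots> < c + 1 / (2 * Suc m)" using elim(1) by simp
      also have "\<dots> = integral\<^sup>L \<mu> \<phi> + 1 / Suc m" by (simp add: c_def field_simps)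
      finally show ?case .
    qed
  qed
qed

lemma ergodic_averages_converge:
  fixes \<phi> :: "real \<Rightarrow> real"
  assumes f: "f \<in> mspace self_maps" and \<mu>: "\<mu> \<in> ergodic_measures f"
    and \<phi>: "continuous_on {0..1} \<phi>"
  shows "AE x in \<mu>. (\<lambda>n. (\<Sum>j<n. \<phi> ((f ^^ j) x)) / n) \<longlonglongrightarrow> integral\<^sup>L \<mu> \<phi>"
proof -
  have n\<phi>: "continuous_on {0..1} (\<lambda>x. - \<phi> x)" using \<phi> by (intro continuous_intros)
  show ?thesis
    using ergodic_averages_eventually_less[OF f \<mu> \<phi>] ergodic_averages_eventually_less[OF f \<mu> n\<phi>]
  proof eventually_elim
    case (elim x)
    show ?case
    proof (rule tendstoI)
      fix e :: real assume "e > 0"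
      then obtain m where m: "1 / real (Suc m) < e" using reals_Archimedean[of e] by (auto simp: inverse_eq_divide)
      show "\<forall>\<^sub>F n in sequentially. dist ((\<Sum>j<n. \<phi> ((f ^^ j) x)) / n) (integral\<^sup>L \<mu> \<phi>) < e"
        using elim(1)[rule_format, of m] elim(2)[rule_format, of m]
      proof eventually_elim
        case (elim n)
        have "(\<Sum>j<n. - \<phi> ((f ^^ j) x)) / n = - ((\<Sum>j<n. \<phi> ((f ^^ j) x)) / n)" by (simp add: sum_negf)
        then show ?case using elim m unfolding dist_real_def by simp
      qed
    qed
  qed
qed

text \<open>Finitely many initial terms do not affect the limit, so a generic point may be replaced by any later
  point of its orbit.\<close>

lemma averages_shift:
  fixes a :: "nat \<Rightarrow> real"
  assumes "(\<lambda>n. (\<Sum>j<n. a j) / n) \<longlonglongrightarrow> L"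
  shows "(\<lambda>n. (\<Sum>j<n. a (i + j)) / n) \<longlonglongrightarrow> L"
proof -
  define c where "c = (\<Sum>j<i. a j)"
  have 1: "(\<lambda>n. (\<Sum>j<n + i. a j) / real (n + i)) \<longlonglongrightarrow> L" by (rule LIMSEQ_ignore_initial_segment[OF assms])
  have 2: "(\<lambda>n. 1 + real i / real n) \<longlonglongrightarrow> 1 + 0" by (intro tendsto_intros lim_const_over_n)
  have "(\<lambda>n. (\<Sum>j<n + i. a j) / real (n + i) * (1 + real i / real n) - c / real n) \<longlonglongrightarrow> L * (1 + 0) - 0"
    by (intro tendsto_intros 1 2 lim_const_over_n)
  moreover have "\<forall>\<^sub>F n in sequentially. (\<Sum>j<n + i. a j) / real (n + i) * (1 + real i / real n) - c / real n =
      (\<Sum>j<n. a (i + j)) / n"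
    using eventually_gt_at_top[of 0]
  proof eventually_elim
    case (elim n)
    have "(\<Sum>j<n + i. a j) = c + (\<Sum>j<n. a (i + j))" for n
      by (induction n) (simp_all add: c_def add.commute)
    moreover have "(1 + real i / real n) = real (n + i) / n" using elim by (simp add: field_simps)
    ultimately show ?case using elim by (simp add: diff_divide_distrib[symmetric] del: of_nat_add)
  qed
  ultimately show ?thesis by (simp add: Lim_transform_eventually)
qed

text \<open>A generic point returns close to one of its earlier positions after arbitrarily long times,
  and the averages over the time in between are those of the measure.\<close>

lemma (in dense_self_maps) ergodic_closed_pseudo_orbit:
  assumes f: "f \<in> mspace self_maps" and \<mu>: "\<mu> \<in> ergodic_measures f"
    and e: "e > 0" and h: "h > 0"
  obtains p z where "p \<ge> 1" "\<And>l. l < p \<Longrightarrow> z l \<in> {0..1}"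
    "\<And>l. l < p \<Longrightarrow> \<bar>f (z l) - z (Suc l mod p)\<bar> < h"
    "\<And>i. i < N \<Longrightarrow> \<bar>(\<Sum>l<p. \<Psi> i (z l)) / p - integral\<^sup>L \<mu> (\<Psi> i)\<bar> < e"
proof -
  have inv: "\<mu> \<in> invariant_measures f" using \<mu> by (simp add: ergodic_measures_def)
  note u = invariant_measures_unit_probs[OF inv]
  interpret prob_space \<mu> using u by (rule unit_probsD)
  have "AE x in \<mu>. \<forall>i. (\<lambda>n. (\<Sum>j<n. \<Psi> i ((f ^^ j) x)) / n) \<longlonglongrightarrow> integral\<^sup>L \<mu> (\<Psi> i)"
    unfolding AE_all_countable by (intro allI ergodic_averages_converge[OF f \<mu> Psi_cont])
  then have "\<exists>x\<in>space \<mu>. \<forall>i. (\<lambda>n. (\<Sum>j<n. \<Psi> i ((f ^^ j) x)) / n) \<longlonglongrightarrow> integral\<^sup>L \<mu> (\<Psi> i)"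
    (is "\<exists>x\<in>space \<mu>. ?P x")
  proof (rule contrapos_pp)
    assume "\<not> (\<exists>x\<in>space \<mu>. ?P x)"
    then have no: "AE x in \<mu>. \<not> ?P x" by (intro AE_I2) blast
    show "\<not> (AE x in \<mu>. ?P x)"
    proof
      assume "AE x in \<mu>. ?P x"
      with no have "AE x in \<mu>. False" by eventually_elim blast
      then show False by simp
    qed
  qed
  then obtain x where x: "x \<in> space \<mu>"
    and gen: "\<And>i. (\<lambda>n. (\<Sum>j<n. \<Psi> i ((f ^^ j) x)) / n) \<longlonglongrightarrow> integral\<^sup>L \<mu> (\<Psi> i)"
    by blast
  have x01: "x \<in> {0..1}" using x unit_probsD(3)[OF u] by simp
  have orb: "(f ^^ n) x \<in> {0..1}" for n by (rule iterate_self_map(1)[OF f x01])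
  obtain y r where r: "strict_mono (r :: nat \<Rightarrow> nat)" and y: "((\<lambda>n. (f ^^ n) x) \<circ> r) \<longlonglongrightarrow> y"
    using orb compact_Icc[of "0::real" 1] unfolding compact_def by metis
  then have "\<forall>\<^sub>F k in sequentially. dist ((f ^^ r k) x) y < h / 2"
    using h tendstoD[OF y, of "h / 2"] by (simp add: comp_def)
  then obtain k0 where k0: "\<And>k. k \<ge> k0 \<Longrightarrow> \<bar>(f ^^ r k) x - y\<bar> < h / 2"
    by (auto simp: eventually_sequentially dist_real_def)
  \<comment> \<open>Of all the close returns, one is fixed as the start and a much later one as the end.\<close>
  define i where "i = r k0"
  have "\<forall>\<^sub>F n in sequentially. \<forall>m\<in>{..<N}. \<bar>(\<Sum>l<n. \<Psi> m ((f ^^ (i + l)) x)) / n - integral\<^sup>L \<mu> (\<Psi> m)\<bar> < e"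
  proof (intro eventually_ball_finite ballI)
    fix m
    show "\<forall>\<^sub>F n in sequentially. \<bar>(\<Sum>l<n. \<Psi> m ((f ^^ (i + l)) x)) / n - integral\<^sup>L \<mu> (\<Psi> m)\<bar> < e"
      using tendstoD[OF averages_shift[OF gen, of m i] e] by (simp add: dist_real_def)
  qed simp
  then obtain n0 where n0: "\<And>n m. \<lbrakk>n \<ge> n0; m < N\<rbrakk> \<Longrightarrow>
      \<bar>(\<Sum>l<n. \<Psi> m ((f ^^ (i + l)) x)) / n - integral\<^sup>L \<mu> (\<Psi> m)\<bar> < e"
    by (auto simp: eventually_sequentially)
  define k where "k = max (Suc k0) (i + n0)"
  define p where "p = r k - i"
  have "r k0 < r k" using r by (simp add: strict_mono_def k_def)
  moreover have "k \<le> r k" by (rule strict_mono_imp_increasing[OF r])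
  ultimately have p: "p \<ge> 1" "p \<ge> n0" "i + p = r k" by (auto simp: p_def i_def k_def)
  have close: "\<bar>(f ^^ (i + p)) x - (f ^^ i) x\<bar> < h"
  proof -
    have "k \<ge> k0" by (simp add: k_def)
    then show ?thesis using k0[of k] k0[of k0] unfolding p(3) unfolding i_def by linarith
  qed
  show thesis
  proof (rule that[of p "\<lambda>l. (f ^^ (i + l)) x"])
    fix l assume l: "l < p"
    have s: "f ((f ^^ (i + l)) x) = (f ^^ (i + Suc l)) x" by simp
    show "\<bar>f ((f ^^ (i + l)) x) - (f ^^ (i + Suc l mod p)) x\<bar> < h"
    proof (cases "Suc l = p")
      case True
      then show ?thesis unfolding s using close by simp
    next
      case False
      then have "Suc l mod p = Suc l" using l by simp
      then show ?thesis unfolding s using h by simp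
    qed
  qed (use p orb n0 in auto)
qed

section \<open>Plateau maps\<close>

text \<open>Near \<open>y \<in> Y\<close> the map \<open>f\<close> is replaced by a convex combination of \<open>f\<close> and the constant \<open>\<sigma> y\<close>, with a
  bump function of \<open>x - y\<close> as weight. The bumps have disjoint supports, and convexity keeps the values
  in the interval and the change at most \<open>h\<close>.\<close>

lemma plateau_map:
  fixes \<sigma> :: "real \<Rightarrow> real"
  assumes f: "f \<in> mspace self_maps" and Y: "finite Y" and r: "r < R"
    and sep: "\<And>y y'. \<lbrakk>y \<in> Y; y' \<in> Y; y \<noteq> y'\<rbrakk> \<Longrightarrow> 2 * R \<le> \<bar>y - y'\<bar>"
    and \<sigma>: "\<And>y. y \<in> Y \<Longrightarrow> \<sigma> y \<in> {0..1}"
    and near: "\<And>x y. \<lbrakk>y \<in> Y; x \<in> {0..1}; \<bar>x - y\<bar> < R\<rbrakk> \<Longrightarrow> \<bar>f x - \<sigma> y\<bar> \<le> h" and h: "h \<ge> 0"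
  obtains g where "g \<in> mspace self_maps" "mdist self_maps f g \<le> h"
    "\<And>x y. \<lbrakk>y \<in> Y; x \<in> {0..1}; \<bar>x - y\<bar> \<le> r\<rbrakk> \<Longrightarrow> g x = \<sigma> y"
proof -
  define \<theta> where "\<theta> t = max 0 (min 1 ((R - \<bar>t\<bar>) / (R - r)))" for t :: real
  have \<theta>01: "\<theta> t \<in> {0..1}" for t by (auto simp: \<theta>_def)
  have \<theta>0: "\<theta> t = 0" if "\<bar>t\<bar> \<ge> R" for t
  proof -
    have "(R - \<bar>t\<bar>) / (R - r) \<le> 0" using that r by (simp add: divide_nonpos_pos)
    then show ?thesis by (simp add: \<theta>_def)
  qed
  have \<theta>1: "\<theta> t = 1" if "\<bar>t\<bar> \<le> r" for t
  proof -
    have "(R - \<bar>t\<bar>) / (R - r) \<ge> 1" using that r by (simp add: field_simps)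
    then show ?thesis by (simp add: \<theta>_def)
  qed
  define g0 where "g0 x = f x + (\<Sum>y\<in>Y. \<theta> (x - y) * (\<sigma> y - f x))" for x
  have near_g0: "g0 x = f x + \<theta> (x - y) * (\<sigma> y - f x)" if y: "y \<in> Y" "\<bar>x - y\<bar> < R" for x y
  proof -
    have "\<theta> (x - y') = 0" if "y' \<in> Y - {y}" for y'
      using sep[of y y'] y that by (intro \<theta>0) auto
    then have "(\<Sum>y'\<in>Y. \<theta> (x - y') * (\<sigma> y' - f x)) = (\<Sum>y'\<in>{y}. \<theta> (x - y') * (\<sigma> y' - f x))"
      using Y y by (intro sum.mono_neutral_right) auto
    then show ?thesis by (simp add: g0_def)
  qed
  have far_g0: "g0 x = f x" if "\<And>y. y \<in> Y \<Longrightarrow> \<not> \<bar>x - y\<bar> < R" for x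
    using that \<theta>0 unfolding g0_def by (simp add: not_less)
  have both: "g0 x \<in> {0..1} \<and> \<bar>f x - g0 x\<bar> \<le> h" if x: "x \<in> {0..1}" for x
  proof (cases "\<exists>y\<in>Y. \<bar>x - y\<bar> < R")
    case False
    then show ?thesis using far_g0[of x] self_mapsD(2)[OF f x] h by auto
  next
    case True
    then obtain y where y: "y \<in> Y" "\<bar>x - y\<bar> < R" by blast
    define t where "t = \<theta> (x - y)"
    have t: "0 \<le> t" "t \<le> 1" using \<theta>01[of "x - y"] by (auto simp: t_def)
    have "g0 x = (1 - t) * f x + t * \<sigma> y" using near_g0[OF y] by (simp add: t_def algebra_simps)
    moreover have "(1 - t) * f x + t * \<sigma> y \<in> {0..1}"
      using convexD_alt[OF convex_real_interval(5)[of 0 1] self_mapsD(2)[OF f x] \<sigma>[OF y(1)] t] by simp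
    moreover have "\<bar>f x - g0 x\<bar> = t * \<bar>f x - \<sigma> y\<bar>"
      using near_g0[OF y] t by (simp add: t_def[symmetric] abs_mult abs_minus_commute)
    moreover have "t * \<bar>f x - \<sigma> y\<bar> \<le> 1 * \<bar>f x - \<sigma> y\<bar>" using t by (intro mult_right_mono) auto
    ultimately show ?thesis using near[OF y(1) x y(2)] by simp
  qed
  have "continuous_on {0..1} g0"
    unfolding g0_def \<theta>_def using r by (intro continuous_intros self_mapsD(1)[OF f]) auto
  then have g: "restrict g0 {0..1} \<in> mspace self_maps" using both by (intro restrict_self_maps) auto
  show thesis
  proof (rule that[OF g])
    show "mdist self_maps f (restrict g0 {0..1}) \<le> h"
      unfolding mdist_self_maps_le[OF f g] using both by auto
    show "restrict g0 {0..1} x = \<sigma> y" if "y \<in> Y" "x \<in> {0..1}" "\<bar>x - y\<bar> \<le> r" for x y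
      using near_g0[of y x] \<theta>1[of "x - y"] that r by simp
  qed
qed

text \<open>The interval of radius \<open>r\<close> about \<open>y \<in> Y\<close> is mapped into the smaller interval of radius \<open>d\<close>
  about \<open>\<sigma> y\<close>. A map that is constant with value \<open>\<sigma> y\<close> on the interval about \<open>y\<close> has this property,
  and so have all maps at distance at most \<open>d\<close> from it. The combinatorics of \<open>\<sigma>\<close> on the finite set
  \<open>Y\<close> then determine the dynamics on the union of these intervals.\<close>

locale plateaus =
  fixes g :: "real \<Rightarrow> real" and Y :: "real set" and \<sigma> :: "real \<Rightarrow> real" and r d :: real
  assumes g: "g \<in> mspace self_maps" and finite_Y: "finite Y"
    and d: "0 < d" "d < r"
    and sep: "\<And>y y'. \<lbrakk>y \<in> Y; y' \<in> Y; y \<noteq> y'\<rbrakk> \<Longrightarrow> 2 * r < \<bar>y - y'\<bar>"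
    and in01: "\<And>y. y \<in> Y \<Longrightarrow> cball y r \<subseteq> {0..1}"
    and \<sigma>: "\<And>y. y \<in> Y \<Longrightarrow> \<sigma> y \<in> Y"
    and near: "\<And>x y. \<lbrakk>y \<in> Y; \<bar>x - y\<bar> \<le> r\<rbrakk> \<Longrightarrow> \<bar>g x - \<sigma> y\<bar> \<le> d"
begin

lemma orbit_in_Y: "y \<in> Y \<Longrightarrow> (\<sigma> ^^ n) y \<in> Y"
  by (induction n) (auto intro: \<sigma>)

lemma iterate_near:
  assumes y: "y \<in> Y" "\<bar>x - y\<bar> \<le> r" and n: "n \<ge> 1"
  shows "\<bar>(g ^^ n) x - (\<sigma> ^^ n) y\<bar> \<le> d"
  using n
proof (induction n rule: dec_induct)
  case base
  then show ?case using near[OF y] by simp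
next
  case (step n)
  have "\<bar>g ((g ^^ n) x) - \<sigma> ((\<sigma> ^^ n) y)\<bar> \<le> d" using step d by (intro near orbit_in_Y y) auto
  then show ?case by simp
qed

lemma iterate_near':
  assumes y: "y \<in> Y" "\<bar>x - y\<bar> \<le> r"
  shows "\<bar>(g ^^ n) x - (\<sigma> ^^ n) y\<bar> \<le> r"
  using iterate_near[OF y, of n] y d by (cases "n = 0") auto

text \<open>After at least one step the images have radius at most \<open>d\<close>, so they are shorter than the interval
  and the last of them falls strictly inside it.\<close>

lemma shrinking_interval_ball:
  assumes y: "y \<in> Y" and p: "p \<ge> 1" "(\<sigma> ^^ p) y = y" "inj_on (\<lambda>j. (\<sigma> ^^ j) y) {..<p}"
  shows "shrinking_interval g p (ball y r)" "measure lebesgue (ball y r) = 2 * r"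
proof -
  have cl: "closure (ball y r) = cball y r" using d by simp
  have mem: "x \<in> cball w s \<longleftrightarrow> \<bar>x - w\<bar> \<le> s" for x w s :: real by (simp add: dist_real_def abs_minus_commute)
  have ball_Icc: "ball y r = {y - r<..<y + r}" by (auto simp: dist_real_def)
  show len: "measure lebesgue (ball y r) = 2 * r" using d unfolding ball_Icc by simp
  have small: "(g ^^ j) ` cball y r \<subseteq> cball ((\<sigma> ^^ j) y) d" if "j \<ge> 1" for j
    using iterate_near[OF y _ that] by (auto simp: mem simp del: mem_cball)
  have inc: "(g ^^ j) ` cball y r \<subseteq> cball ((\<sigma> ^^ j) y) r" for j
    using iterate_near'[OF y] by (auto simp: mem simp del: mem_cball)
  show "shrinking_interval g p (ball y r)"
    unfolding shrinking_interval_def cl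
  proof (intro conjI ballI p(1) open_ball)
    show "ball y r \<noteq> {}" using d by simp
    show "is_interval (ball y r)" by (simp add: is_interval_ball_real)
    show "ball y r \<subseteq> {0..1}" using in01[OF y] ball_subset_cball by blast
    show "disjoint_family_on (\<lambda>j. (g ^^ j) ` cball y r) {0..p - 1}"
      unfolding disjoint_family_on_def
    proof (intro ballI impI)
      fix i j assume ij: "i \<in> {0..p - 1}" "j \<in> {0..p - 1}" "i \<noteq> j"
      then have "i < p" "j < p" using p(1) by auto
      then have "(\<sigma> ^^ i) y \<noteq> (\<sigma> ^^ j) y" using inj_onD[OF p(3), of i j] ij(3) by auto
      then have "2 * r < \<bar>(\<sigma> ^^ i) y - (\<sigma> ^^ j) y\<bar>" using sep orbit_in_Y[OF y] by blast
      then have "cball ((\<sigma> ^^ i) y) r \<inter> cball ((\<sigma> ^^ j) y) r = {}" by (auto simp: dist_real_def)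
      then show "(g ^^ i) ` cball y r \<inter> (g ^^ j) ` cball y r = {}" using inc by blast
    qed
    show "(g ^^ p) ` cball y r \<subseteq> ball y r"
      using small[OF p(1)] d(2) unfolding p(2) by (auto simp: dist_real_def)
    fix j assume "j \<in> {1..p - 1}"
    then have j: "(g ^^ j) ` ball y r \<subseteq> cball ((\<sigma> ^^ j) y) d" using small[of j] ball_subset_cball[of y r] by fastforce
    have "measure lebesgue ((g ^^ j) ` ball y r) \<le> 2 * d"
    proof (cases "(g ^^ j) ` ball y r \<in> sets lebesgue")
      case True
      have "measure lebesgue ((g ^^ j) ` ball y r) \<le> measure lebesgue (cball ((\<sigma> ^^ j) y) d)"
        using j True by (intro measure_mono_fmeasurable) auto
      also have "cball ((\<sigma> ^^ j) y) d = {(\<sigma> ^^ j) y - d..(\<sigma> ^^ j) y + d}" by (auto simp: dist_real_def)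
      finally show ?thesis using d by simp
    qed (use d in \<open>simp add: measure_notin_sets\<close>)
    then show "measure lebesgue ((g ^^ j) ` ball y r) < measure lebesgue (ball y r)" using d len by simp
  qed
qed

text \<open>By the pigeonhole principle; the points of the cycle are distinct because \<open>p\<close> is the least period.\<close>

lemma eventually_periodic:
  assumes y: "y \<in> Y"
  obtains n p where "n \<ge> 1" "p \<ge> 1" "(\<sigma> ^^ p) ((\<sigma> ^^ n) y) = (\<sigma> ^^ n) y"
    "inj_on (\<lambda>j. (\<sigma> ^^ j) ((\<sigma> ^^ n) y)) {..<p}"
proof -
  have "\<not> inj_on (\<lambda>j. (\<sigma> ^^ j) y) {1..}"
    using finite_imageD[of "\<lambda>j. (\<sigma> ^^ j) y" "{1..}"] finite_subset[OF _ finite_Y] orbit_in_Y[OF y]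
    by (metis image_subsetI infinite_Ici)
  then obtain a b where ab: "a \<ge> 1" "a < b" "(\<sigma> ^^ a) y = (\<sigma> ^^ b) y"
    unfolding inj_on_def by (metis atLeast_iff linorder_neqE_nat)
  define w where "w = (\<sigma> ^^ a) y"
  have shift: "(\<sigma> ^^ (m + n)) x = (\<sigma> ^^ m) ((\<sigma> ^^ n) x)" for m n x by (simp add: funpow_add)
  have ex: "b - a \<ge> 1 \<and> (\<sigma> ^^ (b - a)) w = w"
    using ab shift[of "b - a" a y] by (simp add: w_def)
  define p where "p = (LEAST p. p \<ge> 1 \<and> (\<sigma> ^^ p) w = w)"
  have p: "p \<ge> 1" "(\<sigma> ^^ p) w = w" using LeastI[of "\<lambda>p. p \<ge> 1 \<and> (\<sigma> ^^ p) w = w", OF ex] by (auto simp: p_def)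
  have least: "p \<le> j" if "j \<ge> 1" "(\<sigma> ^^ j) w = w" for j
    unfolding p_def using that by (intro Least_le) simp
  have neq: "(\<sigma> ^^ i) w \<noteq> (\<sigma> ^^ j) w" if "i < j" "j < p" for i j
  proof
    assume eq: "(\<sigma> ^^ i) w = (\<sigma> ^^ j) w"
    have "(\<sigma> ^^ (p - j + i)) w = (\<sigma> ^^ (p - j)) ((\<sigma> ^^ j) w)" using eq shift by simp
    also have "\<dots> = w" using shift[of "p - j" j w] that p(2) by simp
    finally have "p \<le> p - j + i" using that by (intro least) auto
    then show False using that by linarith
  qed
  then have "inj_on (\<lambda>j. (\<sigma> ^^ j) w) {..<p}"
    by (intro inj_onI) (metis lessThan_iff linorder_neqE_nat)
  with ab(1) p show thesis using that[of a p] by (simp add: w_def)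
qed

lemma plateau_subset_entering:
  assumes y: "y \<in> Y" and q: "2 * r < 1 / real q"
  shows "cball y r \<subseteq> entering g q"
proof
  fix x assume x: "x \<in> cball y r"
  then have xy: "\<bar>x - y\<bar> \<le> r" by (simp add: dist_real_def abs_minus_commute)
  obtain n p where n: "n \<ge> 1" and p: "p \<ge> 1" "(\<sigma> ^^ p) ((\<sigma> ^^ n) y) = (\<sigma> ^^ n) y"
    "inj_on (\<lambda>j. (\<sigma> ^^ j) ((\<sigma> ^^ n) y)) {..<p}"
    using eventually_periodic[OF y] by metis
  have "(g ^^ n) x \<in> ball ((\<sigma> ^^ n) y) r"
    using iterate_near[OF y xy n] d by (simp add: dist_real_def abs_minus_commute)
  then show "x \<in> entering g q"
    unfolding entering_def using shrinking_interval_ball[OF orbit_in_Y[OF y] p] q x in01[OF y] by force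
qed

end

section \<open>Perturbations\<close>

lemma self_map_modulus:
  assumes f: "f \<in> mspace self_maps" and e: "e > 0"
  obtains d where "d > 0" "\<And>x y. \<lbrakk>x \<in> {0..1}; y \<in> {0..1}; \<bar>x - y\<bar> < d\<rbrakk> \<Longrightarrow> \<bar>f x - f y\<bar> < e"
proof -
  have "uniformly_continuous_on {0..1} f"
    by (rule compact_uniformly_continuous[OF self_mapsD(1)[OF f] compact_Icc])
  then obtain d where "d > 0" "\<And>x x'. x \<in> {0..1} \<Longrightarrow> x' \<in> {0..1} \<Longrightarrow> dist x' x < d \<Longrightarrow> dist (f x') (f x) < e"
    using e unfolding uniformly_continuous_on_def by metis
  then show thesis by (intro that[of d]) (auto simp: dist_real_def)
qed

text \<open>Cut the interval into \<open>N\<close> cells with centres \<open>c k\<close> and make the map constant on most of each cell,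
  with the centre closest to \<open>f (c k)\<close> as value.\<close>

lemma grid_perturbation:
  assumes f: "f \<in> mspace self_maps" and h: "h > 0" and q: "q \<ge> 1"
  obtains f1 d where "f1 \<in> mspace self_maps" "mdist self_maps f f1 \<le> h" "d > 0"
    "\<And>g. \<lbrakk>g \<in> mspace self_maps; mdist self_maps f1 g \<le> d\<rbrakk> \<Longrightarrow>
      \<exists>J\<in>sets borel. J \<subseteq> entering g q \<and> emeasure lborel ({0..1} - J) \<le> ennreal (1 / real q)"
proof -
  obtain d0 where d0: "d0 > 0" "\<And>x y. \<lbrakk>x \<in> {0..1}; y \<in> {0..1}; \<bar>x - y\<bar> < d0\<rbrakk> \<Longrightarrow> \<bar>f x - f y\<bar> < h / 2"
    using self_map_modulus[OF f, of "h / 2"] h by (metis half_gt_zero)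
  obtain N0 where N0: "1 / real (Suc N0) < min d0 h"
    using reals_Archimedean[of "min d0 h"] d0 h by (auto simp: inverse_eq_divide)
  define N where "N = max (Suc N0) q"
  have N: "N \<ge> 1" "N \<ge> q" "1 / real N < d0" "1 / real N < h"
  proof -
    have "1 / real N \<le> 1 / real (Suc N0)" by (simp add: N_def frac_le)
    then show "1 / real N < d0" "1 / real N < h" using N0 by auto
  qed (auto simp: N_def)
  define R where "R = 1 / (2 * real N)"
  \<comment> \<open>The parts of the cells outside the plateaus have total length \<open>1 / (2 q)\<close>.\<close>
  define r where "r = R * (1 - 1 / (2 * real q))"
  have R: "R > 0" using N by (simp add: R_def)
  have "1 / (2 * real q) \<le> 1 / 2" "1 / (2 * real q) > 0" using q by (auto simp: field_simps)
  then have r: "0 < r" "r < R" unfolding r_def using R by (auto simp: mult_less_cancel_left2)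
  define c where "c k = (2 * real k + 1) * R" for k
  have two: "2 * real N * R = 1" using N by (simp add: R_def)
  have c_diff: "c k - c l = 2 * R * (real k - real l)" for k l by (simp add: c_def algebra_simps)
  have c_sep: "2 * R \<le> \<bar>c k - c l\<bar>" if "k \<noteq> l" for k l
  proof -
    have "1 \<le> \<bar>real k - real l\<bar>" using that by linarith
    then have "2 * R * 1 \<le> 2 * R * \<bar>real k - real l\<bar>" using R by (intro mult_left_mono) auto
    then show ?thesis using R by (simp add: c_diff abs_mult)
  qed
  have c_in: "R \<le> c k" "c k \<le> 1 - R" if "k < N" for k
  proof -
    show "R \<le> c k" using R by (simp add: c_def field_simps)
    have "(2 * real k + 2) * R \<le> 2 * real N * R" using that R by (intro mult_right_mono) auto
    then show "c k \<le> 1 - R" unfolding two by (simp add: c_def algebra_simps)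
  qed
  have c_near: "\<exists>k<N. \<bar>t - c k\<bar> \<le> R" if t: "t \<in> {0..1}" for t
  proof -
    define k where "k = min (N - 1) (nat \<lfloor>t * N\<rfloor>)"
    have k: "k < N" using N by (auto simp: k_def)
    have "real k \<le> t * N \<and> t * N \<le> real k + 1"
    proof (cases "nat \<lfloor>t * N\<rfloor> \<le> N - 1")
      case True
      then have "k = nat \<lfloor>t * N\<rfloor>" by (simp add: k_def)
      then show ?thesis using t by (auto simp: le_nat_floor)
    next
      case False
      then have "int N \<le> \<lfloor>t * N\<rfloor>" by linarith
      then have "real N \<le> t * N" by (simp add: le_floor_iff)
      moreover have "k = N - 1" using False by (simp add: k_def)
      moreover have "t * N \<le> real N" using t by (auto intro: mult_left_le_one_le)
      ultimately show ?thesis using N by auto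
    qed
    then have "real k * (2 * R) \<le> t * N * (2 * R)" "t * N * (2 * R) \<le> (real k + 1) * (2 * R)"
      using R by (auto intro!: mult_right_mono)
    moreover have "t * N * (2 * R) = t * (2 * real N * R)" by simp
    ultimately have "real k * (2 * R) \<le> t" "t \<le> (real k + 1) * (2 * R)" unfolding two by simp_all
    then have "\<bar>t - c k\<bar> \<le> R" by (simp add: c_def algebra_simps abs_le_iff)
    with k show ?thesis by blast
  qed
  define Y where "Y = c ` {..<N}"
  have Y01: "cball y R \<subseteq> {0..1}" if "y \<in> Y" for y
    using that c_in by (fastforce simp: Y_def dist_real_def abs_le_iff)
  have Yin: "y \<in> {0..1}" if "y \<in> Y" for y
    using Y01[OF that] centre_in_cball[of y R] R by (meson less_imp_le subsetD)
  have "\<exists>w\<in>Y. \<bar>f y - w\<bar> \<le> R" if "y \<in> Y" for y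
    using c_near[OF self_mapsD(2)[OF f Yin[OF that]]] by (auto simp: Y_def)
  then obtain \<sigma> where \<sigma>: "\<And>y. y \<in> Y \<Longrightarrow> \<sigma> y \<in> Y" "\<And>y. y \<in> Y \<Longrightarrow> \<bar>f y - \<sigma> y\<bar> \<le> R" by metis
  have sepR: "2 * R \<le> \<bar>y - y'\<bar>" if yy: "y \<in> Y" "y' \<in> Y" "y \<noteq> y'" for y y'
  proof -
    obtain k l where "y = c k" "y' = c l" using yy by (auto simp: Y_def)
    then show ?thesis using c_sep[of k l] yy(3) by auto
  qed
  have RN: "2 * R = 1 / real N" by (simp add: R_def)
  obtain f1 where f1: "f1 \<in> mspace self_maps" "mdist self_maps f f1 \<le> h"
    "\<And>x y. \<lbrakk>y \<in> Y; x \<in> {0..1}; \<bar>x - y\<bar> \<le> r\<rbrakk> \<Longrightarrow> f1 x = \<sigma> y"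
  proof (rule plateau_map[OF f _ r(2) sepR, of Y \<sigma> h])
    show "\<bar>f x - \<sigma> y\<bar> \<le> h" if "y \<in> Y" "x \<in> {0..1}" "\<bar>x - y\<bar> < R" for x y
      using d0(2)[OF that(2) Yin[OF that(1)]] \<sigma>(2)[OF that(1)] that(3) N(3,4) RN by linarith
    show "\<sigma> y \<in> {0..1}" if "y \<in> Y" for y using \<sigma>(1) Yin that by blast
  qed (use h in \<open>auto simp: Y_def\<close>)
  define J where "J = (\<Union>k<N. {c k - r..c k + r})"
  have Jb: "J \<in> sets borel" unfolding J_def by auto
  have "emeasure lborel ({0..1} - J) \<le> ennreal (1 / real q)"
  proof -
    have J01: "J \<subseteq> {0..1}"
    proof
      fix x assume "x \<in> J"
      then obtain k where "k < N" "c k - r \<le> x" "x \<le> c k + r" by (auto simp: J_def)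
      then show "x \<in> {0..1}" using c_in[of k] r by auto
    qed
    have "disjoint_family_on (\<lambda>k. {c k - r..c k + r}) {..<N}"
      unfolding disjoint_family_on_def
    proof (intro ballI impI)
      fix k l :: nat assume "k \<noteq> l"
      then show "{c k - r..c k + r} \<inter> {c l - r..c l + r} = {}" using c_sep[of k l] r by auto
    qed
    then have "emeasure lborel J = (\<Sum>k<N. emeasure lborel {c k - r..c k + r})"
      unfolding J_def by (intro sum_emeasure[symmetric]) auto
    also have "\<dots> = (\<Sum>k<N. ennreal (2 * r))" using r by (intro sum.cong) auto
    also have "\<dots> = ennreal (N * (2 * r))" using r by (simp add: ennreal_mult ennreal_of_nat_eq_real_of_nat)
    also have "N * (2 * r) = (2 * real N * R) * (1 - 1 / (2 * real q))" by (simp only: r_def mult_ac)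
    also have "\<dots> = 1 - 1 / (2 * real q)" unfolding two by simp
    finally have eJ: "emeasure lborel J = ennreal (1 - 1 / (2 * real q))" .
    have "emeasure lborel ({0..1} - J) = emeasure lborel {0..1::real} - emeasure lborel J"
      using Jb J01 eJ by (intro emeasure_Diff) auto
    also have "\<dots> = ennreal (1 - (1 - 1 / (2 * real q)))"
      unfolding eJ using q by (subst ennreal_minus[symmetric]) (auto simp: field_simps)
    also have "\<dots> \<le> ennreal (1 / real q)" using q by (intro ennreal_leI) (simp add: field_simps)
    finally show ?thesis .
  qed
  moreover have "J \<subseteq> entering g q" if g: "g \<in> mspace self_maps" "mdist self_maps f1 g \<le> r / 2" for g
  proof -
    interpret plateaus g Y \<sigma> r "r / 2"
    proof
      show "\<bar>g x - \<sigma> y\<bar> \<le> r / 2" if "y \<in> Y" "\<bar>x - y\<bar> \<le> r" for x y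
      proof -
        have "x \<in> {0..1}" using Y01[OF that(1)] that(2) r by (auto simp: subset_iff dist_real_def)
        then show ?thesis
          using f1(3)[OF that(1) _ that(2)] g(2) unfolding mdist_self_maps_le[OF f1(1) g(1)] by (metis abs_minus_commute)
      qed
      show "cball y r \<subseteq> {0..1}" if "y \<in> Y" for y
        by (rule subset_trans[OF subset_cball Y01[OF that]]) (use r in simp)
      show "2 * r < \<bar>y - y'\<bar>" if "y \<in> Y" "y' \<in> Y" "y \<noteq> y'" for y y' using sepR[OF that] r by simp
    qed (use g r \<sigma> in \<open>auto simp: Y_def\<close>)
    have "1 / real N \<le> 1 / real q" using N q by (simp add: frac_le)
    then have q': "2 * r < 1 / real q" using r RN by linarith
    have "{c k - r..c k + r} \<subseteq> entering g q" if "k < N" for k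
    proof -
      have "c k \<in> Y" using that by (simp add: Y_def)
      from plateau_subset_entering[OF this q'] show ?thesis
        by (auto simp: subset_iff dist_real_def abs_le_iff)
    qed
    then show ?thesis by (auto simp: J_def)
  qed
  ultimately show thesis using f1 r Jb by (intro that[of f1 "r / 2"]) auto
qed

text \<open>A pseudo-orbit may visit a point several times, or an endpoint of the interval; around distinct
  interior points there is room for disjoint plateaus.\<close>

lemma distinct_nearby_points:
  fixes z :: "nat \<Rightarrow> real"
  assumes z: "\<And>l. l < p \<Longrightarrow> z l \<in> {0..1}" and t: "t > 0"
  obtains y where "inj_on y {..<p}" "\<And>l. l < p \<Longrightarrow> y l \<in> {0<..<1}" "\<And>l. l < p \<Longrightarrow> \<bar>y l - z l\<bar> < t"
proof -
  have "\<exists>y. inj_on y {..<p} \<and> (\<forall>l<p. y l \<in> {0<..<1} \<and> \<bar>y l - z l\<bar> < t)"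
    using z
  proof (induction p)
    case (Suc p)
    then obtain y where y: "inj_on y {..<p}" "\<And>l. l < p \<Longrightarrow> y l \<in> {0<..<1} \<and> \<bar>y l - z l\<bar> < t" by auto
    have "max 0 (z p - t) < min 1 (z p + t)" using Suc.prems[of p] t by auto
    then have "infinite {max 0 (z p - t)<..<min 1 (z p + t)}" by (rule infinite_Ioo)
    then have "{max 0 (z p - t)<..<min 1 (z p + t)} - y ` {..<p} \<noteq> {}"
      by (metis finite.emptyI finite_Diff2 finite_imageI finite_lessThan)
    then obtain w where "w \<in> {max 0 (z p - t)<..<min 1 (z p + t)}" and w3: "w \<notin> y ` {..<p}"
      by blast
    then have w: "w \<in> {0<..<1}" "\<bar>w - z p\<bar> < t" "w \<notin> y ` {..<p}" by auto
    have "inj_on (y(p := w)) {..<Suc p}"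
      using y(1) w(3) by (auto simp: lessThan_Suc inj_on_def)
    moreover have "\<forall>l<Suc p. (y(p := w)) l \<in> {0<..<1} \<and> \<bar>(y(p := w)) l - z l\<bar> < t"
      using y(2) w by (auto simp: less_Suc_eq)
    ultimately show ?case by blast
  qed auto
  then show thesis using that by blast
qed

text \<open>Plateaus about the points of a closed pseudo-orbit turn it into the cycle of a shrinking interval.
  The invariant measures on this cycle have almost the averages of the pseudo-orbit, hence those of
  \<open>\<mu>\<close>.\<close>

lemma (in dense_self_maps) ergodic_perturbation:
  assumes f: "f \<in> mspace self_maps" and \<mu>: "\<mu> \<in> ergodic_measures f"
    and e: "e > 0" and h: "h > 0" and q: "q \<ge> 1"
  obtains f1 d where "f1 \<in> mspace self_maps" "mdist self_maps f f1 \<le> h" "d > 0"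
    "\<And>g. \<lbrakk>g \<in> mspace self_maps; mdist self_maps f1 g \<le> d\<rbrakk> \<Longrightarrow>
      \<exists>\<nu>\<in>shrinked_periodic q g. \<forall>i<N. \<bar>integral\<^sup>L \<nu> (\<Psi> i) - integral\<^sup>L \<mu> (\<Psi> i)\<bar> < e"
proof -
  obtain p z where p: "p \<ge> 1" and z: "\<And>l. l < p \<Longrightarrow> z l \<in> {0..1}"
    and zf: "\<And>l. l < p \<Longrightarrow> \<bar>f (z l) - z (Suc l mod p)\<bar> < h / 3"
    and zav: "\<And>i. i < N \<Longrightarrow> \<bar>(\<Sum>l<p. \<Psi> i (z l)) / p - integral\<^sup>L \<mu> (\<Psi> i)\<bar> < e / 3"
    using ergodic_closed_pseudo_orbit[OF f \<mu>, of "e / 3" "h / 3" N] e h by (metis divide_pos_pos zero_less_numeral)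
  obtain df where df: "df > 0" "\<And>x y. \<lbrakk>x \<in> {0..1}; y \<in> {0..1}; \<bar>x - y\<bar> < df\<rbrakk> \<Longrightarrow> \<bar>f x - f y\<bar> < h / 3"
    using self_map_modulus[OF f, of "h / 3"] h by (metis divide_pos_pos zero_less_numeral)
  have "\<exists>d>0. \<forall>x\<in>{0..1}. \<forall>y\<in>{0..1}. \<bar>x - y\<bar> < d \<longrightarrow> \<bar>\<Psi> i x - \<Psi> i y\<bar> < e / 3" for i
    using self_map_modulus[OF Psi_self_map[of i], of "e / 3"] e by (metis divide_pos_pos zero_less_numeral)
  then obtain dP where dP: "\<And>i. dP i > 0"
    "\<And>i x y. \<lbrakk>x \<in> {0..1}; y \<in> {0..1}; \<bar>x - y\<bar> < dP i\<rbrakk> \<Longrightarrow> \<bar>\<Psi> i x - \<Psi> i y\<bar> < e / 3"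
    by metis
  \<comment> \<open>The points move by at most \<open>t\<close> and the plateaus have radius at most \<open>t\<close>, hence the factor 2.\<close>
  define t where "t = Min ({df / 2, h / 3} \<union> (\<lambda>i. dP i / 2) ` {..<N})"
  have "t \<in> {df / 2, h / 3} \<union> (\<lambda>i. dP i / 2) ` {..<N}" unfolding t_def by (intro Min_in) auto
  then have t: "t > 0" using df(1) h dP(1) by auto
  have "t \<le> df / 2" "t \<le> h / 3" unfolding t_def by (intro Min_le; simp)+
  then have tle: "2 * t \<le> df" "t \<le> h / 3" by simp_all
  have tdP: "2 * t \<le> dP i" if "i < N" for i
  proof -
    have "t \<le> dP i / 2" unfolding t_def using that by (intro Min_le) auto
    then show ?thesis by simp
  qed
  obtain y where inj: "inj_on y {..<p}" and y01: "\<And>l. l < p \<Longrightarrow> y l \<in> {0<..<1}"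
    and yz: "\<And>l. l < p \<Longrightarrow> \<bar>y l - z l\<bar> < t"
    using distinct_nearby_points[of p z t, OF z t] by metis
  define Y where "Y = y ` {..<p}"
  \<comment> \<open>\<open>R\<close> fits between any two points, between each point and the ends of the interval, and below both scales.\<close>
  define gaps where "gaps = {t, 1 / real q} \<union> (\<lambda>l. y l) ` {..<p} \<union> (\<lambda>l. 1 - y l) ` {..<p} \<union>
    (\<lambda>(k, l). \<bar>y k - y l\<bar> / 2) ` {(k, l) \<in> {..<p} \<times> {..<p}. k \<noteq> l}"
  have fin: "finite gaps" unfolding gaps_def
    by (intro finite_UnI finite_imageI) (auto intro: finite_subset[of _ "{..<p} \<times> {..<p}"])
  define R where "R = Min gaps"
  have "R \<in> gaps" unfolding R_def using fin by (intro Min_in) (auto simp: gaps_def)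
  then have R0: "R > 0" using t q y01 inj_onD[OF inj] by (auto simp: gaps_def)
  have "R \<le> a" if "a \<in> gaps" for a unfolding R_def using fin that by (rule Min_le)
  note Rle = this[unfolded gaps_def]
  have Rt: "R \<le> t" and Rq: "R \<le> 1 / real q" by (intro Rle; simp)+
  have Ry: "R \<le> y l" "R \<le> 1 - y l" if "l < p" for l using that by (intro Rle; auto)+
  have Rsep: "2 * R \<le> \<bar>y k - y l\<bar>" if "k < p" "l < p" "k \<noteq> l" for k l
  proof -
    have "R \<le> \<bar>y k - y l\<bar> / 2" using that by (intro Rle) force
    then show ?thesis by simp
  qed
  define \<sigma> where "\<sigma> w = y (Suc (the_inv_into {..<p} y w) mod p)" for w
  have \<sigma>y: "\<sigma> (y l) = y (Suc l mod p)" if "l < p" for l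
    using the_inv_into_f_f[OF inj, of l] that by (simp add: \<sigma>_def)
  have \<sigma>n: "(\<sigma> ^^ n) (y 0) = y (n mod p)" for n
  proof (induction n)
    case (Suc n)
    have "\<sigma> (y (n mod p)) = y (Suc (n mod p) mod p)" using p by (intro \<sigma>y) auto
    then show ?case using Suc by (simp add: mod_Suc_eq)
  qed simp
  have sepR: "2 * R \<le> \<bar>w - w'\<bar>" if ww: "w \<in> Y" "w' \<in> Y" "w \<noteq> w'" for w w'
  proof -
    obtain k l where "k < p" "l < p" "w = y k" "w' = y l" using ww by (auto simp: Y_def)
    then show ?thesis using Rsep[of k l] ww(3) by auto
  qed
  have mod_less: "n mod p < p" for n using p by simp
  have \<sigma>Y: "\<sigma> w \<in> Y" if "w \<in> Y" for w using that \<sigma>y mod_less by (auto simp: Y_def)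
  have Y01: "w \<in> {0..1}" if "w \<in> Y" for w using that y01 by (force simp: Y_def)
  define r where "r = R / 3"
  have r: "0 < r" "r < R" using R0 by (auto simp: r_def)
  obtain f1 where f1: "f1 \<in> mspace self_maps" "mdist self_maps f f1 \<le> h"
    "\<And>x w. \<lbrakk>w \<in> Y; x \<in> {0..1}; \<bar>x - w\<bar> \<le> r\<rbrakk> \<Longrightarrow> f1 x = \<sigma> w"
  proof (rule plateau_map[OF f _ r(2) sepR, of Y \<sigma> h])
    show "\<bar>f x - \<sigma> w\<bar> \<le> h" if w: "w \<in> Y" and x: "x \<in> {0..1}" "\<bar>x - w\<bar> < R" for x w
    proof -
      obtain l where l: "l < p" "w = y l" using w by (auto simp: Y_def)
      have "\<bar>x - z l\<bar> < df" using x(2) yz[OF l(1)] Rt tle(1) l(2) by linarith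
      then have "\<bar>f x - f (z l)\<bar> < h / 3" by (intro df(2) x z l)
      then show ?thesis
        using zf[OF l(1)] yz[OF mod_less, of "Suc l"] tle(2) unfolding l(2) \<sigma>y[OF l(1)] by linarith
    qed
    show "\<sigma> w \<in> {0..1}" if "w \<in> Y" for w using \<sigma>Y Y01 that by blast
  qed (use h in \<open>auto simp: Y_def\<close>)
  have "\<exists>\<nu>\<in>shrinked_periodic q g. \<forall>i<N. \<bar>integral\<^sup>L \<nu> (\<Psi> i) - integral\<^sup>L \<mu> (\<Psi> i)\<bar> < e"
    if g: "g \<in> mspace self_maps" "mdist self_maps f1 g \<le> r / 2" for g
  proof -
    have ballY: "cball w r \<subseteq> {0..1}" if "w \<in> Y" for w
      using that Ry r by (fastforce simp: Y_def dist_real_def abs_le_iff)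
    interpret plateaus g Y \<sigma> r "r / 2"
    proof
      show "\<bar>g x - \<sigma> w\<bar> \<le> r / 2" if "w \<in> Y" "\<bar>x - w\<bar> \<le> r" for x w
      proof -
        have "x \<in> {0..1}" using ballY[OF that(1)] that(2) by (auto simp: subset_iff dist_real_def)
        then show ?thesis
          using f1(3)[OF that(1) _ that(2)] g(2) unfolding mdist_self_maps_le[OF f1(1) g(1)] by (metis abs_minus_commute)
      qed
      show "2 * r < \<bar>w - w'\<bar>" if "w \<in> Y" "w' \<in> Y" "w \<noteq> w'" for w w' using sepR[OF that] r by simp
    qed (use g r \<sigma>Y ballY in \<open>auto simp: Y_def\<close>)
    have y0: "y 0 \<in> Y" using p by (auto simp: Y_def)
    have per: "(\<sigma> ^^ p) (y 0) = y 0" by (simp add: \<sigma>n)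
    have injp: "inj_on (\<lambda>j. (\<sigma> ^^ j) (y 0)) {..<p}"
      unfolding \<sigma>n by (intro inj_onI) (use inj_onD[OF inj] in auto)
    note shr = shrinking_interval_ball[OF y0 p per injp]
    have len: "measure lebesgue (ball (y 0) r) < 1 / real q" using shr(2) Rq R0 by (simp add: r_def)
    obtain \<nu> where \<nu>: "\<nu> \<in> shrinked_periodic q g" "measure \<nu> (cycle g p (ball (y 0) r)) = 1"
      using shrinking_interval_periodic_measure[OF g(1) shr(1) len] by metis
    have \<nu>i: "\<nu> \<in> invariant_measures g" using shrinked_periodic_subset[OF g(1)] \<nu>(1) by blast
    have "\<bar>integral\<^sup>L \<nu> (\<Psi> i) - integral\<^sup>L \<mu> (\<Psi> i)\<bar> < e" if i: "i < N" for i
    proof -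
      define a where "a j = (g ^^ j) (y 0)" for j
      have a01: "a j \<in> {0..1}" for j
        unfolding a_def by (rule iterate_self_map(1)[OF g(1) Y01[OF y0]])
      have 1: "\<bar>integral\<^sup>L \<nu> (\<Psi> i) - (\<Sum>j<p. \<Psi> i (a j)) / p\<bar> \<le> e / 3"
      proof (rule integral_near_cycle_average[OF g(1) shr(1) \<nu>i \<nu>(2) Psi_cont])
        show "\<bar>\<Psi> i x - \<Psi> i w\<bar> \<le> e / 3"
          if "x \<in> {0..1}" "w \<in> {0..1}" "\<bar>x - w\<bar> \<le> measure lebesgue (ball (y 0) r)" for x w
          using dP(2)[OF that(1,2), of i] that(3) shr(2) Rt tdP[OF i] r t by (simp add: r_def)
        have "y 0 \<in> closure (ball (y 0) r)" using r closure_subset by fastforce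
        then show "a j \<in> (g ^^ j) ` closure (ball (y 0) r)" for j unfolding a_def by blast
      qed
      have "\<bar>\<Psi> i (a j) - \<Psi> i (z j)\<bar> \<le> e / 3" if j: "j < p" for j
      proof -
        have "\<bar>a j - y j\<bar> \<le> r" using iterate_near'[OF y0, of "y 0" j] r \<sigma>n[of j] j by (simp add: a_def)
        then have "\<bar>a j - z j\<bar> < dP i" using yz[OF j] r Rt tdP[OF i] by linarith
        then show ?thesis using dP(2)[OF a01 z[OF j]] by (auto intro: less_imp_le)
      qed
      then have "\<bar>\<Sum>j<p. \<Psi> i (a j) - \<Psi> i (z j)\<bar> \<le> (\<Sum>j<p. e / 3)"
        by (intro order_trans[OF sum_abs] sum_mono) auto
      then have "\<bar>(\<Sum>j<p. \<Psi> i (a j)) - (\<Sum>j<p. \<Psi> i (z j))\<bar> / p \<le> e / 3"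
        using p by (simp add: sum_subtractf field_simps)
      then have 2: "\<bar>(\<Sum>j<p. \<Psi> i (a j)) / p - (\<Sum>j<p. \<Psi> i (z j)) / p\<bar> \<le> e / 3"
        by (simp add: diff_divide_distrib[symmetric])
      show ?thesis using 1 2 zav[OF i] by linarith
    qed
    with \<nu>(1) show ?thesis by blast
  qed
  with f1 r show thesis by (intro that[of f1 "r / 2"]) auto
qed

section \<open>Typical maps\<close>

text \<open>The interior of \<open>S\<close> together with the complement of the closure of this interior is open and dense.
  If every map in \<open>V\<close> is a limit of interior points of \<open>S\<close>, then a map of this open dense set which
  lies in \<open>V\<close> lies in \<open>S\<close>.\<close>

lemma holds_typicallyI:
  assumes cnt: "countable \<P>"
    and dense: "\<And>V S f h. \<lbrakk>(V, S) \<in> \<P>; f \<in> mspace self_maps; f \<in> V; h > 0\<rbrakk> \<Longrightarrow>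
      \<exists>f1\<in>mspace self_maps. mdist self_maps f f1 \<le> h \<and>
        (\<exists>d>0. \<forall>g\<in>mspace self_maps. mdist self_maps f1 g \<le> d \<longrightarrow> g \<in> S)"
    and P: "\<And>f. \<lbrakk>f \<in> mspace self_maps; \<And>V S. \<lbrakk>(V, S) \<in> \<P>; f \<in> V\<rbrakk> \<Longrightarrow> f \<in> S\<rbrakk> \<Longrightarrow> P f"
  shows "holds_typically P"
proof -
  let ?X = "mtopology_of self_maps"
  define T where "T S = ?X interior_of S \<union> (topspace ?X - ?X closure_of (?X interior_of S))" for S
  have T_open: "openin ?X (T S)" for S unfolding T_def by (intro openin_Un openin_diff) auto
  have T_dense: "?X closure_of (T S) = mspace self_maps" for S
  proof -
    have "topspace ?X \<subseteq> ?X closure_of (T S)"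
    proof
      fix f assume f: "f \<in> topspace ?X"
      show "f \<in> ?X closure_of (T S)"
      proof (cases "f \<in> ?X closure_of (?X interior_of S)")
        case True
        then show ?thesis using closure_of_mono[of "?X interior_of S" "T S" ?X] by (auto simp: T_def)
      next
        case False
        then have "f \<in> T S" using f by (simp add: T_def)
        then show ?thesis using closure_of_subset[OF openin_subset[OF T_open]] by blast
      qed
    qed
    then show ?thesis using closure_of_subset_topspace[of ?X "T S"] by auto
  qed
  define \<G> where "\<G> = insert (mspace self_maps) (T ` snd ` \<P>)"
  have \<G>: "countable \<G>" "\<And>U. U \<in> \<G> \<Longrightarrow> openin ?X U \<and> ?X closure_of U = mspace self_maps"
    using cnt T_open T_dense openin_topspace[of ?X] closure_of_topspace[of ?X] by (auto simp: \<G>_def)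
  define G where "G = \<Inter>\<G>"
  have sub: "G \<subseteq> mspace self_maps" by (auto simp: G_def \<G>_def)
  have "gdelta_in ?X G"
    unfolding G_def using \<G> by (intro gdelta_in_Inter) (auto simp: \<G>_def intro: open_imp_gdelta_in)
  moreover have "dense_in_space ?X G"
    unfolding dense_in_space_def using sub SM.metric_Baire_category[OF mcomplete_self_maps \<G>]
    by (simp add: G_def)
  moreover have "P f" if f: "f \<in> G" for f
  proof (rule P)
    show fm: "f \<in> mspace self_maps" using f sub by blast
    fix V S assume VS: "(V, S) \<in> \<P>" "f \<in> V"
    have "f \<in> ?X closure_of (?X interior_of S)"
      unfolding in_closure_of_self_maps
    proof (intro conjI fm allI impI)
      fix h :: real assume h: "h > 0"
      then obtain f1 d where f1: "f1 \<in> mspace self_maps" "mdist self_maps f f1 \<le> h / 2" "d > 0"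
        and d: "\<And>g. g \<in> mspace self_maps \<Longrightarrow> mdist self_maps f1 g \<le> d \<Longrightarrow> g \<in> S"
        using dense[OF VS(1) fm VS(2), of "h / 2"] by (meson half_gt_zero)
      have "SM.mball f1 d \<subseteq> S" using d by (auto simp: SM.in_mball)
      then have "f1 \<in> ?X interior_of S"
        using SM.openin_mball[of f1 d] SM.centre_in_mball_iff[of f1 d] f1 unfolding interior_of_def by blast
      then show "\<exists>g\<in>?X interior_of S. g \<in> mspace self_maps \<and> mdist self_maps f g < h"
        using f1 h by (intro bexI[of _ f1]) auto
    qed
    moreover have "f \<in> T S" using f VS(1) by (force simp: G_def \<G>_def)
    ultimately have "f \<in> ?X interior_of S" by (auto simp: T_def)
    then show "f \<in> S" using interior_of_subset[of ?X S] by blast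
  qed
  ultimately show ?thesis unfolding holds_typically_def by blast
qed

context dense_self_maps
begin

text \<open>Finitely many integrals up to a rational error describe a countable base of the weak-star
  topology. The tolerance is larger for the periodic measures, which leaves room for the
  perturbation.\<close>

definition ergodic_near :: "rat list \<Rightarrow> nat \<Rightarrow> (real \<Rightarrow> real) set" where
  "ergodic_near cs k = {f. \<exists>\<mu>\<in>ergodic_measures f.
     \<forall>i<length cs. \<bar>integral\<^sup>L \<mu> (\<Psi> i) - of_rat (cs ! i)\<bar> < 1 / Suc k}"

definition shrinked_near :: "rat list \<Rightarrow> nat \<Rightarrow> nat \<Rightarrow> (real \<Rightarrow> real) set" where
  "shrinked_near cs k q = {f. \<exists>\<nu>\<in>shrinked_periodic q f.
     \<forall>i<length cs. \<bar>integral\<^sup>L \<nu> (\<Psi> i) - of_rat (cs ! i)\<bar> < 2 / Suc k}"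

lemma ergodic_subset_closure_shrinked_periodic:
  assumes f: "f \<in> mspace self_maps"
    and imp: "\<And>cs k. f \<in> ergodic_near cs k \<Longrightarrow> f \<in> shrinked_near cs k q"
  shows "ergodic_measures f \<subseteq> weak_star closure_of shrinked_periodic q f"
proof
  fix \<mu> assume \<mu>: "\<mu> \<in> ergodic_measures f"
  then have u: "\<mu> \<in> unit_probs" by (simp add: ergodic_measures_def invariant_measures_def)
  show "\<mu> \<in> weak_star closure_of shrinked_periodic q f"
    unfolding in_weak_star_closure
  proof (intro conjI u allI impI)
    fix e :: real assume e: "e > 0"
    obtain N where N: "\<And>\<mu> \<nu>. \<lbrakk>\<mu> \<in> unit_probs; \<nu> \<in> unit_probs;
      \<And>i. i < N \<Longrightarrow> \<bar>integral\<^sup>L \<mu> (\<Psi> i) - integral\<^sup>L \<nu> (\<Psi> i)\<bar> \<le> e / 2\<rbrakk> \<Longrightarrow> meas_dist \<Psi> \<mu> \<nu> < e"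
      using meas_dist_less_criterion[OF e] by metis
    obtain k where k: "1 / real (Suc k) < e / 6"
      using reals_Archimedean[of "e / 6"] e by (auto simp: inverse_eq_divide)
    have "\<exists>c. \<bar>integral\<^sup>L \<mu> (\<Psi> i) - of_rat c\<bar> < 1 / Suc k" for i
    proof -
      obtain c where "integral\<^sup>L \<mu> (\<Psi> i) < of_rat c" "of_rat c < integral\<^sup>L \<mu> (\<Psi> i) + 1 / Suc k"
        using of_rat_dense[of "integral\<^sup>L \<mu> (\<Psi> i)" "integral\<^sup>L \<mu> (\<Psi> i) + 1 / Suc k"] by auto
      then show ?thesis by (intro exI[of _ c]) auto
    qed
    then obtain c where c: "\<And>i. \<bar>integral\<^sup>L \<mu> (\<Psi> i) - of_rat (c i)\<bar> < 1 / Suc k" by metis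
    define cs where "cs = map c [0..<N]"
    have "f \<in> ergodic_near cs k"
      unfolding ergodic_near_def cs_def using \<mu> c by (auto intro!: bexI[of _ \<mu>])
    then have "f \<in> shrinked_near cs k q" by (rule imp)
    then obtain \<nu> where \<nu>: "\<nu> \<in> shrinked_periodic q f"
      "\<And>i. i < N \<Longrightarrow> \<bar>integral\<^sup>L \<nu> (\<Psi> i) - of_rat (c i)\<bar> < 2 / Suc k"
      unfolding shrinked_near_def cs_def by auto
    have \<nu>u: "\<nu> \<in> unit_probs"
      using shrinked_periodic_subset[OF f] \<nu>(1) invariant_measures_unit_probs by blast
    have "meas_dist \<Psi> \<nu> \<mu> < e"
    proof (rule N[OF \<nu>u u])
      fix i assume i: "i < N"
      have "2 / real (Suc k) = 2 * (1 / real (Suc k))" by simp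
      then show "\<bar>integral\<^sup>L \<nu> (\<Psi> i) - integral\<^sup>L \<mu> (\<Psi> i)\<bar> \<le> e / 2"
        using \<nu>(2)[OF i] c[of i] k by linarith
    qed
    then show "\<exists>\<nu>\<in>shrinked_periodic q f \<inter> unit_probs. meas_dist \<Psi> \<nu> \<mu> < e" using \<nu>(1) \<nu>u by blast
  qed
qed

lemma shrinked_near_perturbation:
  assumes f: "f \<in> mspace self_maps" "f \<in> ergodic_near cs k" and h: "h > 0" and q: "q \<ge> 1"
  shows "\<exists>f1\<in>mspace self_maps. mdist self_maps f f1 \<le> h \<and>
    (\<exists>d>0. \<forall>g\<in>mspace self_maps. mdist self_maps f1 g \<le> d \<longrightarrow> g \<in> shrinked_near cs k q)"
proof -
  obtain \<mu> where \<mu>: "\<mu> \<in> ergodic_measures f"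
    "\<And>i. i < length cs \<Longrightarrow> \<bar>integral\<^sup>L \<mu> (\<Psi> i) - of_rat (cs ! i)\<bar> < 1 / Suc k"
    using f(2) by (auto simp: ergodic_near_def)
  obtain f1 d where f1: "f1 \<in> mspace self_maps" "mdist self_maps f f1 \<le> h" "d > 0"
    and near: "\<And>g. \<lbrakk>g \<in> mspace self_maps; mdist self_maps f1 g \<le> d\<rbrakk> \<Longrightarrow>
      \<exists>\<nu>\<in>shrinked_periodic q g. \<forall>i<length cs. \<bar>integral\<^sup>L \<nu> (\<Psi> i) - integral\<^sup>L \<mu> (\<Psi> i)\<bar> < 1 / Suc k"
    using ergodic_perturbation[OF f(1) \<mu>(1) _ h q, of "1 / Suc k" "length cs"] by (metis of_nat_0_less_iff zero_less_Suc zero_less_divide_1_iff)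
  have "g \<in> shrinked_near cs k q" if g: "g \<in> mspace self_maps" "mdist self_maps f1 g \<le> d" for g
  proof -
    obtain \<nu> where \<nu>: "\<nu> \<in> shrinked_periodic q g"
      "\<And>i. i < length cs \<Longrightarrow> \<bar>integral\<^sup>L \<nu> (\<Psi> i) - integral\<^sup>L \<mu> (\<Psi> i)\<bar> < 1 / Suc k"
      using near[OF g] by blast
    have "\<bar>integral\<^sup>L \<nu> (\<Psi> i) - of_rat (cs ! i)\<bar> < 2 / Suc k" if i: "i < length cs" for i
    proof -
      have "2 / real (Suc k) = 1 / real (Suc k) + 1 / real (Suc k)" by simp
      then show ?thesis using \<nu>(2)[OF i] \<mu>(2)[OF i] by linarith
    qed
    then show ?thesis unfolding shrinked_near_def using \<nu>(1) by blast
  qed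
  with f1 show ?thesis by blast
qed

end

theorem theorem24:
  fixes \<Psi> :: "nat \<Rightarrow> real \<Rightarrow> real"
  assumes "dense_in_space (mtopology_of self_maps) (range \<Psi>)"
  shows "holds_typically (\<lambda>f.
    (\<forall>\<epsilon>>0. periodic_measures f
        \<subseteq> (\<Inter>q\<in>{1..}. weak_star closure_of almost_shrinked_periodic \<Psi> \<epsilon> q f)) \<and>
    (\<Inter>\<epsilon>\<in>{0<..}. \<Inter>q\<in>{1..}. weak_star closure_of almost_shrinked_periodic \<Psi> \<epsilon> q f)
      = pseudo_physical \<Psi> f \<and>
    pseudo_physical \<Psi> f = weak_star closure_of infinitely_shrinked f \<and>
    weak_star closure_of infinitely_shrinked f = weak_star closure_of ergodic_measures f \<and>
    weak_star closure_of ergodic_measures f = weak_star closure_of periodic_measures f \<and>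
    (\<forall>\<mu>\<in>ergodic_measures f. \<mu> \<in> pseudo_physical \<Psi> f))"
proof -
  interpret dense_self_maps \<Psi> using assms by unfold_locales
  define mostly_entering where "mostly_entering q =
    {f. \<exists>J\<in>sets borel. J \<subseteq> entering f q \<and> emeasure lborel ({0..1} - J) \<le> ennreal (1 / real q)}" for q
  define \<P> where "\<P> = (\<lambda>(cs, k, q). (ergodic_near cs k, shrinked_near cs k q)) ` {(cs, k, q). q \<ge> 1} \<union>
    (\<lambda>q. (UNIV, mostly_entering q)) ` {1..}"
  show ?thesis
  proof (rule holds_typicallyI[of \<P>])
    show "countable \<P>" unfolding \<P>_def by (intro countable_Un countable_image) auto
    fix V S f and h :: real
    assume VS: "(V, S) \<in> \<P>" and f: "f \<in> mspace self_maps" "f \<in> V" and h: "h > 0"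
    show "\<exists>f1\<in>mspace self_maps. mdist self_maps f f1 \<le> h \<and>
        (\<exists>d>0. \<forall>g\<in>mspace self_maps. mdist self_maps f1 g \<le> d \<longrightarrow> g \<in> S)"
    proof -
      consider (erg) cs k q where "V = ergodic_near cs k" "S = shrinked_near cs k q" "q \<ge> 1"
        | (ent) q where "S = mostly_entering q" "q \<ge> 1"
        using VS by (auto simp: \<P>_def)
      then show ?thesis
      proof cases
        case erg
        then show ?thesis using shrinked_near_perturbation[of f cs k h q] f h by blast
      next
        case ent
        show ?thesis
          using grid_perturbation[OF f(1) h ent(2)] unfolding ent(1) mostly_entering_def mem_Collect_eq by metis
      qed
    qed
  next
    fix f assume f: "f \<in> mspace self_maps" and imp: "\<And>V S. \<lbrakk>(V, S) \<in> \<P>; f \<in> V\<rbrakk> \<Longrightarrow> f \<in> S"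
    have erg: "ergodic_measures f \<subseteq> weak_star closure_of shrinked_periodic q f" if "q \<ge> 1" for q
    proof (rule ergodic_subset_closure_shrinked_periodic[OF f])
      fix cs k assume "f \<in> ergodic_near cs k"
      then show "f \<in> shrinked_near cs k q"
        using imp[of "ergodic_near cs k" "shrinked_near cs k q"] that unfolding \<P>_def by force
    qed
    have "f \<in> mostly_entering q" if "q \<ge> 1" for q
      using imp[of UNIV "mostly_entering q"] that unfolding \<P>_def by blast
    then show "(\<forall>\<epsilon>>0. periodic_measures f
        \<subseteq> (\<Inter>q\<in>{1..}. weak_star closure_of almost_shrinked_periodic \<Psi> \<epsilon> q f)) \<and>
    (\<Inter>\<epsilon>\<in>{0<..}. \<Inter>q\<in>{1..}. weak_star closure_of almost_shrinked_periodic \<Psi> \<epsilon> q f)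
      = pseudo_physical \<Psi> f \<and>
    pseudo_physical \<Psi> f = weak_star closure_of infinitely_shrinked f \<and>
    weak_star closure_of infinitely_shrinked f = weak_star closure_of ergodic_measures f \<and>
    weak_star closure_of ergodic_measures f = weak_star closure_of periodic_measures f \<and>
    (\<forall>\<mu>\<in>ergodic_measures f. \<mu> \<in> pseudo_physical \<Psi> f)"
      by (intro abundance_implies_equalities[OF f erg]) (auto simp: mostly_entering_def)
  qed
qed

end
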